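(* Let $H$ be a complex Hilbert space with $\dim H>1$. Let $\phi:B_s(H)\to B_s(H)$ be a bijective map which preserves the order and the complementarity in both directions, i.e. for all $A,B\in B_s(H)$, \[ A\leq B \Longleftrightarrow \phi(A)\leq\phi(B), \] and $A$ and $B$ are complementary if and only if $\phi(A)$ and $\phi(B)$ are complementary. Then there are an either unitary or antiunitary operator $U:H\to H$, a positive scalar $\lambda$, and a real number $\mu$ such that \[ \phi(A)=\lambda UAU^* +\mu I \qquad \text{for all } A\in B_s(H). \]
   Context: $H$ is a complex Hilbert space (of arbitrary, possibly infinite, dimension). $B_s(H)$ denotes the set of all self-adjoint bounded linear operators on $H$, and $I$ is the identity operator. For $A,B\in B_s(H)$, $A\leq B$ means $\langle Ax,x\rangle\leq\langle Bx,x\rangle$ for every $x\in H$. Two operators $A,B\in B_s(H)$ are called complementary if the range of any nontrivial projection (i.e. different from $0$ and $I$) from the range of the spectral measure of $A$ has zero intersection with the range of any nontrivial projection from the range of the spectral measure of $B$; here the range of the spectral measure $E_A$ of $A$ is the set of projections $E_A(\Delta)$, $\Delta\subset\mathbb{R}$ Borel. No linearity or continuity of $\phi$ is assumed. An antiunitary operator is a bijective conjugate-linear isometry $U:H\to H$; for such $U$, the adjoint $U^*$ is the conjugate-linear operator determined by $\langle Ux,y\rangle=\langle U^*y,x\rangle$ for all $x,y\in H$, which equals $U^{-1}$. *)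

theory Defs
  imports "HOL-Analysis.Analysis"
begin

(* The inner product is linear in its first argument. The real inner product inherited from
   real_inner is tied to it by inner_eq_Re_cinner, so norm, topology and completeness are the
   usual ones, and positive definiteness of cinner is inherited. *)
class complex_hilbert_space = real_inner + complete_space +
  fixes scaleC :: "complex \<Rightarrow> 'a \<Rightarrow> 'a" (infixr "*\<^sub>C" 75)
    and cinner :: "'a \<Rightarrow> 'a \<Rightarrow> complex"
  assumes scaleC_add_right: "c *\<^sub>C (x + y) = c *\<^sub>C x + c *\<^sub>C y"
    and scaleC_add_left: "(c + d) *\<^sub>C x = c *\<^sub>C x + d *\<^sub>C x"
    and scaleC_scaleC: "c *\<^sub>C (d *\<^sub>C x) = (c * d) *\<^sub>C x"
    and scaleR_eq_scaleC: "r *\<^sub>R x = complex_of_real r *\<^sub>C x"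
    and cinner_commute: "cinner x y = cnj (cinner y x)"
    and cinner_add_left: "cinner (x + y) z = cinner x z + cinner y z"
    and cinner_scaleC_left: "cinner (c *\<^sub>C x) y = c * cinner x y"
    and inner_eq_Re_cinner: "inner x y = Re (cinner x y)"

instance complex_hilbert_space \<subseteq> banach ..

interpretation complex_vector:
  vector_space "scaleC :: complex \<Rightarrow> 'a \<Rightarrow> 'a::complex_hilbert_space"
proof
  fix x :: 'a
  show "1 *\<^sub>C x = x"
    using scaleR_eq_scaleC[of 1 x] by simp
qed (simp_all add: scaleC_add_right scaleC_add_left scaleC_scaleC)

definition bounded_clinear :: "('a::complex_hilbert_space \<Rightarrow> 'a) \<Rightarrow> bool" where
  "bounded_clinear A \<longleftrightarrow> bounded_linear A \<and> (\<forall>c x. A (c *\<^sub>C x) = c *\<^sub>C A x)"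

definition is_adjoint ::
  "('a::complex_hilbert_space \<Rightarrow> 'a) \<Rightarrow> ('a \<Rightarrow> 'a) \<Rightarrow> bool" where
  "is_adjoint A B \<longleftrightarrow> (\<forall>x y. cinner (A x) y = cinner x (B y))"

definition selfadjoint_ops :: "('a::complex_hilbert_space \<Rightarrow> 'a) set" where
  "selfadjoint_ops = {A. bounded_clinear A \<and> is_adjoint A A}"

(* For self-adjoint A the number cinner (A x) x is real, so Re loses nothing. *)
definition op_le ::
  "('a::complex_hilbert_space \<Rightarrow> 'a) \<Rightarrow> ('a \<Rightarrow> 'a) \<Rightarrow> bool" where
  "op_le A B \<longleftrightarrow> (\<forall>x. Re (cinner (A x) x) \<le> Re (cinner (B x) x))"

definition projections :: "('a::complex_hilbert_space \<Rightarrow> 'a) set" where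
  "projections = {P \<in> selfadjoint_ops. P \<circ> P = P}"

(* Projection-valued measures on the Borel sets of the line with bounded support, countably
   additive in the strong operator topology. Values off the Borel sets are irrelevant. *)
definition bounded_pvm :: "(real set \<Rightarrow> ('a::complex_hilbert_space \<Rightarrow> 'a)) \<Rightarrow> bool" where
  "bounded_pvm E \<longleftrightarrow>
     (\<forall>\<Delta>\<in>sets borel. E \<Delta> \<in> projections) \<and>
     E {} = (\<lambda>x. 0) \<and> E UNIV = id \<and>
     (\<exists>a. E {-a..a} = id) \<and>
     (\<forall>\<Delta>\<in>sets borel. \<forall>\<Gamma>\<in>sets borel. E (\<Delta> \<inter> \<Gamma>) = E \<Delta> \<circ> E \<Gamma>) \<and>
     (\<forall>D :: nat \<Rightarrow> real set. range D \<subseteq> sets borel \<longrightarrow> disjoint_family D \<longrightarrow>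
        (\<forall>x. (\<lambda>n. E (D n) x) sums E (\<Union>n. D n) x))"

definition scalar_measure ::
  "(real set \<Rightarrow> ('a::complex_hilbert_space \<Rightarrow> 'a)) \<Rightarrow> 'a \<Rightarrow> real measure" where
  "scalar_measure E x =
     measure_of UNIV (sets borel) (\<lambda>\<Delta>. ennreal (Re (cinner (E \<Delta> x) x)))"

(* E is the spectral measure of A: A is the integral of t with respect to E, in the weak
   sense. By polarization the diagonal values determine A. The spectral theorem says that for
   self-adjoint A such an E exists and that its values on Borel sets are unique. *)
definition is_spectral_measure ::
  "('a::complex_hilbert_space \<Rightarrow> 'a) \<Rightarrow> (real set \<Rightarrow> ('a \<Rightarrow> 'a)) \<Rightarrow> bool" where
  "is_spectral_measure A E \<longleftrightarrow>
     bounded_pvm E \<and>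
     (\<forall>x. cinner (A x) x = complex_of_real (\<integral>t. t \<partial>(scalar_measure E x)))"

definition spectral_range ::
  "('a::complex_hilbert_space \<Rightarrow> 'a) \<Rightarrow> ('a \<Rightarrow> 'a) set" where
  "spectral_range A = {E \<Delta> |E \<Delta>. is_spectral_measure A E \<and> \<Delta> \<in> sets borel}"

definition complementary ::
  "('a::complex_hilbert_space \<Rightarrow> 'a) \<Rightarrow> ('a \<Rightarrow> 'a) \<Rightarrow> bool" where
  "complementary A B \<longleftrightarrow>
     (\<forall>P \<in> spectral_range A - {\<lambda>x. 0, id}. \<forall>Q \<in> spectral_range B - {\<lambda>x. 0, id}.
        range P \<inter> range Q = {0})"

definition unitary_op :: "('a::complex_hilbert_space \<Rightarrow> 'a) \<Rightarrow> bool" where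
  "unitary_op U \<longleftrightarrow>
     bounded_clinear U \<and> (\<exists>V. is_adjoint U V \<and> V \<circ> U = id \<and> U \<circ> V = id)"

definition conjugate_linear :: "('a::complex_hilbert_space \<Rightarrow> 'a) \<Rightarrow> bool" where
  "conjugate_linear U \<longleftrightarrow>
     (\<forall>x y. U (x + y) = U x + U y) \<and> (\<forall>c x. U (c *\<^sub>C x) = cnj c *\<^sub>C U x)"

definition antiunitary_op :: "('a::complex_hilbert_space \<Rightarrow> 'a) \<Rightarrow> bool" where
  "antiunitary_op U \<longleftrightarrow> conjugate_linear U \<and> bij U \<and> (\<forall>x. norm (U x) = norm x)"

definition is_conj_adjoint ::
  "('a::complex_hilbert_space \<Rightarrow> 'a) \<Rightarrow> ('a \<Rightarrow> 'a) \<Rightarrow> bool" where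
  "is_conj_adjoint U V \<longleftrightarrow>
     conjugate_linear V \<and> (\<forall>x y. cinner (U x) y = cinner (V y) x)"

end

theory Submission
  imports Defs "HOL-Probability.Distribution_Functions"
begin

text \<open>
  Complementarity enters through the scalars. An operator is complementary to itself exactly when
  it is a real multiple of the identity (\<open>self_complementary_iff_scalar\<close>): a scalar has only
  trivial spectral projections, and the spectral theorem, of which the existence part is proved
  below, provides every other self-adjoint operator with a nontrivial one. Hence \<open>\<phi>\<close> maps scalars
  to scalars, say \<open>\<phi> 0 = m\<close> and \<open>\<phi> 1 = k\<close>, and \<open>(\<phi> A - m) / (k - m)\<close> is an order automorphism
  that fixes zero and the identity. It remains to see that such an automorphism is conjugation by
  a unitary or antiunitary operator (\<open>normalised_order_automorphism\<close>).

  Write \<open>rk x\<close> for the operator \<open>v \<mapsto> \<langle>v, x\<rangle> x\<close>. The operators \<open>A + rk x\<close> are those \<open>B\<close> above \<open>A\<close>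
  for which the order interval from \<open>A\<close> to \<open>B\<close> is a chain, so an order automorphism \<open>\<Phi>\<close> maps the line
  through \<open>A\<close> in direction \<open>rk x\<close> onto a line in some direction \<open>rk y\<close>. Two lines with the same
  direction lie below a common third one, pointwise, whereas a line is never dominated by a line of
  another direction; so \<open>y\<close> depends on \<open>x\<close> alone. In a parallelogram with two different rank-one
  directions both ways around lead to the same corner. Hence the way in which \<open>\<Phi>\<close> stretches a line
  is unaffected by a translation in another direction, and, since \<open>rk x\<close> is a combination of rank-one
  operators of other directions, also by a translation along the line itself. Such a stretching is
  additive and monotone, therefore linear. The outcome is \<open>affine_on_rank_one\<close>:
  \<open>\<Phi> (A + t rk x) = \<Phi> A + t rk (S x)\<close> for a map \<open>S\<close> that is determined up to phases.

  If \<open>\<Phi>\<close> fixes zero and the identity, \<open>S\<close> preserves norms and orthogonality. The phases are then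
  chosen by linearisation: \<open>x \<mapsto> rk (S x)\<close> is a quadratic map, and its derivative at a unit vector
  \<open>e\<close>, applied to \<open>S e\<close>, is a real-linear choice of \<open>S\<close> on the orthogonal complement of \<open>e\<close>. It
  commutes or anticommutes with the imaginary unit, which gives the unitary or antiunitary operator
  \<open>U\<close>. An arbitrary operator is finally compared at each vector with operators that differ from
  rank-one or from positive ones by multiples of \<open>rk x\<close>.

  For the spectral theorem, the spectral projection of \<open>A\<close> for \<open>(-\<infinity>, r]\<close> is the projection onto the
  kernel of the positive part of \<open>A - r\<close>; the absolute value that this requires is the limit of a
  norm-convergent iteration. The resulting right-continuous distribution functions define measures,
  and a Dynkin argument produces a projection for every Borel set.
\<close>

section \<open>The complex inner product\<close>

lemma scaleC_scaleR: "c *\<^sub>C (r *\<^sub>R x) = r *\<^sub>R (c *\<^sub>C (x :: 'a::complex_hilbert_space))"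
  by (simp add: scaleR_eq_scaleC scaleC_scaleC mult.commute)

lemma scaleC_real_imag:
  "c *\<^sub>C x = Re c *\<^sub>R x + Im c *\<^sub>R (\<i> *\<^sub>C (x :: 'a::complex_hilbert_space))"
proof -
  have "c = of_real (Re c) + of_real (Im c) * \<i>"
    by (simp add: complex_eq_iff)
  then show ?thesis
    by (metis scaleC_add_left scaleC_scaleC scaleR_eq_scaleC)
qed

lemma cinner_add_right: "cinner x (y + z) = cinner x y + cinner x (z :: 'a::complex_hilbert_space)"
  by (metis cinner_add_left cinner_commute complex_cnj_add)

lemma cinner_scaleC_right: "cinner x (c *\<^sub>C y) = cnj c * cinner x (y :: 'a::complex_hilbert_space)"
  by (metis cinner_scaleC_left cinner_commute complex_cnj_mult)

lemma cinner_zero_left [simp]: "cinner 0 (x :: 'a::complex_hilbert_space) = 0"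
  using cinner_scaleC_left[of 0 0 x] by simp

lemma cinner_zero_right [simp]: "cinner (x :: 'a::complex_hilbert_space) 0 = 0"
  using cinner_scaleC_right[of x 0 0] by simp

lemma cinner_minus_left: "cinner (- x) (y :: 'a::complex_hilbert_space) = - cinner x y"
  using cinner_scaleC_left[of "-1" x y] by simp

lemma cinner_minus_right: "cinner x (- y :: 'a::complex_hilbert_space) = - cinner x y"
  using cinner_scaleC_right[of x "-1" y] by simp

lemma cinner_diff_left: "cinner (x - y) (z :: 'a::complex_hilbert_space) = cinner x z - cinner y z"
  using cinner_add_left[of x "- y" z] by (simp add: cinner_minus_left)

lemma cinner_diff_right: "cinner x (y - z :: 'a::complex_hilbert_space) = cinner x y - cinner x z"
  using cinner_add_right[of x y "- z"] by (simp add: cinner_minus_right)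

lemma cinner_scaleR_left: "cinner (r *\<^sub>R x) (y :: 'a::complex_hilbert_space) = of_real r * cinner x y"
  by (simp add: scaleR_eq_scaleC cinner_scaleC_left)

lemma cinner_scaleR_right: "cinner x (r *\<^sub>R y :: 'a::complex_hilbert_space) = of_real r * cinner x y"
  by (simp add: scaleR_eq_scaleC cinner_scaleC_right)

lemmas cinner_simps = cinner_add_left cinner_add_right cinner_diff_left cinner_diff_right
  cinner_minus_left cinner_minus_right cinner_scaleC_left cinner_scaleC_right
  cinner_scaleR_left cinner_scaleR_right

lemma cinner_self: "cinner x x = of_real ((norm (x :: 'a::complex_hilbert_space))\<^sup>2)"
proof -
  have "Im (cinner x x) = 0"
    using arg_cong[OF cinner_commute[of x x], of Im] by simp
  moreover have "Re (cinner x x) = (norm x)\<^sup>2"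
    by (simp add: inner_eq_Re_cinner[symmetric] power2_norm_eq_inner)
  ultimately show ?thesis
    by (simp add: complex_eq_iff)
qed

lemma cinner_eq_inner:
  "cinner x y = Complex (inner x y) (inner x (\<i> *\<^sub>C (y :: 'a::complex_hilbert_space)))"
  by (simp add: complex_eq_iff inner_eq_Re_cinner cinner_scaleC_right)

lemma cinner_self_eq_0 [simp]: "cinner x x = 0 \<longleftrightarrow> x = (0 :: 'a::complex_hilbert_space)"
  by (simp add: cinner_self)

lemma cmod_cinner_commute: "cmod (cinner x y) = cmod (cinner y (x :: 'a::complex_hilbert_space))"
  by (subst cinner_commute) simp

lemma norm_scaleC: "norm (c *\<^sub>C x) = cmod c * norm (x :: 'a::complex_hilbert_space)"
proof -
  have "cinner (c *\<^sub>C x) (c *\<^sub>C x) = of_real ((cmod c)\<^sup>2) * cinner x x"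
    by (simp add: cinner_simps complex_norm_square del: of_real_power)
  then have "(norm (c *\<^sub>C x))\<^sup>2 = (cmod c * norm x)\<^sup>2"
    by (simp only: cinner_self of_real_mult[symmetric] of_real_eq_iff power_mult_distrib)
  then show ?thesis by simp
qed

lemma unimodular_rotation: "\<exists>u. cmod u = 1 \<and> u * z = of_real (cmod z)"
proof (cases "z = 0")
  case False
  then have "cmod (cnj z / of_real (cmod z)) = 1"
    by (simp add: norm_divide)
  moreover have "cnj z / of_real (cmod z) * z = of_real (cmod z)"
    using False complex_norm_square[of z] by (simp add: field_simps power2_eq_square)
  ultimately show ?thesis by blast
qed (auto intro: exI[of _ 1])

lemma complex_Cauchy_Schwarz: "cmod (cinner x y) \<le> norm x * norm (y :: 'a::complex_hilbert_space)"
proof -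
  obtain u where u: "cmod u = 1" "u * cinner x y = of_real (cmod (cinner x y))"
    using unimodular_rotation by blast
  then have "cmod (cinner x y) = inner (u *\<^sub>C x) y"
    by (simp add: inner_eq_Re_cinner cinner_scaleC_left)
  also have "\<dots> \<le> norm (u *\<^sub>C x) * norm y"
    by (rule norm_cauchy_schwarz)
  finally show ?thesis by (simp add: norm_scaleC u)
qed

lemma bounded_linear_scaleC: "bounded_linear (\<lambda>x. c *\<^sub>C (x :: 'a::complex_hilbert_space))"
  by (rule bounded_linear_intro[where K = "cmod c"])
     (simp_all add: scaleC_add_right scaleC_scaleR norm_scaleC mult.commute)

text \<open>Limits and projections are constructed in the underlying real Hilbert space; this criterion turns
  the results into complex self-adjoint operators.\<close>

lemma selfadjoint_iff_symmetric:
  "A \<in> selfadjoint_ops \<longleftrightarrow>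
     bounded_linear A \<and> (\<forall>x. A (\<i> *\<^sub>C x) = \<i> *\<^sub>C A x) \<and> (\<forall>x y. inner (A x) y = inner x (A y))"
  (is "?L \<longleftrightarrow> ?R")
proof
  assume ?L
  then show ?R
    by (auto simp: selfadjoint_ops_def bounded_clinear_def is_adjoint_def inner_eq_Re_cinner)
next
  assume R: ?R
  then have lin: "linear A" by (simp add: bounded_linear.linear)
  have "A (c *\<^sub>C x) = c *\<^sub>C A x" for c x
    using R by (subst (1 2) scaleC_real_imag) (simp add: linear_add[OF lin] linear_scale[OF lin])
  moreover have "cinner (A x) y = cinner x (A y)" for x y
    using R by (metis cinner_eq_inner)
  ultimately show ?L
    using R by (simp add: selfadjoint_ops_def bounded_clinear_def is_adjoint_def)
qed

section \<open>The ordered vector space of self-adjoint operators\<close>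

lemma selfadjoint_zero: "(\<lambda>x. 0) \<in> selfadjoint_ops"
  by (simp add: selfadjoint_iff_symmetric)

lemma selfadjoint_id: "(\<lambda>x. x) \<in> selfadjoint_ops"
  by (simp add: selfadjoint_iff_symmetric)

lemma selfadjoint_add:
  "A \<in> selfadjoint_ops \<Longrightarrow> B \<in> selfadjoint_ops \<Longrightarrow> (\<lambda>x. A x + B x) \<in> selfadjoint_ops"
  by (simp add: selfadjoint_iff_symmetric bounded_linear_add scaleC_add_right inner_add_left
      inner_add_right)

lemma selfadjoint_scaleR:
  "A \<in> selfadjoint_ops \<Longrightarrow> (\<lambda>x. r *\<^sub>R A x) \<in> selfadjoint_ops"
  by (simp add: selfadjoint_iff_symmetric bounded_linear_scaleR_const scaleC_scaleR
     bounded_linear_const_scaleR)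

lemma selfadjoint_minus: "A \<in> selfadjoint_ops \<Longrightarrow> (\<lambda>x. - A x) \<in> selfadjoint_ops"
  using selfadjoint_scaleR[of A "-1"] by simp

lemma selfadjoint_diff:
  "A \<in> selfadjoint_ops \<Longrightarrow> B \<in> selfadjoint_ops \<Longrightarrow> (\<lambda>x. A x - B x) \<in> selfadjoint_ops"
  using selfadjoint_add[OF _ selfadjoint_minus, of A B] by simp

text \<open>Polarization of the quadratic form; symmetry makes the two mixed terms equal.\<close>

lemma selfadjoint_eq_0_if_form_eq_0:
  assumes A: "A \<in> selfadjoint_ops" and form: "\<And>x. inner (A x) x = 0"
  shows "A x = 0"
proof -
  have lin: "linear A"
    using A by (simp add: selfadjoint_iff_symmetric bounded_linear.linear)
  have "inner (A x) y = 0" for x y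
  proof -
    have "inner (A (x + y)) (x + y) = inner (A x) x + inner (A y) y + 2 * inner (A x) y"
      using A by (simp add: selfadjoint_iff_symmetric linear_add[OF lin] inner_add_left
          inner_add_right inner_commute)
    then show ?thesis by (simp add: form)
  qed
  then show ?thesis by (metis inner_eq_zero_iff)
qed

lemma selfadjoint_eqI:
  assumes "A \<in> selfadjoint_ops" "B \<in> selfadjoint_ops" "\<And>x. inner (A x) x = inner (B x) x"
  shows "A = B"
proof
  fix x
  have "A x - B x = 0"
    by (rule selfadjoint_eq_0_if_form_eq_0[OF selfadjoint_diff[OF assms(1,2)]])
       (simp add: inner_diff_left assms(3))
  then show "A x = B x" by simp
qed

text \<open>A type of self-adjoint operators makes the real vector space structure and the operator order
  available as type class instances.\<close>

typedef (overloaded) 'a sa = "selfadjoint_ops :: ('a::complex_hilbert_space \<Rightarrow> 'a) set"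
  morphisms app Abs_sa
  using selfadjoint_zero by blast

setup_lifting type_definition_sa

instantiation sa :: (complex_hilbert_space) real_vector
begin

lift_definition zero_sa :: "'a sa" is "\<lambda>x. 0" by (rule selfadjoint_zero)
lift_definition plus_sa :: "'a sa \<Rightarrow> 'a sa \<Rightarrow> 'a sa" is "\<lambda>A B x. A x + B x"
  by (rule selfadjoint_add)
lift_definition minus_sa :: "'a sa \<Rightarrow> 'a sa \<Rightarrow> 'a sa" is "\<lambda>A B x. A x - B x"
  by (rule selfadjoint_diff)
lift_definition uminus_sa :: "'a sa \<Rightarrow> 'a sa" is "\<lambda>A x. - A x"
  by (rule selfadjoint_minus)
lift_definition scaleR_sa :: "real \<Rightarrow> 'a sa \<Rightarrow> 'a sa" is "\<lambda>r A x. r *\<^sub>R A x"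
  by (rule selfadjoint_scaleR)

instance
  by standard (transfer; simp add: fun_eq_iff algebra_simps)+

end

instantiation sa :: (complex_hilbert_space) one
begin
lift_definition one_sa :: "'a sa" is "\<lambda>x. x" by (rule selfadjoint_id)
instance ..
end

definition form :: "'a::complex_hilbert_space sa \<Rightarrow> 'a \<Rightarrow> real" where
  "form A v = inner (app A v) v"

lemma form_eqI: "(\<And>v. form A v = form B v) \<Longrightarrow> A = B"
  unfolding form_def by transfer (rule selfadjoint_eqI)

lemma form_simps [simp]:
  "form (A + B) v = form A v + form B v"
  "form (A - B) v = form A v - form B v"
  "form (- A) v = - form A v"
  "form (r *\<^sub>R A) v = r * form A v"
  "form 0 v = 0"
  "form 1 v = (norm v)\<^sup>2"
  unfolding form_def
  by (transfer; simp add: inner_add_left inner_diff_left power2_norm_eq_inner)+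

instantiation sa :: (complex_hilbert_space) ordered_real_vector
begin

definition less_eq_sa :: "'a sa \<Rightarrow> 'a sa \<Rightarrow> bool" where
  "A \<le> B \<longleftrightarrow> (\<forall>v. form A v \<le> form B v)"
definition less_sa :: "'a sa \<Rightarrow> 'a sa \<Rightarrow> bool" where
  "less_sa A B \<longleftrightarrow> A \<le> B \<and> \<not> B \<le> A"

instance
proof
  fix A B :: "'a sa"
  assume "A \<le> B" "B \<le> A"
  then show "A = B"
    by (intro form_eqI) (simp add: less_eq_sa_def antisym)
next
  fix A B C :: "'a sa"
  assume "A \<le> B" "B \<le> C"
  then show "A \<le> C"
    unfolding less_eq_sa_def by (meson order_trans)
next
  fix A B :: "'a sa" and r s :: real
  assume "r \<le> s" "0 \<le> A"
  then show "r *\<^sub>R A \<le> s *\<^sub>R A"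
    by (simp add: less_eq_sa_def mult_right_mono)
qed (auto simp: less_eq_sa_def less_sa_def mult_left_mono)

end

lemma le_form: "A \<le> B \<longleftrightarrow> (\<forall>v. form A v \<le> form B v)"
  by (rule less_eq_sa_def)

lemma op_le_app: "op_le (app A) (app B) \<longleftrightarrow> A \<le> B"
  by (simp add: op_le_def le_form form_def inner_eq_Re_cinner)

lemma app_linear [simp]:
  "app A (x + y) = app A x + app A y"
  "app A (x - y) = app A x - app A y"
  "app A (- x) = - app A x"
  "app A (r *\<^sub>R x) = r *\<^sub>R app A x"
  "app A (c *\<^sub>C x) = c *\<^sub>C app A x"
  "app A 0 = 0"
proof -
  have A: "app A \<in> selfadjoint_ops" by (rule app)
  then have lin: "linear (app A)"
    by (simp add: selfadjoint_iff_symmetric bounded_linear.linear)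
  show "app A (x + y) = app A x + app A y" "app A (x - y) = app A x - app A y"
    "app A (- x) = - app A x" "app A (r *\<^sub>R x) = r *\<^sub>R app A x" "app A 0 = 0"
    by (simp_all add: linear_add linear_diff linear_neg linear_scale linear_0 lin)
  show "app A (c *\<^sub>C x) = c *\<^sub>C app A x"
    using A by (simp add: selfadjoint_ops_def bounded_clinear_def)
qed

lemma app_adjoint: "cinner (app A x) y = cinner x (app A y)"
  using app[of A] by (simp add: selfadjoint_ops_def is_adjoint_def)

lemma app_symmetric: "inner (app A x) y = inner x (app A y)"
  by (simp add: inner_eq_Re_cinner app_adjoint)

lemma app_simps [simp]:
  "app (A + B) v = app A v + app B v"
  "app (A - B) v = app A v - app B v"
  "app (- A) v = - app A v"
  "app (r *\<^sub>R A) v = r *\<^sub>R app A v"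
  "app 0 v = 0"
  "app 1 v = v"
  by (transfer; simp)+

lemma form_cinner: "cinner (app A v) v = of_real (form A v)"
  by (simp add: complex_eq_iff form_def inner_eq_Re_cinner)
     (metis app_adjoint cinner_commute cnj.sel(2) neg_equal_zero)

lemma form_scaleC: "form A (c *\<^sub>C v) = (cmod c)\<^sup>2 * form A v"
proof -
  have "complex_of_real (form A (c *\<^sub>C v)) = of_real ((cmod c)\<^sup>2 * form A v)"
    by (simp add: form_cinner[symmetric] cinner_simps complex_norm_square mult_ac
        del: of_real_power)
  then show ?thesis by (simp only: of_real_eq_iff)
qed

lemma form_scaleR: "form A (r *\<^sub>R v) = r\<^sup>2 * form A v"
  by (simp add: form_def power2_eq_square)

lemma form_add_arg: "form A (x + y) = form A x + form A y + 2 * inner (app A x) y"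
proof -
  have "inner (app A y) x = inner (app A x) y"
    by (metis app_symmetric inner_commute)
  then show ?thesis
    by (simp add: form_def inner_add_left inner_add_right)
qed

lemma bounded_by_identity:
  fixes A :: "'a::complex_hilbert_space sa"
  shows "\<exists>K\<ge>0. A \<le> K *\<^sub>R 1 \<and> - (K *\<^sub>R 1) \<le> A"
proof -
  have "bounded_linear (app A)"
    using app[of A] by (simp add: selfadjoint_iff_symmetric)
  then obtain K where K: "K \<ge> 0" "\<And>x. norm (app A x) \<le> norm x * K"
    using bounded_linear.nonneg_bounded by blast
  have "\<bar>form A v\<bar> \<le> K * (norm v)\<^sup>2" for v
  proof -
    have "\<bar>form A v\<bar> \<le> norm (app A v) * norm v"
      unfolding form_def by (rule Cauchy_Schwarz_ineq2)
    also have "\<dots> \<le> (norm v * K) * norm v"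
      using K(2)[of v] by (intro mult_right_mono) auto
    finally show ?thesis by (simp add: power2_eq_square mult_ac)
  qed
  then have "form A v \<le> K * (norm v)\<^sup>2" "- (K * (norm v)\<^sup>2) \<le> form A v" for v
    by (simp_all only: abs_le_iff minus_le_iff)
  then show ?thesis using K(1) by (auto simp: le_form)
qed

text \<open>Nonnegativity of the form at all real combinations of \<open>x\<close> and \<open>y\<close> gives the inequality for the
  real inner product. Rotating \<open>y\<close> by a phase makes that inner product equal to the modulus of the
  complex one.\<close>

lemma positive_Cauchy_Schwarz:
  assumes "0 \<le> A"
  shows "(cmod (cinner (app A x) y))\<^sup>2 \<le> form A x * form A y"
proof -
  have nonneg: "0 \<le> form A v" for v
    using assms by (simp add: le_form)
  have real: "(inner (app A x) y)\<^sup>2 \<le> form A x * form A y" for y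
  proof -
    define b where "b = inner (app A x) y"
    have quad: "0 \<le> s\<^sup>2 * form A x + t\<^sup>2 * form A y + 2 * (s * t * b)" for s t
      using nonneg[of "s *\<^sub>R x + t *\<^sub>R y"] by (simp add: form_add_arg form_scaleR b_def mult_ac)
    show ?thesis
    proof (cases "form A y = 0")
      case True
      have "b = 0"
        using quad[of 1 "- (form A x + 1) / (2 * b)"] nonneg[of x]
        by (cases "b = 0") (auto simp: True field_simps)
      then show ?thesis by (simp add: True b_def)
    next
      case False
      have "0 \<le> form A y * (form A x * form A y - b\<^sup>2)"
        using quad[of "form A y" "- b"] by (simp add: power2_eq_square algebra_simps)
      then show ?thesis
        using False nonneg[of y] by (simp add: zero_le_mult_iff b_def)
    qed
  qed
  obtain u where u: "cmod u = 1" "u * cinner (app A x) y = of_real (cmod (cinner (app A x) y))"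
    using unimodular_rotation by blast
  then have "cmod (cinner (app A x) y) = inner (app A x) (cnj u *\<^sub>C y)"
    by (simp add: inner_eq_Re_cinner cinner_scaleC_right)
  then show ?thesis
    using real[of "cnj u *\<^sub>C y"] by (simp add: form_scaleC u)
qed

lemma positive_kernel:
  assumes "0 \<le> A" "form A x = 0"
  shows "app A x = 0"
  using positive_Cauchy_Schwarz[OF assms(1), of x "app A x"] assms(2) by simp

section \<open>Rank-one operators and the order\<close>

lift_definition rk :: "'a::complex_hilbert_space \<Rightarrow> 'a sa" is "\<lambda>x v. cinner v x *\<^sub>C x"
proof -
  fix x :: 'a
  have "bounded_linear (\<lambda>v. cinner v x *\<^sub>C x)"
  proof (rule bounded_linear_intro[where K = "norm x * norm x"])
    show "norm (cinner v x *\<^sub>C x) \<le> norm v * (norm x * norm x)" for v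
      using mult_right_mono[OF complex_Cauchy_Schwarz[of v x], of "norm x"]
      by (simp add: norm_scaleC mult_ac)
  qed (simp_all add: cinner_simps scaleC_add_left scaleC_scaleC scaleR_eq_scaleC)
  moreover have "cinner (cinner v x *\<^sub>C x) w = cinner v (cinner w x *\<^sub>C x)" for v w
    by (simp add: cinner_simps cinner_commute[of x w])
  ultimately show "(\<lambda>v. cinner v x *\<^sub>C x) \<in> selfadjoint_ops"
    by (simp add: selfadjoint_ops_def bounded_clinear_def is_adjoint_def cinner_simps
        scaleC_scaleC)
qed

lemma app_rk: "app (rk x) v = cinner v x *\<^sub>C x"
  by transfer (rule refl)

lemma form_rk: "form (rk x) v = (cmod (cinner v x))\<^sup>2"
proof -
  have "complex_of_real (form (rk x) v) = of_real ((cmod (cinner v x))\<^sup>2)"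
    unfolding form_cinner[symmetric]
    by (simp add: app_rk cinner_simps complex_norm_square cinner_commute[of x v] del: of_real_power)
  then show ?thesis by (simp only: of_real_eq_iff)
qed

lemma rk_nonneg [simp]: "0 \<le> rk x"
  by (simp add: le_form form_rk)

lemma rk_zero [simp]: "rk 0 = 0"
  by (rule form_eqI) (simp add: form_rk)

lemma rk_scaleC: "rk (c *\<^sub>C x) = (cmod c)\<^sup>2 *\<^sub>R rk x"
  by (rule form_eqI) (simp add: form_rk cinner_simps norm_mult power_mult_distrib)

lemma rk_scaleR: "rk (r *\<^sub>R x) = r\<^sup>2 *\<^sub>R rk x"
  by (simp add: scaleR_eq_scaleC rk_scaleC)

lemma form_rk_self: "form (rk x) x = (norm x) ^ 4"
  by (simp add: form_rk cinner_self norm_power flip: power_mult)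

lemma rk_eq_0_iff [simp]: "rk x = 0 \<longleftrightarrow> x = 0"
  using form_rk_self[of x] by auto

lemma scaleR_rk_le_iff [simp]: "s *\<^sub>R rk x \<le> t *\<^sub>R rk x \<longleftrightarrow> s \<le> t \<or> x = 0"
proof
  assume "s *\<^sub>R rk x \<le> t *\<^sub>R rk x"
  then have "s * (norm x) ^ 4 \<le> t * (norm x) ^ 4"
    unfolding le_form by (metis form_rk_self form_simps(4))
  then show "s \<le> t \<or> x = 0" by (auto simp: mult_le_cancel_right)
qed (auto simp: scaleR_right_mono)

lemma rk_parallelogram: "rk (x + e) + rk (x - e) = 2 *\<^sub>R rk x + 2 *\<^sub>R rk e"
  by (rule form_eqI) (simp add: form_rk cinner_simps cmod_power2 power2_sum power2_diff)

text \<open>The witness is the coefficient of the projection of \<open>x\<close> to the line of \<open>y\<close>: the remaining part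
  of \<open>x\<close> is orthogonal to \<open>y\<close>, hence to \<open>x\<close>, hence to itself.\<close>

lemma in_span_if_orthogonal_complement:
  fixes x y :: "'a::complex_hilbert_space"
  assumes "\<And>z. cinner z y = 0 \<Longrightarrow> cinner z x = 0"
  shows "\<exists>c. x = c *\<^sub>C y"
proof (cases "y = 0")
  case True
  then show ?thesis using assms[of x] by simp
next
  case False
  define c where "c = cinner x y / cinner y y"
  have "cinner (x - c *\<^sub>C y) y = 0"
    using False by (simp add: c_def cinner_simps)
  then have "cinner (x - c *\<^sub>C y) (x - c *\<^sub>C y) = 0"
    using assms[of "x - c *\<^sub>C y"] by (simp add: cinner_diff_right[of "x - c *\<^sub>C y"]
       cinner_scaleC_right)
  then show ?thesis by auto
qed

lemma orthogonal_decomposition: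
  fixes x v :: "'a::complex_hilbert_space"
  obtains c w where "v = w + c *\<^sub>C x" "cinner w x = 0"
proof (cases "x = 0")
  case True
  then show ?thesis using that[of v 0] by simp
next
  case False
  then show ?thesis
    using that[of "v - (cinner v x / cinner x x) *\<^sub>C x" "cinner v x / cinner x x"]
    by (simp add: cinner_simps)
qed

text \<open>The form of \<open>B\<close> vanishes on the orthogonal complement of \<open>x\<close>. As \<open>B\<close> is positive, it vanishes
  there itself, so it is determined by its value at \<open>x\<close>.\<close>

lemma below_rk:
  assumes "0 \<le> B" "B \<le> rk x"
  shows "\<exists>t. 0 \<le> t \<and> t \<le> 1 \<and> B = t *\<^sub>R rk x"
proof (cases "x = 0")
  case True
  then show ?thesis using assms by (auto intro: antisym exI[of _ 0])
next
  case False
  have B: "0 \<le> form B v" "form B v \<le> form (rk x) v" for v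
    using assms by (auto simp: le_form)
  define t where "t = form B x / norm x ^ 4"
  have eq: "B = t *\<^sub>R rk x"
  proof (rule form_eqI)
    fix v
    obtain c w where v: "v = w + c *\<^sub>C x" "cinner w x = 0"
      by (rule orthogonal_decomposition)
    have "form B w = 0"
      using B[of w] v(2) by (simp add: form_rk)
    then have "app B w = 0"
      by (rule positive_kernel[OF assms(1)])
    then have "form B v = (cmod c)\<^sup>2 * form B x"
      by (simp add: v(1) form_add_arg form_scaleC \<open>form B w = 0\<close>)
    also have "\<dots> = form (t *\<^sub>R rk x) v"
      using False by (simp add: t_def v form_rk cinner_simps cinner_self norm_mult norm_power
          power_mult_distrib flip: power_mult)
    finally show "form B v = form (t *\<^sub>R rk x) v" .
  qed
  have "0 \<le> t" "t \<le> 1"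
    using B[of x] False by (auto simp: t_def form_rk_self divide_le_eq_1)
  then show ?thesis using eq by blast
qed

text \<open>This is the Cauchy--Schwarz inequality for the form of \<open>A\<close>. At \<open>y\<close> both sides have the same form,
  so it provides minorants of \<open>A\<close> of rank one that are sharp at a prescribed vector. If
  \<open>form A y = 0\<close>, the left-hand side is zero by the convention for division.\<close>

lemma rk_below_positive:
  assumes "0 \<le> A"
  shows "(1 / form A y) *\<^sub>R rk (app A y) \<le> A"
  unfolding le_form
proof
  fix v
  have "0 \<le> form A v" "form A y = 0 \<or> 0 < form A y"
    using assms by (auto simp: le_form less_le)
  then show "form ((1 / form A y) *\<^sub>R rk (app A y)) v \<le> form A v"
    using positive_Cauchy_Schwarz[OF assms, of y v]
    by (auto simp: form_rk cmod_cinner_commute[of v] divide_le_eq mult.commute)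
qed

text \<open>Let \<open>R\<close> be the rank-one minorant of \<open>D\<close> that is sharp at \<open>y\<close>. The chain condition compares \<open>R\<close>
  with \<open>D - R\<close>, and since \<open>D - R\<close> vanishes at \<open>y\<close> while \<open>R\<close> does not, only \<open>D - R \<le> R\<close> is possible.
  Then \<open>D - R\<close> is a multiple of \<open>R\<close>, and the multiple is zero, again by evaluation at \<open>y\<close>.\<close>

lemma rank_one_if_chain:
  assumes D: "0 \<le> D"
    and chain: "\<And>E F. 0 \<le> E \<Longrightarrow> E \<le> D \<Longrightarrow> 0 \<le> F \<Longrightarrow> F \<le> D \<Longrightarrow> E \<le> F \<or> F \<le> E"
  shows "\<exists>x. D = rk x"
proof (cases "\<exists>y. form D y \<noteq> 0")
  case False
  then have "D = rk 0" by (intro form_eqI) simp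
  then show ?thesis by blast
next
  case True
  then obtain y where "form D y \<noteq> 0" by blast
  moreover have "0 \<le> form D y" using D by (simp add: le_form)
  ultimately have pos: "form D y > 0" by simp
  define R where "R = (1 / form D y) *\<^sub>R rk (app D y)"
  have R: "0 \<le> R" "R \<le> D"
    using pos rk_below_positive[OF D] by (auto simp: R_def scaleR_nonneg_nonneg)
  have Ry: "form R y = form D y"
    using pos by (simp add: R_def form_rk cmod_cinner_commute[of y] form_cinner power2_eq_square)
  have "D - R \<le> R \<or> R \<le> D - R"
    using R by (intro chain) auto
  moreover have "\<not> R \<le> D - R"
    using pos Ry by (auto simp: le_form intro!: exI[of _ y])
  moreover have "R = rk ((1 / sqrt (form D y)) *\<^sub>R app D y)"
    using pos by (simp add: R_def rk_scaleR power_divide)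
  ultimately obtain t where t: "D - R = t *\<^sub>R R"
    using below_rk[of "D - R"] R by auto
  have "form (D - R) y = 0"
    by (simp add: Ry)
  then have "t = 0"
    using pos by (simp add: t Ry)
  then show ?thesis
    using t \<open>R = rk _\<close> by auto
qed

section \<open>Order automorphisms map lines to lines\<close>

locale order_automorphism =
  fixes \<Phi> :: "'a::complex_hilbert_space sa \<Rightarrow> 'a sa"
  assumes bij: "bij \<Phi>" and order: "A \<le> B \<longleftrightarrow> \<Phi> A \<le> \<Phi> B"
begin

lemma mono: "A \<le> B \<Longrightarrow> \<Phi> A \<le> \<Phi> B"
  using order by blast

lemma injD: "\<Phi> A = \<Phi> B \<Longrightarrow> A = B"
  using bij by (simp add: bij_is_inj inj_eq)

lemma surjD: "\<exists>A. B = \<Phi> A"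
  using bij by (meson bij_pointE)

lemma inverse: "order_automorphism (inv \<Phi>)"
proof
  show "bij (inv \<Phi>)" by (rule bij_imp_bij_inv[OF bij])
  show "A \<le> B \<longleftrightarrow> inv \<Phi> A \<le> inv \<Phi> B" for A B
    using order[of "inv \<Phi> A" "inv \<Phi> B"] bij by (simp add: bij_is_surj surj_f_inv_f)
qed

lemma inv_eq: "inv \<Phi> (\<Phi> A) = A" "\<Phi> (inv \<Phi> A) = A"
  using bij by (simp_all add: bij_is_inj bij_is_surj surj_f_inv_f)

text \<open>By \<open>below_rk\<close> the order interval from \<open>A\<close> to \<open>A + rk x\<close> is a chain, and so is its image.\<close>

lemma add_rk: "\<exists>y. \<Phi> (A + rk x) = \<Phi> A + rk y"
proof -
  define D where "D = \<Phi> (A + rk x) - \<Phi> A"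
  \<comment> \<open>Operators between \<open>0\<close> and \<open>D\<close> are pulled back to the chain of the \<open>A + t rk x\<close>.\<close>
  have "\<exists>y. D = rk y"
  proof (rule rank_one_if_chain)
    show "0 \<le> D" by (simp add: D_def order[symmetric])
  next
    fix E F assume E: "0 \<le> E" "E \<le> D" and F: "0 \<le> F" "F \<le> D"
    have pre: "\<exists>t. \<Phi> A + G = \<Phi> (A + t *\<^sub>R rk x)" if "0 \<le> G" "G \<le> D" for G
    proof -
      obtain B where B: "\<Phi> A + G = \<Phi> B" using surjD by blast
      have "\<Phi> A \<le> \<Phi> B" "\<Phi> B \<le> \<Phi> (A + rk x)"
        using that by (simp_all add: B[symmetric] D_def algebra_simps)
      then have "0 \<le> B - A" "B - A \<le> rk x"
        by (simp_all add: order[symmetric] algebra_simps)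
      then obtain t where "B - A = t *\<^sub>R rk x" using below_rk by blast
      then have "B = A + t *\<^sub>R rk x" by (simp add: algebra_simps)
      then show ?thesis using B by blast
    qed
    obtain s t where st: "\<Phi> A + E = \<Phi> (A + s *\<^sub>R rk x)" "\<Phi> A + F = \<Phi> (A + t *\<^sub>R rk x)"
      using pre[OF E] pre[OF F] by blast
    have "A + s *\<^sub>R rk x \<le> A + t *\<^sub>R rk x \<or> A + t *\<^sub>R rk x \<le> A + s *\<^sub>R rk x"
      by auto
    then have "\<Phi> A + E \<le> \<Phi> A + F \<or> \<Phi> A + F \<le> \<Phi> A + E"
      unfolding st using mono by blast
    then show "E \<le> F \<or> F \<le> E" by simp
  qed
  then show ?thesis by (auto simp: D_def algebra_simps)
qed

text \<open>The direction \<open>y\<close> is read off at \<open>t = 1\<close>. Another parameter \<open>t \<ge> 0\<close> gives a rank-one increment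
  that is comparable with \<open>rk y\<close>, hence proportional to it. For \<open>t < 0\<close> the increments are taken
  from the point with parameter \<open>t\<close>, which lies below the other two.\<close>

lemma line_into_line:
  assumes "x \<noteq> 0"
  shows "\<exists>y. y \<noteq> 0 \<and> (\<forall>t. \<exists>s. \<Phi> (A + t *\<^sub>R rk x) = \<Phi> A + s *\<^sub>R rk y)"
proof -
  obtain y where y: "\<Phi> (A + rk x) = \<Phi> A + rk y" using add_rk by blast
  have "y \<noteq> 0"
    using injD[of "A + rk x" A] y assms by auto
  have plus: "\<exists>z. \<Phi> (B + t *\<^sub>R rk x) = \<Phi> B + rk z" if "t \<ge> 0" for t B
    using add_rk[of B "sqrt t *\<^sub>R x"] that by (simp add: rk_scaleR)
  have "\<exists>s. \<Phi> (A + t *\<^sub>R rk x) = \<Phi> A + s *\<^sub>R rk y" for t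
  proof (cases "t \<ge> 0")
    case True
    then obtain z where z: "\<Phi> (A + t *\<^sub>R rk x) = \<Phi> A + rk z" using plus by blast
    show ?thesis
    proof (cases "t \<le> 1")
      case True
      then have "A + t *\<^sub>R rk x \<le> A + rk x"
        using scaleR_rk_le_iff[of t x 1] by simp
      then have "rk z \<le> rk y"
        using mono z y by fastforce
      then show ?thesis using below_rk[of "rk z" y] z by auto
    next
      case False
      then have "A + rk x \<le> A + t *\<^sub>R rk x"
        using scaleR_rk_le_iff[of 1 x t] by simp
      then have "rk y \<le> rk z"
        using mono z y by fastforce
      then obtain s where s: "rk y = s *\<^sub>R rk z" using below_rk[of "rk y" z] by auto
      then have "s \<noteq> 0" using \<open>y \<noteq> 0\<close> by auto
      then have "rk z = (1 / s) *\<^sub>R rk y" by (simp add: s)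
      then show ?thesis using z by auto
    qed
  next
    case False
    define B where "B = A + t *\<^sub>R rk x"
    obtain w where "\<Phi> (B + (- t) *\<^sub>R rk x) = \<Phi> B + rk w"
      using plus[of "- t" B] False by auto
    then have w: "\<Phi> A = \<Phi> B + rk w" by (simp add: B_def)
    obtain w' where "\<Phi> (B + (1 - t) *\<^sub>R rk x) = \<Phi> B + rk w'"
      using plus[of "1 - t" B] False by auto
    then have w': "\<Phi> (A + rk x) = \<Phi> B + rk w'" by (simp add: B_def algebra_simps)
    have sum: "rk w' = rk w + rk y" using w w' y by (simp add: algebra_simps)
    then obtain s where s: "rk w = s *\<^sub>R rk w'" using below_rk[of "rk w" w'] by auto
    then have "rk y = (1 - s) *\<^sub>R rk w'" using sum by (simp add: algebra_simps)
    then have "s \<noteq> 1" "rk w' = (1 / (1 - s)) *\<^sub>R rk y" using \<open>y \<noteq> 0\<close> by auto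
    then have "\<Phi> B = \<Phi> A + (- s / (1 - s)) *\<^sub>R rk y" by (simp add: w s)
    then show ?thesis unfolding B_def by blast
  qed
  then show ?thesis using \<open>y \<noteq> 0\<close> by blast
qed

text \<open>The image of the line through \<open>A\<close> in direction \<open>rk x\<close> is the whole line through \<open>\<Phi> A\<close> in
  direction \<open>rk y\<close>.\<close>

definition direction :: "'a sa \<Rightarrow> 'a \<Rightarrow> 'a \<Rightarrow> bool" where
  "direction A x y \<longleftrightarrow> y \<noteq> 0 \<and>
     (\<forall>t. \<exists>s. \<Phi> (A + t *\<^sub>R rk x) = \<Phi> A + s *\<^sub>R rk y) \<and>
     (\<forall>s. \<exists>t. \<Phi> (A + t *\<^sub>R rk x) = \<Phi> A + s *\<^sub>R rk y)"

text \<open>That the line is covered follows from \<open>line_into_line\<close> for the inverse automorphism, which maps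
  the image line into a line through \<open>A\<close> and \<open>A + rk x\<close>.\<close>

lemma direction_exists:
  assumes "x \<noteq> 0"
  shows "\<exists>y. direction A x y"
proof -
  interpret I: order_automorphism "inv \<Phi>" by (rule inverse)
  obtain y where y: "y \<noteq> 0" "\<And>t. \<exists>s. \<Phi> (A + t *\<^sub>R rk x) = \<Phi> A + s *\<^sub>R rk y"
    using line_into_line[OF assms] by blast
  obtain z where "\<And>s. \<exists>t. inv \<Phi> (\<Phi> A + s *\<^sub>R rk y) = A + t *\<^sub>R rk z"
    using I.line_into_line[OF y(1), of "\<Phi> A"] by (auto simp: inv_eq)
  then have z: "\<exists>t. \<Phi> A + s *\<^sub>R rk y = \<Phi> (A + t *\<^sub>R rk z)" for s
    by (metis inv_eq(2))
  obtain s where "\<Phi> (A + rk x) = \<Phi> A + s *\<^sub>R rk y" using y(2)[of 1] by auto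
  then obtain t where "rk x = t *\<^sub>R rk z"
    using z[of s] injD by (metis add_left_cancel)
  then have "rk z = (1 / t) *\<^sub>R rk x" using assms by auto
  then have "\<exists>t. \<Phi> (A + t *\<^sub>R rk x) = \<Phi> A + s *\<^sub>R rk y" for s
    using z[of s] by (metis scaleR_scaleR)
  then show ?thesis using y by (auto simp: direction_def)
qed

lemma direction_scaleC:
  assumes "direction A x y" "y = c *\<^sub>C y'"
  shows "direction A x y'"
proof -
  have c: "(cmod c)\<^sup>2 \<noteq> 0" "y' \<noteq> 0" using assms by (auto simp: direction_def)
  have "\<exists>r. s *\<^sub>R rk y = r *\<^sub>R rk y'" "\<exists>r. s *\<^sub>R rk y' = r *\<^sub>R rk y" for s
    using c(1) by (auto simp: assms(2) rk_scaleC intro: exI[of _ "s / (cmod c)\<^sup>2"])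
  then show ?thesis using assms(1) c(2) unfolding direction_def by metis
qed

text \<open>Translation by \<open>t rk x\<close> keeps \<open>A\<close> below \<open>B\<close>. At a vector \<open>v\<close> orthogonal to \<open>z\<close> the form is constant
  along the image of the line through \<open>B\<close>, so it is bounded above along the image of the line
  through \<open>A\<close>, which is a full line in direction \<open>rk y\<close>. Hence \<open>v\<close> is orthogonal to \<open>y\<close>.\<close>

lemma direction_unique_if_le:
  assumes "A \<le> B" "direction A x y" "direction B x z"
  shows "\<exists>c. y = c *\<^sub>C z"
proof (rule in_span_if_orthogonal_complement)
  fix v assume v: "cinner v z = 0"
  have bound: "form (\<Phi> A) v + s * (cmod (cinner v y))\<^sup>2 \<le> form (\<Phi> B) v" for s
  proof -
    obtain t where t: "\<Phi> (A + t *\<^sub>R rk x) = \<Phi> A + s *\<^sub>R rk y"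
      using assms(2) unfolding direction_def by blast
    obtain r where r: "\<Phi> (B + t *\<^sub>R rk x) = \<Phi> B + r *\<^sub>R rk z"
      using assms(3) unfolding direction_def by blast
    have "\<Phi> A + s *\<^sub>R rk y \<le> \<Phi> B + r *\<^sub>R rk z"
      using assms(1) mono by (simp flip: t r)
    then have "form (\<Phi> A + s *\<^sub>R rk y) v \<le> form (\<Phi> B + r *\<^sub>R rk z) v"
      by (simp only: le_form)
    then show ?thesis by (simp add: form_rk v)
  qed
  show "cinner v y = 0"
  proof (rule ccontr)
    assume "cinner v y \<noteq> 0"
    then show False
      using bound[of "(form (\<Phi> B) v - form (\<Phi> A) v + 1) / (cmod (cinner v y))\<^sup>2"] by simp
  qed
qed

lemma common_upper_bound: "\<exists>C :: 'a sa. A \<le> C \<and> B \<le> C"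
proof -
  obtain K where K: "K \<ge> 0" "A - B \<le> K *\<^sub>R 1" using bounded_by_identity[of "A - B"] by auto
  have "0 \<le> K *\<^sub>R (1 :: 'a sa)" using K(1) by (simp add: le_form)
  then show ?thesis using K(2) by (intro exI[of _ "B + K *\<^sub>R 1"]) (simp add: algebra_simps)
qed

lemma direction_independent:
  assumes "x \<noteq> 0" "direction A x y"
  shows "direction B x y"
proof -
  obtain C where C: "A \<le> C" "B \<le> C" using common_upper_bound by blast
  obtain z w where z: "direction C x z" and w: "direction B x w"
    using direction_exists assms(1) by blast
  obtain c d where cd: "y = c *\<^sub>C z" "w = d *\<^sub>C z"
    using direction_unique_if_le C assms(2) z w by blast
  moreover have "c \<noteq> 0" using cd(1) assms(2) by (auto simp: direction_def)
  ultimately have "w = (d / c) *\<^sub>C y" by (simp add: scaleC_scaleC)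
  then show ?thesis using direction_scaleC[OF w] by blast
qed

end

section \<open>Linearity along lines\<close>

lemma additive_mono_imp_linear:
  fixes f :: "real \<Rightarrow> real"
  assumes add: "\<And>s t. f (s + t) = f s + f t" and mono: "\<And>s t. s \<le> t \<Longrightarrow> f s \<le> f t"
  shows "f t = f 1 * t"
proof -
  have f0: "f 0 = 0" using add[of 0 0] by simp
  have nat: "f (real n * s) = real n * f s" for n s
    by (induction n) (simp_all add: f0 add algebra_simps)
  have neg: "f (- s) = - f s" for s
    using add[of s "- s"] f0 by simp
  have int: "f (of_int k) = of_int k * f 1" for k
    using nat[of _ 1] neg[of "real (nat (- k))"] by (cases k rule: int_cases2) (auto simp: neg)
  have f1: "0 \<le> f 1" using mono[of 0 1] f0 by simp
  \<comment> \<open>Both \<open>f (n t)\<close> and \<open>n t f 1\<close> lie between the values of \<open>f\<close> at the integers around \<open>n t\<close>.\<close>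
  have "real n * \<bar>f t - f 1 * t\<bar> \<le> f 1" for n
  proof -
    define k where "k = \<lfloor>real n * t\<rfloor>"
    have k: "of_int k \<le> real n * t" "real n * t \<le> of_int k + 1"
      by (simp_all add: k_def)
    have "of_int k * f 1 \<le> real n * f t" "real n * f t \<le> (of_int k + 1) * f 1"
      using mono[OF k(1)] mono[OF k(2)] by (simp_all only: nat int add distrib_right mult_1)
    moreover have "of_int k * f 1 \<le> real n * t * f 1" "real n * t * f 1 \<le> (of_int k + 1) * f 1"
      using k f1 by (auto intro: mult_right_mono)
    ultimately have "\<bar>real n * f t - real n * t * f 1\<bar> \<le> f 1"
      by (simp add: algebra_simps abs_le_iff)
    moreover have "real n * f t - real n * t * f 1 = real n * (f t - f 1 * t)"
      by (simp add: algebra_simps)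
    ultimately show ?thesis by (simp add: abs_mult)
  qed
  then have "\<bar>f t - f 1 * t\<bar> \<le> 0"
    by (meson linorder_not_le reals_Archimedean3)
  then show ?thesis by simp
qed

context order_automorphism
begin

definition dir :: "'a \<Rightarrow> 'a" where
  "dir x = (SOME y. \<forall>A. direction A x y)"

lemma direction_dir:
  assumes "x \<noteq> 0"
  shows "direction A x (dir x)"
proof -
  obtain y where "direction 0 x y" using direction_exists[OF assms] by blast
  then have "\<forall>A. direction A x y" using direction_independent[OF assms] by blast
  then have "\<forall>A. direction A x (dir x)" unfolding dir_def by (rule someI)
  then show ?thesis ..
qed

lemma dir_nonzero: "x \<noteq> 0 \<Longrightarrow> dir x \<noteq> 0"
  using direction_dir by (auto simp: direction_def)

text \<open>How \<open>\<Phi>\<close> stretches the line through \<open>A\<close> in direction \<open>rk x\<close>, as a function of the parameter.\<close>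

definition dilation :: "'a sa \<Rightarrow> 'a \<Rightarrow> real \<Rightarrow> real" where
  "dilation A x t = (SOME s. \<Phi> (A + t *\<^sub>R rk x) = \<Phi> A + s *\<^sub>R rk (dir x))"

lemma \<Phi>_line:
  assumes "x \<noteq> 0"
  shows "\<Phi> (A + t *\<^sub>R rk x) = \<Phi> A + dilation A x t *\<^sub>R rk (dir x)"
proof -
  have "\<exists>s. \<Phi> (A + t *\<^sub>R rk x) = \<Phi> A + s *\<^sub>R rk (dir x)"
    using direction_dir[OF assms, of A] by (simp add: direction_def)
  then show ?thesis unfolding dilation_def by (rule someI_ex)
qed

text \<open>If the images had the same direction, \<open>rk x\<close> and a multiple of \<open>rk e\<close> would have the same image,
  because the line in direction \<open>rk e\<close> covers its image line.\<close>

lemma dir_independent: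
  assumes "x \<noteq> 0" "e \<noteq> 0" "a *\<^sub>R rk (dir x) = b *\<^sub>R rk (dir e)" "a \<noteq> 0"
  shows "\<exists>c. x = c *\<^sub>C e"
proof -
  have dir: "rk (dir x) = (b / a) *\<^sub>R rk (dir e)"
    using arg_cong[OF assms(3), of "scaleR (1 / a)"] assms(4) by simp
  define r where "r = dilation 0 x 1 * (b / a)"
  have "\<Phi> (0 + 1 *\<^sub>R rk x) = \<Phi> 0 + r *\<^sub>R rk (dir e)"
    unfolding \<Phi>_line[OF assms(1)] dir r_def by simp
  moreover obtain t where "\<Phi> (0 + t *\<^sub>R rk e) = \<Phi> 0 + r *\<^sub>R rk (dir e)"
    using direction_dir[OF assms(2), of 0] unfolding direction_def by meson
  ultimately have "\<Phi> (rk x) = \<Phi> (t *\<^sub>R rk e)" by simp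
  then have "rk x = t *\<^sub>R rk e" by (rule injD)
  then have "form (rk x) z = form (t *\<^sub>R rk e) z" for z by (rule arg_cong)
  then have form: "(cmod (cinner z x))\<^sup>2 = t * (cmod (cinner z e))\<^sup>2" for z
    unfolding form_rk form_simps .
  show ?thesis
  proof (rule in_span_if_orthogonal_complement)
    show "cinner z x = 0" if "cinner z e = 0" for z
      using form[of z] that by simp
  qed
qed

text \<open>The point \<open>A + s rk e + t rk x\<close> can be reached from \<open>A\<close> along either side of a parallelogram;
  the coefficients of \<open>rk (dir x)\<close> in the two expressions for its image agree.\<close>

lemma dilation_shift_other:
  assumes "x \<noteq> 0" "\<And>c. x \<noteq> c *\<^sub>C e"
  shows "dilation (A + s *\<^sub>R rk e) x t = dilation A x t"
proof (cases "e = 0")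
  case False
  have "\<Phi> (A + s *\<^sub>R rk e + t *\<^sub>R rk x) = \<Phi> (A + t *\<^sub>R rk x + s *\<^sub>R rk e)"
    by (simp only: ac_simps)
  then have "\<Phi> A + dilation A e s *\<^sub>R rk (dir e) + dilation (A + s *\<^sub>R rk e) x t *\<^sub>R rk (dir x) =
      \<Phi> A + dilation A x t *\<^sub>R rk (dir x) + dilation (A + t *\<^sub>R rk x) e s *\<^sub>R rk (dir e)"
    by (simp only: \<Phi>_line[OF assms(1)] \<Phi>_line[OF False])
  then have eq: "(dilation (A + s *\<^sub>R rk e) x t - dilation A x t) *\<^sub>R rk (dir x) =
      (dilation (A + t *\<^sub>R rk x) e s - dilation A e s) *\<^sub>R rk (dir e)"
    by (simp add: algebra_simps)
  show ?thesis
  proof (rule ccontr)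
    assume "\<not> ?thesis"
    then show False
      using dir_independent[OF assms(1) False eq] assms(2) by simp
  qed
qed simp

text \<open>By the parallelogram identity \<open>rk x\<close> is a combination of \<open>rk (x + e)\<close>, \<open>rk (x - e)\<close> and
  \<open>rk e\<close>, none of which is proportional to \<open>rk x\<close>.\<close>

lemma dilation_shift_self:
  assumes x: "x \<noteq> 0" and e: "e \<noteq> 0" "cinner e x = 0"
  shows "dilation (A + s *\<^sub>R rk x) x t = dilation A x t"
proof -
  have xe: "cinner x e = 0" using e(2) by (metis cinner_commute complex_cnj_zero)
  have not_parallel: "x \<noteq> c *\<^sub>C (x + d)" if "d \<noteq> 0" "cinner x d = 0" for c d
  proof
    assume eq: "x = c *\<^sub>C (x + d)"
    have "c * cinner d d = 0"
      using arg_cong[OF eq, of "\<lambda>y. cinner y d"] that(2) by (simp add: cinner_simps)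
    then have "c *\<^sub>C (x + d) = 0" using that(1) by simp
    then show False using x eq by simp
  qed
  have np: "x \<noteq> c *\<^sub>C (x + e)" "x \<noteq> c *\<^sub>C (x - e)" "x \<noteq> c *\<^sub>C e" for c
  proof -
    show "x \<noteq> c *\<^sub>C (x + e)" "x \<noteq> c *\<^sub>C (x - e)"
      using not_parallel[of e c] not_parallel[of "- e" c] e xe by (simp_all add: cinner_simps)
    show "x \<noteq> c *\<^sub>C e"
    proof
      assume eq: "x = c *\<^sub>C e"
      have "cinner x x = 0"
        using arg_cong[OF eq, of "cinner x"] xe by (simp add: cinner_simps)
      then show False using x by simp
    qed
  qed
  have "s *\<^sub>R rk x = (s/2) *\<^sub>R (2 *\<^sub>R rk x + 2 *\<^sub>R rk e) - s *\<^sub>R rk e"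
    by (simp add: algebra_simps)
  also have "\<dots> = (s/2) *\<^sub>R rk (x + e) + (s/2) *\<^sub>R rk (x - e) + (- s) *\<^sub>R rk e"
    by (simp only: rk_parallelogram[symmetric]) (simp add: algebra_simps)
  finally have "A + s *\<^sub>R rk x =
      A + (s/2) *\<^sub>R rk (x + e) + (s/2) *\<^sub>R rk (x - e) + (- s) *\<^sub>R rk e"
    by (simp add: add.assoc)
  then show ?thesis
    by (simp only: dilation_shift_other[OF x np(1)] dilation_shift_other[OF x np(2)]
        dilation_shift_other[OF x np(3)])
qed

lemma dilation_mono:
  assumes "x \<noteq> 0" "s \<le> t"
  shows "dilation A x s \<le> dilation A x t"
proof -
  have "\<Phi> (A + s *\<^sub>R rk x) \<le> \<Phi> (A + t *\<^sub>R rk x)"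
    using assms(2) by (intro mono) simp
  then show ?thesis
    by (simp add: \<Phi>_line assms(1) dir_nonzero)
qed

lemma dilation_linear:
  assumes "x \<noteq> 0" "e \<noteq> 0" "cinner e x = 0"
  shows "dilation A x t = dilation A x 1 * t"
proof (rule additive_mono_imp_linear)
  fix s t
  have "\<Phi> (A + (s + t) *\<^sub>R rk x) = \<Phi> (A + s *\<^sub>R rk x + t *\<^sub>R rk x)"
    by (simp add: algebra_simps)
  then have "\<Phi> A + dilation A x (s + t) *\<^sub>R rk (dir x) =
      \<Phi> A + dilation A x s *\<^sub>R rk (dir x) + dilation A x t *\<^sub>R rk (dir x)"
    by (simp only: \<Phi>_line[OF assms(1)] dilation_shift_self[OF assms])
  then have "dilation A x (s + t) *\<^sub>R rk (dir x) = (dilation A x s + dilation A x t) *\<^sub>R rk (dir x)"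
    by (simp add: scaleR_add_left add.assoc)
  then show "dilation A x (s + t) = dilation A x s + dilation A x t"
    by (simp add: dir_nonzero assms(1))
qed (rule dilation_mono[OF assms(1)])

text \<open>If \<open>A \<le> C\<close>, then for all real \<open>t\<close> the image of \<open>A + t rk x\<close> is below that of \<open>C + t rk x\<close>. At
  \<open>dir x\<close> this compares two affine functions of \<open>t\<close> on the whole line, so their slopes agree.\<close>

lemma dilation_independent:
  assumes "x \<noteq> 0" "e \<noteq> 0" "cinner e x = 0"
  shows "dilation A x t = dilation B x t"
proof -
  have le: "dilation A x 1 = dilation C x 1" if "A \<le> C" for A C
  proof -
    define a where "a = form (rk (dir x)) (dir x)"
    define b where "b = form (\<Phi> C) (dir x) - form (\<Phi> A) (dir x)"
    have a: "a > 0" by (simp add: a_def form_rk_self dir_nonzero assms(1))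
    have bound: "t * ((dilation A x 1 - dilation C x 1) * a) \<le> b" for t
    proof -
      have "\<Phi> (A + t *\<^sub>R rk x) \<le> \<Phi> (C + t *\<^sub>R rk x)"
        using that by (intro mono) simp
      then have "form (\<Phi> (A + t *\<^sub>R rk x)) (dir x) \<le> form (\<Phi> (C + t *\<^sub>R rk x)) (dir x)"
        by (simp only: le_form)
      then show ?thesis
        by (simp add: \<Phi>_line assms(1) dilation_linear[OF assms, of A t]
            dilation_linear[OF assms, of C t] a_def b_def algebra_simps)
    qed
    have "(dilation A x 1 - dilation C x 1) * a = 0"
    proof (rule ccontr)
      assume "(dilation A x 1 - dilation C x 1) * a \<noteq> 0"
      then show False
        using bound[of "(b + 1) / ((dilation A x 1 - dilation C x 1) * a)"] by simp
    qed
    then show ?thesis using a by simp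
  qed
  obtain C where "A \<le> C" "B \<le> C" using common_upper_bound by blast
  then show ?thesis
    using le[of A C] le[of B C] dilation_linear[OF assms, of A t] dilation_linear[OF assms, of B t]
    by simp
qed

text \<open>The common slope of the dilations is nonnegative by monotonicity, so its square root can be
  absorbed into the direction.\<close>

theorem affine_on_rank_one:
  assumes dim: "\<And>x :: 'a. \<exists>e. e \<noteq> 0 \<and> cinner e x = 0"
  shows "\<exists>S. \<forall>A t x. \<Phi> (A + t *\<^sub>R rk x) = \<Phi> A + t *\<^sub>R rk (S x)"
proof -
  define S where "S x = (if x = 0 then 0 else sqrt (dilation 0 x 1) *\<^sub>R dir x)" for x
  have "\<Phi> (A + t *\<^sub>R rk x) = \<Phi> A + t *\<^sub>R rk (S x)" for A t x
  proof (cases "x = 0")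
    case False
    obtain e where e: "e \<noteq> 0" "cinner e x = 0" using dim by blast
    have "dilation 0 x 0 = 0"
      using dilation_linear[OF False e, of 0 0] by simp
    then have "0 \<le> dilation 0 x 1"
      using dilation_mono[OF False, of 0 1 0] by simp
    then have "rk (S x) = dilation 0 x 1 *\<^sub>R rk (dir x)"
      using False by (simp add: S_def rk_scaleR)
    moreover have "dilation A x t = t * dilation 0 x 1"
      using dilation_linear[OF False e, of A t] dilation_independent[OF False e, of A 1 0] by simp
    ultimately show ?thesis by (simp add: \<Phi>_line False)
  qed (simp add: S_def)
  then show ?thesis by blast
qed

end

section \<open>From rank-one operators to a unitary or antiunitary operator\<close>

lemma rk_eq_imp_phase:
  assumes "rk a = rk b"
  shows "\<exists>w. cmod w = 1 \<and> a = w *\<^sub>C b"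
proof (cases "b = 0")
  case True
  then show ?thesis using assms by (intro exI[of _ 1]) simp
next
  case False
  have form: "(cmod (cinner z a))\<^sup>2 = (cmod (cinner z b))\<^sup>2" for z
    using assms by (simp flip: form_rk)
  have "cinner z a = 0" if "cinner z b = 0" for z
    using form[of z] that by simp
  then obtain w where w: "a = w *\<^sub>C b"
    using in_span_if_orthogonal_complement by blast
  have "(cmod w)\<^sup>2 *\<^sub>R rk b = 1 *\<^sub>R rk b"
    using assms by (simp add: w rk_scaleC)
  then have "(cmod w)\<^sup>2 = 1\<^sup>2"
    unfolding scaleR_cancel_right using False by simp
  then have "cmod w = 1"
    by (simp only: power2_eq_iff_nonneg norm_ge_zero zero_le_one)
  then show ?thesis using w by blast
qed

lemma rk_eq_imp_norm_eq: "rk a = rk b \<Longrightarrow> norm a = norm b"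
  using rk_eq_imp_phase[of a b] by (auto simp: norm_scaleC)

lemma scaleR_rk_le_one_iff: "t *\<^sub>R rk x \<le> 1 \<longleftrightarrow> t * (norm x)\<^sup>2 \<le> 1" if "t \<ge> 0"
proof
  assume "t *\<^sub>R rk x \<le> 1"
  then have "form (t *\<^sub>R rk x) x \<le> form 1 x" by (simp only: le_form)
  then have "t * (norm x)\<^sup>2 * (norm x)\<^sup>2 \<le> 1 * (norm x)\<^sup>2"
    by (simp add: form_rk_self power2_eq_square power4_eq_xxxx mult_ac)
  then show "t * (norm x)\<^sup>2 \<le> 1"
    by (cases "x = 0") (simp_all add: mult_le_cancel_right)
next
  assume t: "t * (norm x)\<^sup>2 \<le> 1"
  show "t *\<^sub>R rk x \<le> 1"
    unfolding le_form
  proof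
    fix v
    have "t * (cmod (cinner v x))\<^sup>2 \<le> t * (norm v * norm x)\<^sup>2"
      using that complex_Cauchy_Schwarz[of v x] by (intro mult_left_mono power_mono) auto
    also have "\<dots> = t * (norm x)\<^sup>2 * (norm v)\<^sup>2"
      by (simp add: power_mult_distrib)
    also have "\<dots> \<le> 1 * (norm v)\<^sup>2"
      using t by (intro mult_right_mono) auto
    finally show "form (t *\<^sub>R rk x) v \<le> form 1 v"
      by (simp add: form_rk)
  qed
qed

text \<open>Bessel's inequality: \<open>p\<close> is the part of \<open>v\<close> orthogonal to \<open>x\<close> and \<open>e\<close>.\<close>

lemma orthogonal_rk_sum_le_one:
  assumes "norm x = 1" "norm e = 1" "cinner x e = 0"
  shows "rk x + rk e \<le> 1"
  unfolding le_form
proof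
  fix v
  have ex: "cinner e x = 0" using assms(3) by (metis cinner_commute complex_cnj_zero)
  define p where "p = v - cinner v x *\<^sub>C x - cinner v e *\<^sub>C e"
  have "cinner p p = cinner v v - of_real ((cmod (cinner v x))\<^sup>2) - of_real ((cmod (cinner v e))\<^sup>2)"
    unfolding p_def using assms ex
    by (simp add: cinner_simps cinner_self[of x] cinner_self[of e] complex_norm_square
        cinner_commute[of x v] cinner_commute[of e v] del: of_real_power)
  then have "(norm p)\<^sup>2 = (norm v)\<^sup>2 - (cmod (cinner v x))\<^sup>2 - (cmod (cinner v e))\<^sup>2"
    by (simp only: cinner_self of_real_diff[symmetric] of_real_eq_iff)
  then show "form (rk x + rk e) v \<le> form 1 v"
    using zero_le_power2[of "norm p"] by (simp add: form_rk)
qed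

text \<open>The polarization of the quadratic map \<open>rk\<close>, that is, its derivative at \<open>e\<close> in direction \<open>x\<close>.\<close>

definition cross :: "'a::complex_hilbert_space \<Rightarrow> 'a \<Rightarrow> 'a sa" where
  "cross e x = rk (x + e) - rk x - rk e"

lemma form_cross: "form (cross e x) v = 2 * Re (cinner v x * cnj (cinner v e))"
  by (simp add: cross_def form_rk cinner_simps cmod_power2) (simp add: power2_eq_square algebra_simps)

lemma cross_add: "cross e (x + y) = cross e x + cross e y"
  by (rule form_eqI) (simp add: form_cross cinner_simps algebra_simps)

lemma cross_scaleR: "cross e (r *\<^sub>R x) = r *\<^sub>R cross e x"
  by (rule form_eqI) (simp add: form_cross cinner_simps algebra_simps)

lemma rk_expand:
  "rk (x + c *\<^sub>C e) =
     rk x + (cmod c)\<^sup>2 *\<^sub>R rk e + Re c *\<^sub>R cross e x + (- Im c) *\<^sub>R cross e (\<i> *\<^sub>C x)"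
  by (rule form_eqI)
     (simp add: form_cross form_rk cinner_simps cmod_power2,
      simp add: power2_eq_square algebra_simps)

lemma app_cross: "app (cross e x) v = cinner v e *\<^sub>C x + cinner v x *\<^sub>C e"
  by (simp add: cross_def app_rk cinner_simps scaleC_add_left scaleC_add_right)

lemma nonneg_affine_imp_slope_0:
  fixes a b :: real
  assumes "\<And>t. 0 \<le> a + t * b"
  shows "b = 0"
proof (rule ccontr)
  assume "b \<noteq> 0"
  then show False using assms[of "- (a + 1) / b"] by simp
qed

lemma nonneg_quadratic_imp_slope_0:
  fixes b :: real
  assumes "\<And>t. 0 \<le> t\<^sup>2 + t * b"
  shows "b = 0"
proof -
  have "b * b \<le> 0"
    using assms[of "- b / 2"] by (simp add: power2_eq_square field_simps)
  then show ?thesis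
    using zero_le_square[of b] by (simp add: antisym)
qed

text \<open>The identity for \<open>\<sigma> = 1\<close> and complex conjugation for \<open>\<sigma> = -1\<close>, so that linear and conjugate-linear
  maps can be treated together.\<close>

definition twist :: "real \<Rightarrow> complex \<Rightarrow> complex" where
  "twist \<sigma> c = Complex (Re c) (\<sigma> * Im c)"

text \<open>The operators \<open>rk (S x)\<close> are determined by \<open>\<Phi>\<close>, the vectors \<open>S x\<close> only up to a phase that may vary
  with \<open>x\<close>.\<close>

locale normalised_automorphism = order_automorphism \<Phi>
  for \<Phi> :: "'a::complex_hilbert_space sa \<Rightarrow> 'a sa" +
  fixes S :: "'a \<Rightarrow> 'a"
  assumes \<Phi>_zero: "\<Phi> 0 = 0" and \<Phi>_one: "\<Phi> 1 = 1"
    and \<Phi>_add_rk: "\<Phi> (A + t *\<^sub>R rk x) = \<Phi> A + t *\<^sub>R rk (S x)"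
begin

lemma \<Phi>_rk: "\<Phi> (t *\<^sub>R rk x) = t *\<^sub>R rk (S x)"
  using \<Phi>_add_rk[of 0 t x] by (simp add: \<Phi>_zero)

lemma \<Phi>_rk1: "\<Phi> (rk x) = rk (S x)"
  using \<Phi>_rk[of 1 x] by simp

lemma rk_S_cong: "rk x = rk y \<Longrightarrow> rk (S x) = rk (S y)"
  by (metis \<Phi>_rk1)

text \<open>For \<open>x \<noteq> 0\<close>, the largest \<open>t\<close> with \<open>t rk x \<le> 1\<close> is the inverse square of the norm of \<open>x\<close>.\<close>

lemma norm_S: "norm (S x) = norm x"
proof (cases "x = 0")
  case True
  then have "rk (S x) = 0" using \<Phi>_rk1[of x] by (simp add: \<Phi>_zero)
  then show ?thesis using True by simp
next
  case False
  have S: "S x \<noteq> 0"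
    using False injD[of "rk x" 0] by (auto simp: \<Phi>_zero \<Phi>_rk1)
  have "t * (norm x)\<^sup>2 \<le> 1 \<longleftrightarrow> t * (norm (S x))\<^sup>2 \<le> 1" if "t \<ge> 0" for t
    using order[of "t *\<^sub>R rk x" 1] that by (simp add: \<Phi>_rk \<Phi>_one scaleR_rk_le_one_iff)
  from this[of "1 / (norm x)\<^sup>2"] this[of "1 / (norm (S x))\<^sup>2"]
  have "(norm (S x))\<^sup>2 = (norm x)\<^sup>2"
    using False S by (simp add: divide_le_eq_1)
  then show ?thesis by simp
qed

text \<open>By Bessel's inequality \<open>rk x + rk e \<le> 1\<close>, so \<open>rk (S x) + rk (S e) \<le> 1\<close>. At \<open>S x\<close> the first summand
  already attains the bound.\<close>

lemma S_orthogonal_units: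
  assumes "cinner x e = 0" "norm x = 1" "norm e = 1"
  shows "cinner (S x) (S e) = 0"
proof -
  have "\<Phi> (rk x + 1 *\<^sub>R rk e) \<le> \<Phi> 1"
    using orthogonal_rk_sum_le_one assms by (intro mono) auto
  then have "rk (S x) + rk (S e) \<le> 1"
    unfolding \<Phi>_add_rk \<Phi>_rk1 \<Phi>_one by simp
  then have "form (rk (S x) + rk (S e)) (S x) \<le> form 1 (S x)"
    by (simp only: le_form)
  then show ?thesis
    using assms by (simp add: form_rk_self norm_S) (simp add: form_rk)
qed

lemma S_orthogonal:
  assumes "cinner x e = 0" "norm e = 1"
  shows "cinner (S x) (S e) = 0"
proof (cases "x = 0")
  case True
  then show ?thesis using norm_S[of x] by simp
next
  case False
  define y where "y = (1 / norm x) *\<^sub>R x"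
  have "cinner (S y) (S e) = 0"
    using False assms by (intro S_orthogonal_units) (simp_all add: y_def cinner_simps)
  moreover have "rk (S x) = rk (norm x *\<^sub>R S y)"
    using \<Phi>_rk[of "(norm x)\<^sup>2" y] False \<Phi>_rk1[of x] by (simp add: y_def rk_scaleR power_divide)
  then obtain w where "S x = w *\<^sub>C (norm x *\<^sub>R S y)" using rk_eq_imp_phase by blast
  ultimately show ?thesis by (simp add: cinner_simps)
qed

text \<open>The polarization of \<open>x \<mapsto> rk (S x)\<close>; it is real-linear in \<open>x\<close> although \<open>S\<close> need not be.\<close>

definition derivative :: "'a \<Rightarrow> 'a \<Rightarrow> 'a sa" where
  "derivative e x = \<Phi> (cross e x)"

lemma \<Phi>_add_cross: "\<Phi> (A + t *\<^sub>R cross e x) = \<Phi> A + t *\<^sub>R derivative e x"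
proof -
  have add: "\<Phi> (A + t *\<^sub>R cross e x) = \<Phi> A + t *\<^sub>R (rk (S (x + e)) - rk (S x) - rk (S e))" for A t
  proof -
    have "A + t *\<^sub>R cross e x = A + t *\<^sub>R rk (x + e) + (- t) *\<^sub>R rk x + (- t) *\<^sub>R rk e"
      by (simp add: cross_def algebra_simps)
    then show ?thesis by (simp only: \<Phi>_add_rk) (simp add: algebra_simps)
  qed
  show ?thesis
    unfolding derivative_def using add[of 0 1] by (simp add: add \<Phi>_zero)
qed

lemma derivative_add: "derivative e (x + y) = derivative e x + derivative e y"
  using \<Phi>_add_cross[of "cross e x" 1 e y] by (simp add: derivative_def cross_add)

lemma derivative_scaleR: "derivative e (r *\<^sub>R x) = r *\<^sub>R derivative e x"
  using \<Phi>_add_cross[of 0 r e x] by (simp add: derivative_def cross_scaleR \<Phi>_zero)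

lemma rk_S_expand:
  "rk (S (x + c *\<^sub>C e)) = rk (S x) + (cmod c)\<^sup>2 *\<^sub>R rk (S e) +
     Re c *\<^sub>R derivative e x + (- Im c) *\<^sub>R derivative e (\<i> *\<^sub>C x)"
  unfolding \<Phi>_rk1[symmetric] rk_expand by (simp only: \<Phi>_add_rk \<Phi>_add_cross \<Phi>_rk1)

text \<open>For all real \<open>t\<close> the operator \<open>rk (S x) + t\<^sup>2 rk (S e) + t derivative e x\<close> equals
  \<open>rk (S (x + t e))\<close> and is positive. Therefore the form of the derivative vanishes at \<open>S x\<close>, at
  \<open>S e\<close> and on the orthogonal complement of both. Thus \<open>z = S (x + e)\<close> is a combination of \<open>S x\<close> and
  \<open>S e\<close> with unimodular coefficients, and the derivative is the cross term of \<open>rk z\<close>.\<close>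

lemma derivative_eq_cross:
  assumes e: "norm e = 1" and x: "cinner x e = 0"
  shows "\<exists>w. cmod w = 1 \<and> derivative e x = cross (S e) (w *\<^sub>C S x)"
proof (cases "x = 0")
  case True
  then have "derivative e x = 0" "S x = 0"
    using norm_S[of x] derivative_scaleR[of e 0 x] by simp_all
  then show ?thesis
    by (intro exI[of _ 1]) (simp add: cross_def)
next
  case False
  define f where "f = S e"
  define y where "y = S x"
  define z where "z = S (x + e)"
  have f: "norm f = 1" by (simp add: f_def norm_S e)
  have y: "y \<noteq> 0" using False norm_S[of x] by (auto simp: y_def)
  have yf: "cinner y f = 0" unfolding y_def f_def by (rule S_orthogonal[OF x e])
  have fy: "cinner f y = 0" using yf by (metis cinner_commute complex_cnj_zero)
  have expand: "rk (S (x + t *\<^sub>R e)) = rk y + t\<^sup>2 *\<^sub>R rk f + t *\<^sub>R derivative e x" for t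
    using rk_S_expand[of x "of_real t" e] by (simp add: y_def f_def scaleR_eq_scaleC)
  \<comment> \<open>An expression that is affine in \<open>t\<close>, or quadratic without constant term, and nonnegative for
    all \<open>t\<close> has no linear term.\<close>
  have nonneg: "0 \<le> form (rk y) v + t\<^sup>2 * form (rk f) v + t * form (derivative e x) v" for t v
  proof -
    have "0 \<le> form (rk (S (x + t *\<^sub>R e))) v" by (simp add: form_rk)
    then show ?thesis unfolding expand by simp
  qed
  have z: "rk z = rk y + rk f + derivative e x"
    using expand[of 1] by (simp add: z_def)
  have dy: "form (derivative e x) y = 0"
    using nonneg[where v = y] by (intro nonneg_affine_imp_slope_0[of "form (rk y) y"])
      (simp add: form_rk yf)
  have df: "form (derivative e x) f = 0"
    using nonneg[where v = f] f by (intro nonneg_quadratic_imp_slope_0)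
      (simp add: form_rk fy cinner_self)
  have dv: "form (derivative e x) v = 0" if "cinner v y = 0" "cinner v f = 0" for v
    using nonneg[where v = v] that by (intro nonneg_affine_imp_slope_0[of 0]) (simp add: form_rk)
  obtain a u where u: "z = u + a *\<^sub>C y" "cinner u y = 0" by (rule orthogonal_decomposition)
  obtain b v where v: "u = v + b *\<^sub>C f" "cinner v f = 0" by (rule orthogonal_decomposition)
  have vy: "cinner v y = 0" using u(2) fy by (simp add: v(1) cinner_simps)
  have "form (rk z) v = 0"
    unfolding z using vy v(2) by (simp add: form_rk dv)
  then have "cinner v z = 0" by (simp add: form_rk)
  then have "v = 0" using vy v(2) by (simp add: u(1) v(1) cinner_simps)
  then have z_eq: "z = b *\<^sub>C f + a *\<^sub>C y" by (simp add: u(1) v(1))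
  have "form (rk z) y = form (rk y) y"
    unfolding z by (simp add: dy) (simp add: form_rk yf)
  then have "(cmod a)\<^sup>2 = 1\<^sup>2"
    using y by (simp add: z_eq form_rk cinner_simps yf norm_mult power_mult_distrib)
  then have "cmod a = 1"
    by (simp only: power2_eq_iff_nonneg norm_ge_zero zero_le_one)
  moreover have "form (rk z) f = 1"
    unfolding z using f by (simp add: df) (simp add: form_rk fy cinner_self)
  then have "(cmod b)\<^sup>2 = 1\<^sup>2"
    using f by (simp add: z_eq form_rk cinner_simps fy norm_mult cinner_self)
  then have b: "cmod b = 1"
    by (simp only: power2_eq_iff_nonneg norm_ge_zero zero_le_one)
  ultimately have w: "cmod (a * cnj b) = 1" by (simp add: norm_mult)
  have "cnj b * b = 1"
    using b complex_norm_square[of b] by (simp add: mult.commute)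
  then have "cnj b *\<^sub>C z = (a * cnj b) *\<^sub>C y + f"
    by (simp add: z_eq scaleC_add_right scaleC_scaleC mult.commute)
  then have "rk z = rk ((a * cnj b) *\<^sub>C y + f)"
    using rk_scaleC[of "cnj b" z] b by simp
  then have "derivative e x = cross f ((a * cnj b) *\<^sub>C y)"
    using z w by (simp add: cross_def rk_scaleC algebra_simps)
  then show ?thesis using w by (auto simp: f_def y_def)
qed

text \<open>For \<open>y\<close> orthogonal to the unit vector \<open>S e\<close>, the operator \<open>cross (S e) y\<close> maps \<open>S e\<close> to \<open>y\<close>.
  Hence on the orthogonal complement of \<open>e\<close> this is a choice of phases for \<open>S\<close> that is
  real-linear, because the derivative is.\<close>

definition rephased :: "'a \<Rightarrow> 'a \<Rightarrow> 'a" where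
  "rephased e x = app (derivative e x) (S e)"

lemma rephased_real_linear:
  "rephased e (x + y) = rephased e x + rephased e y"
  "rephased e (r *\<^sub>R x) = r *\<^sub>R rephased e x"
  by (simp_all add: rephased_def derivative_add derivative_scaleR)

lemma rephased_phase:
  assumes e: "norm e = 1" and x: "cinner x e = 0"
  shows "\<exists>w. cmod w = 1 \<and> rephased e x = w *\<^sub>C S x"
    and "derivative e x = cross (S e) (rephased e x)"
proof -
  obtain w where w: "cmod w = 1" "derivative e x = cross (S e) (w *\<^sub>C S x)"
    using derivative_eq_cross[OF assms] by blast
  have "cinner (S e) (S x) = 0"
    using S_orthogonal[OF x e] by (metis cinner_commute complex_cnj_zero)
  then have "rephased e x = w *\<^sub>C S x"
    by (simp add: rephased_def w(2) app_cross cinner_self norm_S e cinner_simps)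
  then show "\<exists>w. cmod w = 1 \<and> rephased e x = w *\<^sub>C S x"
    "derivative e x = cross (S e) (rephased e x)"
    using w by auto
qed

lemma rk_rephased:
  assumes "norm e = 1" "cinner x e = 0"
  shows "rk (rephased e x) = rk (S x)" "norm (rephased e x) = norm x"
  using rephased_phase(1)[OF assms] by (auto simp: rk_scaleC norm_scaleC norm_S)

text \<open>Multiplication by the imaginary unit does not change \<open>rk x\<close>, so the two images differ by a phase
  \<open>w\<close>. Comparing the norms of \<open>x + \<i> x\<close> and of its image shows that \<open>w\<close> is purely imaginary.\<close>

lemma rephased_imaginary_pointwise:
  assumes e: "norm e = 1" and x: "cinner x e = 0"
  shows "rephased e (\<i> *\<^sub>C x) = \<i> *\<^sub>C rephased e x \<or>
         rephased e (\<i> *\<^sub>C x) = - (\<i> *\<^sub>C rephased e x)"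
proof (cases "x = 0")
  case True
  then show ?thesis using rephased_real_linear(2)[of e 0 x] by simp
next
  case False
  define y where "y = rephased e x"
  have y: "y \<noteq> 0" using False rk_rephased(2)[OF assms] by (auto simp: y_def)
  have ix: "cinner (\<i> *\<^sub>C x) e = 0" by (simp add: cinner_simps x)
  have "rk (rephased e (\<i> *\<^sub>C x)) = rk y"
    using rk_S_cong[of "\<i> *\<^sub>C x" x] by (simp add: y_def rk_rephased[OF e] x ix rk_scaleC)
  then obtain w where w: "cmod w = 1" "rephased e (\<i> *\<^sub>C x) = w *\<^sub>C y"
    using rk_eq_imp_phase by blast
  have "norm (y + w *\<^sub>C y) = norm (x + \<i> *\<^sub>C x)"
    using rk_rephased(2)[OF e, of "x + \<i> *\<^sub>C x"] x ix
    by (simp add: rephased_real_linear w(2) y_def cinner_simps)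
  moreover have "y + w *\<^sub>C y = (1 + w) *\<^sub>C y" "x + \<i> *\<^sub>C x = (1 + \<i>) *\<^sub>C x"
    by (simp_all add: scaleC_add_left)
  ultimately have "cmod (1 + w) * norm y = cmod (1 + \<i>) * norm y"
    using rk_rephased(2)[OF assms] by (simp add: norm_scaleC y_def)
  then have "(cmod (1 + w))\<^sup>2 = (cmod (1 + \<i>))\<^sup>2"
    using y by simp
  then have "Re w = 0"
    using arg_cong[OF w(1), of "\<lambda>r. r\<^sup>2"] by (simp add: cmod_power2 power2_sum)
  then have "w = \<i> \<or> w = - \<i>"
    using arg_cong[OF w(1), of "\<lambda>r. r\<^sup>2"]
    by (auto simp: cmod_power2 power2_eq_1_iff complex_eq_iff)
  then show ?thesis
    by (auto simp: w(2) y_def)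
qed

text \<open>The vectors on which \<open>rephased e\<close> commutes, respectively anticommutes, with the imaginary
  unit form two real subspaces that together cover the orthogonal complement of \<open>e\<close>.  A vector
  space is not the union of two proper subspaces, so one sign works throughout.\<close>

lemma rephased_imaginary:
  assumes e: "norm e = 1"
  obtains \<sigma> :: real where "\<sigma> = 1 \<or> \<sigma> = -1"
    "\<And>x. cinner x e = 0 \<Longrightarrow> rephased e (\<i> *\<^sub>C x) = \<sigma> *\<^sub>R (\<i> *\<^sub>C rephased e x)"
proof -
  let ?T = "rephased e"
  have "(\<forall>x. cinner x e = 0 \<longrightarrow> ?T (\<i> *\<^sub>C x) = \<i> *\<^sub>C ?T x) \<or>
        (\<forall>x. cinner x e = 0 \<longrightarrow> ?T (\<i> *\<^sub>C x) = - (\<i> *\<^sub>C ?T x))"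
  proof (rule ccontr)
    assume "\<not> ?thesis"
    then obtain x y where x: "cinner x e = 0" "?T (\<i> *\<^sub>C x) \<noteq> \<i> *\<^sub>C ?T x"
      and y: "cinner y e = 0" "?T (\<i> *\<^sub>C y) \<noteq> - (\<i> *\<^sub>C ?T y)"
      by blast
    have Tx: "?T (\<i> *\<^sub>C x) = - (\<i> *\<^sub>C ?T x)" and Ty: "?T (\<i> *\<^sub>C y) = \<i> *\<^sub>C ?T y"
      using rephased_imaginary_pointwise[OF e] x y by blast+
    have "?T (\<i> *\<^sub>C (x + y)) = \<i> *\<^sub>C ?T (x + y) \<or> ?T (\<i> *\<^sub>C (x + y)) = - (\<i> *\<^sub>C ?T (x + y))"
      using x y by (intro rephased_imaginary_pointwise[OF e]) (simp add: cinner_simps)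
    then have "- (\<i> *\<^sub>C ?T x) = \<i> *\<^sub>C ?T x \<or> \<i> *\<^sub>C ?T y = - (\<i> *\<^sub>C ?T y)"
      by (simp add: scaleC_add_right rephased_real_linear Tx Ty)
    then show False using x(2) y(2) Tx Ty by auto
  qed
  then show ?thesis
    using that[of 1] that[of "-1"] by auto
qed

text \<open>Every \<open>x\<close> is the sum of its part \<open>p x\<close> orthogonal to \<open>e\<close> and a multiple of \<open>e\<close>. On the first part
  the re-phased map is used; the coefficient of \<open>e\<close> is conjugated or not according to the sign \<open>\<sigma>\<close>.
  The expansion of \<open>rk\<close> along this decomposition then matches that of \<open>x \<mapsto> rk (S x)\<close>.\<close>

lemma real_linear_representative:
  fixes e :: 'a
  assumes e: "norm e = 1"
  obtains U :: "'a \<Rightarrow> 'a" and \<sigma> :: real where "\<sigma> = 1 \<or> \<sigma> = -1"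
    "\<And>x y. U (x + y) = U x + U y" "\<And>c x. U (c *\<^sub>C x) = twist \<sigma> c *\<^sub>C U x"
    "\<And>x. rk (U x) = rk (S x)"
proof -
  let ?T = "rephased e"
  obtain \<sigma> :: real where \<sigma>: "\<sigma> = 1 \<or> \<sigma> = -1"
    and im: "\<And>x. cinner x e = 0 \<Longrightarrow> ?T (\<i> *\<^sub>C x) = \<sigma> *\<^sub>R (\<i> *\<^sub>C ?T x)"
    using rephased_imaginary[OF e] by blast
  define f where "f = S e"
  define p where "p x = x - cinner x e *\<^sub>C e" for x
  define U where "U x = ?T (p x) + twist \<sigma> (cinner x e) *\<^sub>C f" for x
  have p: "cinner (p x) e = 0" for x
    by (simp add: p_def cinner_simps cinner_self e)
  have p_linear: "p (x + y) = p x + p y" "p (c *\<^sub>C x) = c *\<^sub>C p x" for x y c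
    by (simp_all add: p_def cinner_simps scaleC_add_left scaleC_add_right
        complex_vector.scale_right_diff_distrib scaleC_scaleC)
  have T_scaleC: "?T (c *\<^sub>C x) = twist \<sigma> c *\<^sub>C ?T x" if "cinner x e = 0" for c x
  proof -
    have "?T (c *\<^sub>C x) = Re c *\<^sub>R ?T x + Im c *\<^sub>R ?T (\<i> *\<^sub>C x)"
      by (subst scaleC_real_imag) (simp add: rephased_real_linear)
    then show ?thesis
      by (subst (2) scaleC_real_imag) (simp add: twist_def im[OF that] mult.commute)
  qed
  have "U (x + y) = U x + U y" for x y
    by (simp add: U_def p_linear rephased_real_linear cinner_simps twist_def
        flip: scaleC_add_left) (simp add: algebra_simps flip: scaleC_add_left complex_add)
  moreover have "twist \<sigma> (c * d) = twist \<sigma> c * twist \<sigma> d" for c d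
    using \<sigma> by (auto simp: twist_def complex_eq_iff)
  then have "U (c *\<^sub>C x) = twist \<sigma> c *\<^sub>C U x" for x c
    by (simp add: U_def p_linear T_scaleC[OF p] cinner_simps scaleC_add_right scaleC_scaleC)
  moreover have "rk (U x) = rk (S x)" for x
  proof -
    have x: "x = p x + cinner x e *\<^sub>C e" by (simp add: p_def)
    have ip: "cinner (\<i> *\<^sub>C p x) e = 0" by (simp add: cinner_simps p)
    have "(cmod (twist \<sigma> (cinner x e)))\<^sup>2 = (cmod (cinner x e))\<^sup>2"
      using \<sigma> by (auto simp: twist_def cmod_power2)
    then have "rk (U x) = rk (?T (p x)) + (cmod (cinner x e))\<^sup>2 *\<^sub>R rk f +
        Re (cinner x e) *\<^sub>R cross f (?T (p x)) + (- \<sigma> * Im (cinner x e)) *\<^sub>R cross f (\<i> *\<^sub>C ?T (p x))"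
      unfolding U_def rk_expand by (simp add: twist_def)
    also have "\<dots> = rk (S (p x)) + (cmod (cinner x e))\<^sup>2 *\<^sub>R rk f +
        Re (cinner x e) *\<^sub>R derivative e (p x) + (- Im (cinner x e)) *\<^sub>R derivative e (\<i> *\<^sub>C p x)"
      using rephased_phase(2)[OF e p] rephased_phase(2)[OF e ip] rk_rephased(1)[OF e p]
      by (simp add: f_def im[OF p] cross_scaleR mult.commute)
    also have "\<dots> = rk (S x)"
      unfolding f_def rk_S_expand[symmetric] x[symmetric] ..
    finally show ?thesis .
  qed
  ultimately show ?thesis using that \<sigma> by blast
qed

end

section \<open>Conjugation by a unitary or antiunitary operator\<close>

locale semiunitary =
  fixes U :: "'a::complex_hilbert_space \<Rightarrow> 'a" and \<sigma> :: real
  assumes sign: "\<sigma> = 1 \<or> \<sigma> = -1"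
    and U_add: "U (x + y) = U x + U y"
    and U_scaleC: "U (c *\<^sub>C x) = twist \<sigma> c *\<^sub>C U x"
    and norm_U: "norm (U x) = norm x"
    and surj_U: "surj U"
begin

lemma twist_twist: "twist \<sigma> (twist \<sigma> c) = c"
  using sign by (auto simp: twist_def)

lemma U_scaleR: "U (r *\<^sub>R x) = r *\<^sub>R U x"
  by (simp add: scaleR_eq_scaleC U_scaleC) (simp add: twist_def complex_of_real_def)

lemma U_linear: "linear U"
  by (rule linearI) (simp_all add: U_add U_scaleR)

lemma U_diff: "U (x - y) = U x - U y"
  by (rule linear_diff[OF U_linear])

lemma bij_U: "bij U"
proof -
  have "inj U"
  proof (rule injI)
    fix x y assume "U x = U y"
    then have "norm (x - y) = 0" using norm_U[of "x - y"] by (simp add: U_diff)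
    then show "x = y" by simp
  qed
  then show ?thesis using surj_U by (simp add: bij_def)
qed

lemma inv_U: "inv U (U x) = x" "U (inv U x) = x"
  using bij_U by (simp_all add: bij_is_inj bij_is_surj surj_f_inv_f)

lemma inner_U: "inner (U x) (U y) = inner x y"
  by (simp add: dot_norm norm_U flip: U_add)

lemma cinner_U: "cinner (U x) (U y) = twist \<sigma> (cinner x y)"
proof -
  have "\<i> *\<^sub>C U y = \<sigma> *\<^sub>R U (\<i> *\<^sub>C y)"
  proof -
    have "\<i> = of_real \<sigma> * twist \<sigma> \<i>" using sign by (auto simp: twist_def complex_eq_iff)
    then show ?thesis by (simp add: U_scaleC scaleR_eq_scaleC scaleC_scaleC)
  qed
  then show ?thesis
    by (simp add: cinner_eq_inner inner_U twist_def)
qed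

lemma cmod_cinner_U: "cmod (cinner (U x) (U y)) = cmod (cinner x y)"
  using sign by (auto simp: cinner_U twist_def cmod_def)

lemma semiunitary_inv: "semiunitary (inv U) \<sigma>"
proof
  show "\<sigma> = 1 \<or> \<sigma> = -1" by (rule sign)
  show "surj (inv U)" using bij_U by (simp add: bij_imp_bij_inv bij_is_surj)
  fix x y and c :: complex
  show "inv U (x + y) = inv U x + inv U y"
    by (metis U_add inv_U)
  show "inv U (c *\<^sub>C x) = twist \<sigma> c *\<^sub>C inv U x"
    by (metis U_scaleC inv_U twist_twist)
  show "norm (inv U x) = norm x"
    by (metis norm_U inv_U(2))
qed

end

locale implemented_automorphism =
  normalised_automorphism \<Phi> U + semiunitary U \<sigma>
  for \<Phi> :: "'a::complex_hilbert_space sa \<Rightarrow> 'a sa" and U \<sigma>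
begin

lemma implemented_inv: "implemented_automorphism (inv \<Phi>) (inv U) \<sigma>"
proof -
  interpret I: order_automorphism "inv \<Phi>" by (rule inverse)
  interpret V: semiunitary "inv U" \<sigma> by (rule semiunitary_inv)
  show ?thesis
  proof
    show "inv \<Phi> 0 = 0" "inv \<Phi> 1 = 1"
      using inv_eq(1)[of 0] inv_eq(1)[of 1] by (simp_all add: \<Phi>_zero \<Phi>_one)
    show "inv \<Phi> (B + t *\<^sub>R rk y) = inv \<Phi> B + t *\<^sub>R rk (inv U y)" for B t y
    proof (rule injD)
      show "\<Phi> (inv \<Phi> (B + t *\<^sub>R rk y)) = \<Phi> (inv \<Phi> B + t *\<^sub>R rk (inv U y))"
        by (simp add: inv_eq \<Phi>_add_rk inv_U)
    qed
  qed
qed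

text \<open>A positive operator dominates rank-one operators touching its form at any prescribed
  vector, and \<open>\<Phi>\<close> is known on these.\<close>

lemma form_le_if_nonneg:
  assumes "0 \<le> A"
  shows "form A v \<le> form (\<Phi> A) (U v)"
proof (cases "form A v = 0")
  case True
  have "\<Phi> 0 \<le> \<Phi> A" using assms by (rule mono)
  then show ?thesis by (simp add: True \<Phi>_zero le_form)
next
  case False
  have "\<Phi> ((1 / form A v) *\<^sub>R rk (app A v)) \<le> \<Phi> A"
    by (intro mono rk_below_positive assms)
  then have "form ((1 / form A v) *\<^sub>R rk (U (app A v))) (U v) \<le> form (\<Phi> A) (U v)"
    unfolding \<Phi>_rk le_form by blast
  moreover have "form ((1 / form A v) *\<^sub>R rk (U (app A v))) (U v) = form A v"
    using False
    by (simp add: form_rk cmod_cinner_U cmod_cinner_commute[of v] form_cinner power2_eq_square)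
  ultimately show ?thesis by simp
qed

end

context implemented_automorphism
begin

text \<open>The inverse automorphism satisfies the same hypotheses and provides the reverse inequality.\<close>

lemma form_eq_if_nonneg:
  assumes "0 \<le> A"
  shows "form (\<Phi> A) (U v) = form A v"
proof -
  interpret I: implemented_automorphism "inv \<Phi>" "inv U" \<sigma> by (rule implemented_inv)
  have "0 \<le> \<Phi> A" using mono[OF assms] by (simp add: \<Phi>_zero)
  then have "form (\<Phi> A) (U v) \<le> form A v"
    using I.form_le_if_nonneg[of "\<Phi> A" "U v"] by (simp add: inv_eq inv_U)
  then show ?thesis using form_le_if_nonneg[OF assms, of v] by simp
qed

text \<open>An arbitrary operator lies below one that has the same form at \<open>x\<close> and is positive up to a
  multiple of \<open>rk x\<close>.\<close>

lemma form_le: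
  shows "form (\<Phi> A) (U x) \<le> form A x"
proof (cases "x = 0")
  case True
  then show ?thesis using norm_U[of 0] by (simp add: form_def)
next
  case False
  obtain r where r: "r \<ge> 0" "- (r *\<^sub>R 1) \<le> A" using bounded_by_identity[of A] by blast
  \<comment> \<open>The added operator is positive, its form vanishes at \<open>x\<close>, and together with \<open>K rk x\<close> it is \<open>r\<close>.\<close>
  define K where "K = r / (norm x)\<^sup>2"
  define B where "B = A + K *\<^sub>R ((norm x)\<^sup>2 *\<^sub>R 1 - rk x)"
  have K: "K \<ge> 0" "K * (norm x)\<^sup>2 = r" using False r(1) by (simp_all add: K_def)
  have "(1 / (norm x)\<^sup>2) *\<^sub>R rk x \<le> 1"
    using False by (subst scaleR_rk_le_one_iff) auto
  then have "(norm x)\<^sup>2 *\<^sub>R ((1 / (norm x)\<^sup>2) *\<^sub>R rk x) \<le> (norm x)\<^sup>2 *\<^sub>R 1"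
    by (rule scaleR_left_mono) simp
  then have "rk x \<le> (norm x)\<^sup>2 *\<^sub>R 1" using False by simp
  then have AB: "A \<le> B" using K(1) by (simp add: B_def scaleR_nonneg_nonneg)
  have "B + K *\<^sub>R rk x = A + r *\<^sub>R 1"
    using K(2) by (simp add: B_def algebra_simps)
  moreover have "0 \<le> A + r *\<^sub>R 1"
    using add_right_mono[OF r(2), of "r *\<^sub>R 1"] by simp
  ultimately have "0 \<le> B + K *\<^sub>R rk x" by simp
  then have "form (\<Phi> (B + K *\<^sub>R rk x)) (U x) = form (B + K *\<^sub>R rk x) x"
    by (rule form_eq_if_nonneg)
  then have "form (\<Phi> B) (U x) = form B x"
    by (simp add: \<Phi>_add_rk form_rk cmod_cinner_U)
  moreover have "form B x = form A x"
    by (simp add: B_def form_rk_self power2_eq_square power4_eq_xxxx)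
  moreover have "form (\<Phi> A) (U x) \<le> form (\<Phi> B) (U x)"
    using mono[OF AB] by (simp add: le_form)
  ultimately show ?thesis by simp
qed

lemma form_\<Phi>: "form (\<Phi> A) (U x) = form A x"
proof -
  interpret I: implemented_automorphism "inv \<Phi>" "inv U" \<sigma> by (rule implemented_inv)
  have "form A x \<le> form (\<Phi> A) (U x)"
    using I.form_le[of "\<Phi> A" "U x"] by (simp add: inv_eq inv_U)
  then show ?thesis using form_le[of A x] by simp
qed

lemma app_\<Phi>: "app (\<Phi> A) = (\<lambda>x. U (app A (inv U x)))"
proof
  fix x
  obtain y where x: "x = U y" by (metis inv_U(2))
  have "app (\<Phi> A) (U y) = U (app A y)"
  proof -
    have "inner (app (\<Phi> A) (U y)) (U z) = inner (U (app A y)) (U z)" for z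
      using form_\<Phi>[of A "y + z"] form_\<Phi>[of A y] form_\<Phi>[of A z]
      by (simp add: form_add_arg U_add inner_U)
    then have "inner (app (\<Phi> A) (U y) - U (app A y)) w = 0" for w
      using inv_U(2)[of w] by (simp add: inner_diff_left) metis
    from this[of "app (\<Phi> A) (U y) - U (app A y)"] show ?thesis by simp
  qed
  then show "app (\<Phi> A) x = U (app A (inv U x))" by (simp add: x inv_U)
qed

end

text \<open>All facts about \<open>S\<close> that matter are facts about \<open>rk (S x)\<close>, so \<open>S\<close> may be replaced by the
  linear or conjugate-linear map \<open>U\<close>. It is surjective because every \<open>rk w\<close> is the image of some
  \<open>rk y\<close> under \<open>\<Phi>\<close>, and phases can be moved through \<open>U\<close>.\<close>

theorem normalised_order_automorphism:
  fixes \<Phi> :: "'a::complex_hilbert_space sa \<Rightarrow> 'a sa"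
  assumes aut: "order_automorphism \<Phi>" and zero: "\<Phi> 0 = 0" and one: "\<Phi> 1 = 1"
    and dim: "\<And>x :: 'a. \<exists>e. e \<noteq> 0 \<and> cinner e x = 0"
  obtains U \<sigma> where "semiunitary U \<sigma>" "\<And>A. app (\<Phi> A) = (\<lambda>x. U (app A (inv U x)))"
proof -
  interpret order_automorphism \<Phi> by (rule aut)
  obtain S where S: "\<And>A t x. \<Phi> (A + t *\<^sub>R rk x) = \<Phi> A + t *\<^sub>R rk (S x)"
    using affine_on_rank_one[OF dim] by blast
  interpret N: normalised_automorphism \<Phi> S
    by unfold_locales (fact zero one S)+
  obtain v :: 'a where "v \<noteq> 0" using dim by blast
  then have unit: "norm ((1 / norm v) *\<^sub>R v) = 1" by simp
  obtain U \<sigma> where U: "\<sigma> = 1 \<or> \<sigma> = -1"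
    "\<And>x y. U (x + y) = U x + U y" "\<And>c x. U (c *\<^sub>C x) = twist \<sigma> c *\<^sub>C U x"
    "\<And>x. rk (U x) = rk (S x)"
    by (rule N.real_linear_representative[OF unit], rule that)
  have norm: "norm (U x) = norm x" for x
    using rk_eq_imp_norm_eq[OF U(4)] by (simp add: N.norm_S)
  have surj: "surj U"
    unfolding surj_def
  proof
    fix w
    interpret I: order_automorphism "inv \<Phi>" by (rule inverse)
    obtain y where "inv \<Phi> (0 + rk w) = inv \<Phi> 0 + rk y" using I.add_rk by blast
    then have "\<Phi> (rk y) = rk w"
      using inv_eq(1)[of 0] inv_eq(2)[of "rk w"] by (simp add: zero)
    then have "rk w = rk (U y)" by (simp add: N.\<Phi>_rk1 U(4))
    then obtain c where "w = c *\<^sub>C U y" using rk_eq_imp_phase by blast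
    moreover have "twist \<sigma> (twist \<sigma> c) = c" using U(1) by (auto simp: twist_def)
    ultimately have "w = U (twist \<sigma> c *\<^sub>C y)" by (simp add: U(3))
    then show "\<exists>x. w = U x" ..
  qed
  interpret semiunitary U \<sigma>
    by unfold_locales (fact U norm surj)+
  interpret implemented_automorphism \<Phi> U \<sigma>
    by unfold_locales (simp_all add: zero one N.\<Phi>_add_rk U(4))
  show ?thesis
    using that[OF semiunitary_axioms] app_\<Phi> by blast
qed

section \<open>Absolute value of a self-adjoint operator\<close>

definition commuting :: "'a::complex_hilbert_space sa \<Rightarrow> 'a sa \<Rightarrow> bool" where
  "commuting A B \<longleftrightarrow> (\<forall>x. app A (app B x) = app B (app A x))"

lemma bounded_linear_app: "bounded_linear (app A)"
  using app[of A] by (simp add: selfadjoint_iff_symmetric)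

text \<open>The limit of the iterates is a solution \<open>b\<close> of \<open>2 b = d + b\<^sup>2\<close>. For \<open>d = 1 - C\<^sup>2\<close> this says
  \<open>(1 - b)\<^sup>2 = C\<^sup>2\<close>, so \<open>1 - b\<close> is the absolute value of \<open>C\<close>.\<close>

fun sqrt_iter :: "('a::real_normed_vector \<Rightarrow>\<^sub>L 'a) \<Rightarrow> nat \<Rightarrow> ('a \<Rightarrow>\<^sub>L 'a)" where
  "sqrt_iter d 0 = 0"
| "sqrt_iter d (Suc n) = (1/2) *\<^sub>R (d + (sqrt_iter d n o\<^sub>L sqrt_iter d n))"

text \<open>The same iteration for the number \<open>d = 1\<close>. It bounds the norms of the iterates and of their
  increments whenever \<open>norm d \<le> 1\<close>, and it converges because it is monotone and bounded.\<close>

fun sqrt_majorant :: "nat \<Rightarrow> real" where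
  "sqrt_majorant 0 = 0"
| "sqrt_majorant (Suc n) = (1 + (sqrt_majorant n)\<^sup>2) / 2"

lemma sqrt_majorant_bounds: "0 \<le> sqrt_majorant n \<and> sqrt_majorant n \<le> 1"
  by (induction n) (auto simp: power_le_one)

lemma norm_sqrt_iter:
  assumes "norm d \<le> 1"
  shows "norm (sqrt_iter d n) \<le> sqrt_majorant n"
proof (induction n)
  case (Suc n)
  have "norm ((sqrt_iter d n o\<^sub>L sqrt_iter d n)) \<le> norm (sqrt_iter d n) * norm (sqrt_iter d n)"
    by (rule norm_blinfun_compose)
  also have "\<dots> \<le> sqrt_majorant n * sqrt_majorant n"
    using Suc sqrt_majorant_bounds by (intro mult_mono) auto
  finally have "norm (d + (sqrt_iter d n o\<^sub>L sqrt_iter d n)) \<le> 1 + (sqrt_majorant n)\<^sup>2"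
    using assms norm_triangle_ineq[of d "(sqrt_iter d n o\<^sub>L sqrt_iter d n)"]
    by (simp add: power2_eq_square)
  then show ?case by simp
qed simp

lemma norm_sqrt_iter_diff:
  assumes "norm d \<le> 1"
  shows "norm (sqrt_iter d (Suc n) - sqrt_iter d n) \<le> sqrt_majorant (Suc n) - sqrt_majorant n"
proof (induction n)
  case 0
  then show ?case using assms by simp
next
  case (Suc n)
  let ?b = "sqrt_iter d (Suc n)" and ?a = "sqrt_iter d n"
  let ?s = "sqrt_majorant (Suc n)" and ?r = "sqrt_majorant n"
  have "sqrt_iter d (Suc (Suc n)) - ?b = (1/2) *\<^sub>R (d + (?b o\<^sub>L ?b)) - (1/2) *\<^sub>R (d + (?a o\<^sub>L ?a))"
    by (simp only: sqrt_iter.simps)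
  also have "\<dots> = (1/2) *\<^sub>R ((?b o\<^sub>L ?b) - (?a o\<^sub>L ?a))"
    by (simp only: scaleR_diff_right[symmetric] add_diff_cancel_left)
  also have "(?b o\<^sub>L ?b) - (?a o\<^sub>L ?a) = (?b o\<^sub>L (?b - ?a)) + ((?b - ?a) o\<^sub>L ?a)"
    by (simp add: bounded_bilinear.diff_left[OF bounded_bilinear_blinfun_compose]
        bounded_bilinear.diff_right[OF bounded_bilinear_blinfun_compose] del: sqrt_iter.simps)
  finally have eq: "sqrt_iter d (Suc (Suc n)) - ?b = (1/2) *\<^sub>R ((?b o\<^sub>L (?b - ?a)) + ((?b - ?a) o\<^sub>L ?a))" .
  have "norm ((?b o\<^sub>L (?b - ?a))) \<le> ?s * (?s - ?r)"
    using norm_blinfun_compose[of ?b "?b - ?a"] Suc norm_sqrt_iter[OF assms, of "Suc n"]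
    by (meson mult_mono norm_ge_zero order_trans)
  moreover have "norm (((?b - ?a) o\<^sub>L ?a)) \<le> (?s - ?r) * ?r"
    using norm_blinfun_compose[of "?b - ?a" ?a] Suc norm_sqrt_iter[OF assms, of n]
    by (meson mult_mono norm_ge_zero order_trans)
  ultimately have "norm ((?b o\<^sub>L (?b - ?a)) + ((?b - ?a) o\<^sub>L ?a)) \<le> ?s * (?s - ?r) + (?s - ?r) * ?r"
    by (rule norm_triangle_mono)
  then have "norm (sqrt_iter d (Suc (Suc n)) - ?b) \<le> (?s * (?s - ?r) + (?s - ?r) * ?r) / 2"
    unfolding eq by simp
  also have "\<dots> = sqrt_majorant (Suc (Suc n)) - ?s"
    by (simp add: power2_eq_square field_simps)
  finally show ?case .
qed

lemma sqrt_majorant_mono: "sqrt_majorant n \<le> sqrt_majorant (Suc n)"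
  using norm_sqrt_iter_diff[of "0 :: real \<Rightarrow>\<^sub>L real" n] norm_ge_zero 
  by (metis diff_ge_0_iff_ge norm_zero order_trans zero_le_one)

lemma sqrt_iter_convergent:
  fixes d :: "'a::banach \<Rightarrow>\<^sub>L 'a"
  assumes "norm d \<le> 1"
  shows "convergent (sqrt_iter d)"
proof -
  let ?r = sqrt_majorant
  have "incseq ?r" by (rule incseq_SucI) (rule sqrt_majorant_mono)
  then have "convergent ?r"
    using sqrt_majorant_bounds by (intro Bseq_mono_convergent BseqI'[of _ 1])
      (auto simp: incseq_def)
  then have "summable (\<lambda>n. ?r (Suc n) - ?r n)"
    by (intro telescope_summable) (auto simp: convergent_LIMSEQ_iff)
  then have "summable (\<lambda>n. sqrt_iter d (Suc n) - sqrt_iter d n)"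
    by (rule summable_comparison_test'[where N = 0]) (rule norm_sqrt_iter_diff[OF assms])
  then have "convergent (\<lambda>n. \<Sum>k<n. sqrt_iter d (Suc k) - sqrt_iter d k)"
    by (rule summable_iff_convergent[THEN iffD1])
  then show ?thesis by (simp add: sum_lessThan_telescope del: sqrt_iter.simps(2))
qed

text \<open>All iterates are symmetric and commute with whatever commutes with \<open>C\<close>, in particular with the
  imaginary unit, and these properties pass to the limit \<open>L\<close>. The operator \<open>1 - L\<close> is positive
  since \<open>norm L \<le> 1\<close>.\<close>

lemma contraction_absolute_value:
  fixes C :: "'a::complex_hilbert_space sa"
  assumes C: "\<And>x. norm (app C x) \<le> norm x"
  shows "\<exists>D. 0 \<le> D \<and> (\<forall>x. app D (app D x) = app C (app C x)) \<and>
     (\<forall>B. commuting B C \<longrightarrow> commuting B D)"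
proof -
  define d where "d = id_blinfun - (Blinfun (app C) o\<^sub>L Blinfun (app C))"
  have d: "blinfun_apply d x = x - app C (app C x)" for x
    by (simp add: d_def blinfun.diff_left bounded_linear_Blinfun_apply bounded_linear_app)
  have "norm d \<le> 1"
  proof (rule norm_blinfun_bound)
    fix x
    have "(norm (blinfun_apply d x))\<^sup>2 = (norm x)\<^sup>2 - 2 * (norm (app C x))\<^sup>2 + (norm (app C (app C x)))\<^sup>2"
      by (simp add: d power2_norm_eq_inner inner_diff_left inner_diff_right app_symmetric inner_commute)
    also have "\<dots> \<le> (norm x)\<^sup>2 - (norm (app C x))\<^sup>2"
      using power_mono[OF C[of "app C x"], of 2] by simp
    finally have "(norm (blinfun_apply d x))\<^sup>2 \<le> (norm x)\<^sup>2"
      by (rule order_trans) simp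
    then show "norm (blinfun_apply d x) \<le> 1 * norm x"
      by (simp add: power2_le_iff_abs_le)
  qed simp
  then obtain L where L: "sqrt_iter d \<longlonglongrightarrow> L"
    using sqrt_iter_convergent by (auto simp: convergent_def)
  have lim: "(\<lambda>n. blinfun_apply (sqrt_iter d n) x) \<longlonglongrightarrow> blinfun_apply L x" for x
    by (intro tendsto_intros L)
  have "norm L \<le> 1"
  proof (rule LIMSEQ_le_const2)
    show "(\<lambda>n. norm (sqrt_iter d n)) \<longlonglongrightarrow> norm L" by (intro tendsto_intros L)
    show "\<exists>N. \<forall>n\<ge>N. norm (sqrt_iter d n) \<le> 1"
      using norm_sqrt_iter[OF \<open>norm d \<le> 1\<close>] sqrt_majorant_bounds by (meson order_trans)
  qed
  have fixpoint: "blinfun_apply L x = (1/2) *\<^sub>R (x - app C (app C x) + blinfun_apply L (blinfun_apply L x))" for x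
  proof (rule LIMSEQ_unique)
    show "(\<lambda>n. blinfun_apply (sqrt_iter d (Suc n)) x) \<longlonglongrightarrow> blinfun_apply L x"
      by (rule LIMSEQ_Suc[OF lim])
    have "(\<lambda>n. (1/2) *\<^sub>R (x - app C (app C x) + blinfun_apply (sqrt_iter d n) (blinfun_apply (sqrt_iter d n) x)))
        \<longlonglongrightarrow> (1/2) *\<^sub>R (x - app C (app C x) + blinfun_apply L (blinfun_apply L x))"
      by (intro tendsto_intros L)
    then show "(\<lambda>n. blinfun_apply (sqrt_iter d (Suc n)) x) \<longlonglongrightarrow>
        (1/2) *\<^sub>R (x - app C (app C x) + blinfun_apply L (blinfun_apply L x))"
      by (simp add: blinfun.add_left blinfun.scaleR_left d)
  qed
  have commute: "blinfun_apply L (T x) = T (blinfun_apply L x)"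
    if T: "bounded_linear T" "\<And>x. T (app C x) = app C (T x)" for T x
  proof -
    note T_lin = bounded_linear.linear[OF T(1)]
    have iter: "blinfun_apply (sqrt_iter d n) (T x) = T (blinfun_apply (sqrt_iter d n) x)" for n x
      by (induction n arbitrary: x)
        (simp_all add: linear_0[OF T_lin] blinfun.add_left blinfun.scaleR_left d T(2)
          linear_add[OF T_lin] linear_diff[OF T_lin] linear_scale[OF T_lin])
    show ?thesis
      by (rule LIMSEQ_unique[OF lim]) (simp add: iter bounded_linear.tendsto[OF T(1)] lim)
  qed
  have sym: "inner (blinfun_apply L x) y = inner x (blinfun_apply L y)" for x y
  proof -
    have iter: "inner (blinfun_apply (sqrt_iter d n) x) y = inner x (blinfun_apply (sqrt_iter d n) y)" for n x y
      by (induction n arbitrary: x y)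
        (simp_all add: blinfun.add_left blinfun.scaleR_left d inner_add_left inner_add_right
          inner_diff_left inner_diff_right app_symmetric)
    have "(\<lambda>n. inner (blinfun_apply (sqrt_iter d n) x) y) \<longlonglongrightarrow> inner (blinfun_apply L x) y"
      by (intro tendsto_intros lim)
    moreover have "(\<lambda>n. inner (blinfun_apply (sqrt_iter d n) x) y) \<longlonglongrightarrow> inner x (blinfun_apply L y)"
      unfolding iter by (intro tendsto_intros lim)
    ultimately show ?thesis by (rule LIMSEQ_unique)
  qed
  have "blinfun_apply L \<in> selfadjoint_ops"
    unfolding selfadjoint_iff_symmetric
    by (intro conjI allI commute bounded_linear_scaleC)
      (simp_all add: blinfun.bounded_linear_right sym)
  then have L_app: "app (Abs_sa (blinfun_apply L)) = blinfun_apply L"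
    by (rule Abs_sa_inverse)
  define D where "D = 1 - Abs_sa (blinfun_apply L)"
  have D: "app D x = x - blinfun_apply L x" for x
    by (simp add: D_def L_app)
  have "0 \<le> D"
    unfolding le_form
  proof
    fix v
    have "inner (blinfun_apply L v) v \<le> norm (blinfun_apply L v) * norm v"
      by (rule norm_cauchy_schwarz)
    also have "\<dots> \<le> (norm L * norm v) * norm v"
      by (intro mult_right_mono norm_blinfun) simp
    also have "\<dots> \<le> (1 * norm v) * norm v"
      using \<open>norm L \<le> 1\<close> by (intro mult_right_mono) auto
    finally show "form 0 v \<le> form D v"
      by (simp add: form_def D inner_diff_left power2_norm_eq_inner[symmetric] power2_eq_square)
  qed
  moreover have "app D (app D x) = app C (app C x)" for x
  proof -
    have "2 *\<^sub>R blinfun_apply L x = x - app C (app C x) + blinfun_apply L (blinfun_apply L x)"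
      by (subst fixpoint) simp
    then show ?thesis by (simp add: D blinfun.diff_right scaleR_2 algebra_simps)
  qed
  moreover have "commuting B D" if "commuting B C" for B
    using commute[OF bounded_linear_app[of B]] that by (simp add: commuting_def D)
  ultimately show ?thesis by blast
qed

lemma absolute_value:
  fixes C :: "'a::complex_hilbert_space sa"
  obtains D where "0 \<le> D" "\<And>x. app D (app D x) = app C (app C x)"
    "\<And>B. commuting B C \<Longrightarrow> commuting B D"
proof -
  obtain K where K: "K > 0" "\<And>x. norm (app C x) \<le> norm x * K"
    using bounded_linear.pos_bounded[OF bounded_linear_app] by blast
  have "\<exists>D. 0 \<le> D \<and> (\<forall>x. app D (app D x) = app ((1/K) *\<^sub>R C) (app ((1/K) *\<^sub>R C) x)) \<and>
     (\<forall>B. commuting B ((1/K) *\<^sub>R C) \<longrightarrow> commuting B D)"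
    using K by (intro contraction_absolute_value) (simp add: divide_le_eq)
  then obtain D where D: "0 \<le> D" "\<And>x. app D (app D x) = (1/K) *\<^sub>R (1/K) *\<^sub>R app C (app C x)"
    "\<And>B. commuting B ((1/K) *\<^sub>R C) \<Longrightarrow> commuting B D"
    by auto
  show ?thesis
  proof (rule that[of "K *\<^sub>R D"])
    show "0 \<le> K *\<^sub>R D" using D(1) K(1) by (simp add: scaleR_nonneg_nonneg)
    show "app (K *\<^sub>R D) (app (K *\<^sub>R D) x) = app C (app C x)" for x
      using K(1) by (simp add: D(2))
    show "commuting B (K *\<^sub>R D)" if "commuting B C" for B
      using D(3)[of B] that by (simp add: commuting_def)
  qed
qed

section \<open>Orthogonal projections\<close>

lemmas inner_expand = inner_add_left inner_add_right inner_diff_left inner_diff_right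

text \<open>By the parallelogram law a sequence in \<open>M\<close> that minimises the distance to \<open>x\<close> is Cauchy; its limit
  attains the minimum. Minimality along the line through the limit in direction \<open>y\<close> gives the
  orthogonality.\<close>

lemma orthogonal_projection_exists:
  fixes M :: "'a::{real_inner, complete_space} set"
  assumes M: "subspace M" "closed M"
  shows "\<exists>m\<in>M. \<forall>y\<in>M. inner (x - m) y = 0"
proof -
  define \<delta> where "\<delta> = (INF m\<in>M. (norm (x - m))\<^sup>2)"
  have bdd: "bdd_below ((\<lambda>m. (norm (x - m))\<^sup>2) ` M)" by (rule bdd_belowI[of _ 0]) auto
  have ne: "M \<noteq> {}" using subspace_0[OF M(1)] by auto
  have lower: "\<delta> \<le> (norm (x - m))\<^sup>2" if "m \<in> M" for m
    unfolding \<delta>_def using that bdd by (rule cINF_lower[rotated])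
  have "\<exists>m\<in>M. (norm (x - m))\<^sup>2 < \<delta> + 1 / real (Suc n)" for n
    using cINF_less_iff[OF ne bdd, of "\<delta> + 1 / real (Suc n)"] by (simp add: \<delta>_def)
  then obtain m where m: "\<And>n. m n \<in> M" "\<And>n. (norm (x - m n))\<^sup>2 < \<delta> + 1 / real (Suc n)"
    by metis
  \<comment> \<open>The midpoint of \<open>m n\<close> and \<open>m k\<close> cannot be closer to \<open>x\<close> than the infimum.\<close>
  have close: "(norm (m n - m k))\<^sup>2 \<le> 2 / real (Suc n) + 2 / real (Suc k)" for n k
  proof -
    have "(1/2) *\<^sub>R (m n + m k) \<in> M"
      using m(1) M(1) by (intro subspace_scale subspace_add)
    then have "4 * \<delta> \<le> 4 * (norm (x - (1/2) *\<^sub>R (m n + m k)))\<^sup>2" using lower by simp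
    also have "\<dots> = 2 * (norm (x - m n))\<^sup>2 + 2 * (norm (x - m k))\<^sup>2 - (norm (m n - m k))\<^sup>2"
      by (simp add: power2_norm_eq_inner inner_expand inner_commute algebra_simps)
    finally show ?thesis using m(2)[of n] m(2)[of k] by simp
  qed
  have "Cauchy m"
  proof (rule metric_CauchyI)
    fix e :: real assume "e > 0"
    then obtain N where N: "4 / e\<^sup>2 < real N" using reals_Archimedean2 by blast
    have "dist (m n) (m k) < e" if "n \<ge> N" "k \<ge> N" for n k
    proof -
      have "4 / e\<^sup>2 < real (Suc i)" if "i \<ge> N" for i using N that by simp
      then have "2 / real (Suc i) < e\<^sup>2 / 2" if "i \<ge> N" for i
        using that \<open>e > 0\<close> by (simp add: field_simps)
      from this[OF that(1)] this[OF that(2)] have "(norm (m n - m k))\<^sup>2 < e\<^sup>2"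
        using close[of n k] by simp
      then show ?thesis using \<open>e > 0\<close> by (simp add: dist_norm power2_less_imp_less)
    qed
    then show "\<exists>N. \<forall>n\<ge>N. \<forall>k\<ge>N. dist (m n) (m k) < e" by blast
  qed
  then obtain l where l: "m \<longlonglongrightarrow> l" using Cauchy_convergent by (auto simp: convergent_def)
  have "l \<in> M" using M(2) m(1) l closed_sequentially by blast
  have minimal: "(norm (x - l))\<^sup>2 \<le> \<delta> + 0"
  proof (rule LIMSEQ_le)
    show "(\<lambda>n. (norm (x - m n))\<^sup>2) \<longlonglongrightarrow> (norm (x - l))\<^sup>2" by (intro tendsto_intros l)
    show "(\<lambda>n. \<delta> + 1 / real (Suc n)) \<longlonglongrightarrow> \<delta> + 0"
      by (intro tendsto_intros) (rule LIMSEQ_Suc[OF lim_1_over_n])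
    show "\<exists>N. \<forall>n\<ge>N. (norm (x - m n))\<^sup>2 \<le> \<delta> + 1 / real (Suc n)" using m(2) less_imp_le by blast
  qed
  have "inner (x - l) y = 0" if "y \<in> M" for y
  proof (cases "y = 0")
    case False
    define t where "t = inner (x - l) y / (norm y)\<^sup>2"
    have "\<delta> \<le> (norm (x - (l + t *\<^sub>R y)))\<^sup>2"
      using \<open>l \<in> M\<close> \<open>y \<in> M\<close> M(1) by (intro lower subspace_add subspace_scale)
    also have "\<dots> = (norm (x - l))\<^sup>2 - 2 * t * inner (x - l) y + t\<^sup>2 * (norm y)\<^sup>2"
      by (simp add: power2_norm_eq_inner inner_expand inner_commute) (simp add: power2_eq_square algebra_simps)
    also have "\<dots> = (norm (x - l))\<^sup>2 - (inner (x - l) y)\<^sup>2 / (norm y)\<^sup>2"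
      using False by (simp add: t_def power2_eq_square field_simps)
    finally have "(inner (x - l) y)\<^sup>2 / (norm y)\<^sup>2 \<le> 0" using minimal by simp
    then show ?thesis using False by (simp add: divide_le_0_iff)
  qed simp
  then show ?thesis using \<open>l \<in> M\<close> by blast
qed

definition is_proj :: "'a::complex_hilbert_space sa \<Rightarrow> bool" where
  "is_proj P \<longleftrightarrow> (\<forall>x. app P (app P x) = app P x)"

lemma app_in_projections: "is_proj P \<Longrightarrow> app P \<in> projections"
  using app[of P] by (simp add: projections_def is_proj_def fun_eq_iff)

lemma is_projD: "is_proj P \<Longrightarrow> app P (app P x) = app P x"
  by (simp add: is_proj_def)

lemma form_proj: "is_proj P \<Longrightarrow> form P x = (norm (app P x))\<^sup>2"
  by (simp add: form_def power2_norm_eq_inner app_symmetric is_projD)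

text \<open>If \<open>B\<close> commutes with \<open>G\<close>, the kernel of \<open>G\<close> and its orthogonal complement are invariant under \<open>B\<close>,
  so \<open>B\<close> commutes with the projection. The same argument for multiplication by \<open>c\<close>, whose adjoint is
  multiplication by \<open>cnj c\<close>, shows that the projection is complex linear.\<close>

lemma kernel_projection:
  fixes G :: "'a::complex_hilbert_space sa"
  obtains P where "is_proj P" "\<And>x. app G (app P x) = 0" "\<And>x. app G x = 0 \<Longrightarrow> app P x = x"
    "\<And>B. commuting B G \<Longrightarrow> commuting B P"
proof -
  define M where "M = {x. app G x = 0}"
  have sub: "subspace M" by (simp add: M_def subspace_def)
  have "closed M"
    unfolding M_def using bounded_linear_app[of G]
    by (intro closed_Collect_eq continuous_intros linear_continuous_on)
  then obtain p where p: "\<And>x. p x \<in> M" "\<And>x y. y \<in> M \<Longrightarrow> inner (x - p x) y = 0"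
    using orthogonal_projection_exists[OF sub] by metis
  have unique: "p x = m" if "m \<in> M" "\<And>y. y \<in> M \<Longrightarrow> inner (x - m) y = 0" for x m
  proof -
    have "p x - m \<in> M" using p(1) that(1) sub by (rule subspace_diff[rotated])
    then have "inner (x - m) (p x - m) - inner (x - p x) (p x - m) = 0"
      using that(2) p(2) by simp
    then have "inner (p x - m) (p x - m) = 0" by (simp add: inner_diff_left)
    then show ?thesis by simp
  qed
  have norm_p: "norm (p x) \<le> norm x" for x
  proof -
    have "(norm x)\<^sup>2 = (norm (x - p x))\<^sup>2 + (norm (p x))\<^sup>2"
      using p(2)[OF p(1), of x x] by (simp add: power2_norm_eq_inner inner_expand inner_commute)
    then have "(norm (p x))\<^sup>2 \<le> (norm x)\<^sup>2" by simp
    then show ?thesis by simp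
  qed
  have p_add: "p (x + y) = p x + p y" for x y
  proof (rule unique)
    show "p x + p y \<in> M" using p(1) sub by (simp add: subspace_add)
    show "inner (x + y - (p x + p y)) z = 0" if "z \<in> M" for z
      using p(2)[OF that, of x] p(2)[OF that, of y] by (simp add: inner_expand)
  qed
  have commute: "p (T x) = T (p x)"
    if "\<And>x y. T (x - y) = T x - T y" "\<And>y. y \<in> M \<Longrightarrow> T y \<in> M" "\<And>y. y \<in> M \<Longrightarrow> T' y \<in> M"
      "\<And>x y. inner (T x) y = inner x (T' y)" for T T' x
  proof (rule unique)
    show "T (p x) \<in> M" using that p(1) by blast
    show "inner (T x - T (p x)) y = 0" if "y \<in> M" for y
      using p(2)[of "T' y" x] that \<open>\<And>y. y \<in> M \<Longrightarrow> T' y \<in> M\<close>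
      by (simp flip: \<open>\<And>x y. T (x - y) = T x - T y\<close> add: \<open>\<And>x y. inner (T x) y = inner x (T' y)\<close>)
  qed
  have p_scaleC: "p (c *\<^sub>C x) = c *\<^sub>C p x" for c x
    by (rule commute[where T' = "\<lambda>x. cnj c *\<^sub>C x"])
       (auto simp: M_def complex_vector.scale_right_diff_distrib inner_eq_Re_cinner cinner_simps)
  have p_sym: "inner (p x) y = inner x (p y)" for x y
    using p(2)[OF p(1), of x y] p(2)[OF p(1), of y x] by (simp add: inner_expand inner_commute)
  have "bounded_linear p"
  proof (rule bounded_linear_intro[where K = 1])
    show "p (r *\<^sub>R x) = r *\<^sub>R p x" for r x by (simp add: scaleR_eq_scaleC p_scaleC)
  qed (simp_all add: p_add norm_p)
  then have "p \<in> selfadjoint_ops"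
    by (simp add: selfadjoint_iff_symmetric p_scaleC p_sym)
  then have app: "app (Abs_sa p) = p" by (rule Abs_sa_inverse)
  have fixed: "p x = x" if "x \<in> M" for x using that by (intro unique) auto
  show ?thesis
  proof (rule that[of "Abs_sa p"])
    show "is_proj (Abs_sa p)" using fixed p(1) by (simp add: is_proj_def app)
    show "app G (app (Abs_sa p) x) = 0" for x using p(1)[of x] by (simp add: app M_def)
    show "app (Abs_sa p) x = x" if "app G x = 0" for x using fixed that by (simp add: app M_def)
    show "commuting B (Abs_sa p)" if B: "commuting B G" for B
    proof -
      have "app B y \<in> M" if "y \<in> M" for y
        using that B by (auto simp: M_def commuting_def) (metis app_linear(6))
      then have "p (app B x) = app B (p x)" for x
        by (intro commute[where T' = "app B"]) (auto simp: app_symmetric)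
      then show ?thesis by (simp add: commuting_def app)
    qed
  qed
qed

text \<open>The projection \<open>P\<close> belongs to the spectral subspace of \<open>A\<close> for \<open>(-\<infinity>, r]\<close>.  It is the
  kernel projection of the positive part of \<open>C = A - r\<close>, which is \<open>(D + C) / 2\<close> for the absolute
  value \<open>D\<close> of \<open>C\<close>. On the kernel of \<open>D + C\<close> the operator \<open>C\<close> is \<open>-D\<close>; on the orthogonal complement
  it is \<open>D\<close>, as the range of \<open>D - C\<close> lies in that kernel. The second inequality is strict, because
  \<open>D x = 0\<close> puts \<open>x\<close> into the kernel.\<close>

lemma spectral_projection_exists:
  fixes A :: "'a::complex_hilbert_space sa"
  shows "\<exists>P. is_proj P \<and> (\<forall>B. commuting B A \<longrightarrow> commuting B P) \<and>
     (\<forall>x. app P x = x \<longrightarrow> form A x \<le> r * (norm x)\<^sup>2) \<and>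
     (\<forall>x. app P x = 0 \<longrightarrow> x \<noteq> 0 \<longrightarrow> r * (norm x)\<^sup>2 < form A x)"
proof -
  define C where "C = A - r *\<^sub>R 1"
  obtain D where D: "0 \<le> D" "\<And>x. app D (app D x) = app C (app C x)"
    "\<And>B. commuting B C \<Longrightarrow> commuting B D"
    using absolute_value by blast
  have CD: "app C (app D x) = app D (app C x)" for x
    using D(3)[of C] by (simp add: commuting_def)
  obtain P where P: "is_proj P" "\<And>x. app (D + C) (app P x) = 0"
    "\<And>x. app (D + C) x = 0 \<Longrightarrow> app P x = x" "\<And>B. commuting B (D + C) \<Longrightarrow> commuting B P"
    using kernel_projection by blast
  have formC: "form C x = form A x - r * (norm x)\<^sup>2" for x by (simp add: C_def)
  have "commuting B P" if "commuting B A" for B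
  proof -
    have "commuting B C" using that by (simp add: commuting_def C_def)
    then show ?thesis using D(3)[of B] by (intro P(4)) (simp add: commuting_def)
  qed
  moreover have "form A x \<le> r * (norm x)\<^sup>2" if "app P x = x" for x
  proof -
    have "form (D + C) x = 0" using P(2)[of x] that by (simp add: form_def)
    moreover have "0 \<le> form D x" using D(1) by (simp add: le_form)
    ultimately show ?thesis by (simp add: formC)
  qed
  moreover have "r * (norm x)\<^sup>2 < form A x" if "app P x = 0" "x \<noteq> 0" for x
  proof -
    have "app P (app (D - C) z) = app (D - C) z" for z
      by (rule P(3)) (simp add: D(2) CD)
    then have "inner (app (D - C) x) z = 0" for z
      using that(1) by (metis app_symmetric inner_zero_left)
    then have "app (D - C) x = 0" by (metis inner_eq_zero_iff)
    then have DC: "app D x = app C x" by simp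
    then have form_eq: "form C x = form D x" by (simp add: form_def)
    have "form D x \<noteq> 0"
    proof
      assume "form D x = 0"
      then have "app D x = 0" using positive_kernel[OF D(1)] by blast
      then have "app P x = x" using DC by (intro P(3)) simp
      then show False using that by simp
    qed
    moreover have "0 \<le> form D x" using D(1) by (simp add: le_form)
    ultimately show ?thesis using form_eq by (simp add: formC)
  qed
  ultimately show ?thesis using P(1) by blast
qed

lemma is_proj_zero: "is_proj 0" and is_proj_one: "is_proj 1"
  by (simp_all add: is_proj_def)

lemma is_proj_compl: "is_proj P \<Longrightarrow> is_proj (1 - P)"
  by (simp add: is_proj_def)

lemma proj_nonneg: "is_proj P \<Longrightarrow> 0 \<le> P"
  by (simp add: le_form form_proj)

lemma proj_le_one: "is_proj P \<Longrightarrow> P \<le> 1"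
  using proj_nonneg[OF is_proj_compl[of P]] by simp

text \<open>The form of \<open>1 - Q\<close> at \<open>P x\<close> is the squared norm of \<open>(1 - Q) (P x)\<close>, and \<open>P \<le> Q\<close> makes it nonpositive.
  The second equation is the adjoint of the first.\<close>

lemma proj_le_absorb:
  assumes P: "is_proj P" and Q: "is_proj Q" and le: "P \<le> Q"
  shows "app Q (app P x) = app P x" "app P (app Q x) = app P x"
proof -
  have QP: "app Q (app P x) = app P x" for x
  proof -
    have "form P (app P x) \<le> form Q (app P x)" using le by (simp add: le_form)
    then have "form (1 - Q) (app P x) \<le> 0"
      by (simp add: form_proj P is_projD[OF P])
    then have "(norm (app (1 - Q) (app P x)))\<^sup>2 \<le> 0"
      by (simp only: form_proj[OF is_proj_compl[OF Q]])
    then show ?thesis by simp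
  qed
  have "inner (app P (app Q x) - app P x) z = 0" for z
    by (simp add: inner_diff_left app_symmetric QP)
  then show "app P (app Q x) = app P x"
    by (metis inner_eq_zero_iff right_minus_eq)
  show "app Q (app P x) = app P x" by (rule QP)
qed

lemma proj_orthogonal:
  assumes "is_proj P" "is_proj Q" "P + Q \<le> 1"
  shows "app P (app Q x) = 0"
proof -
  have "P \<le> 1 - Q" using assms(3) by (simp add: algebra_simps)
  then have "app P (app (1 - Q) x) = app P x"
    using assms by (intro proj_le_absorb(2) is_proj_compl)
  then show ?thesis by simp
qed

lemma is_proj_add:
  assumes "is_proj P" "is_proj Q" "P + Q \<le> 1"
  shows "is_proj (P + Q)"
  using proj_orthogonal[OF assms] proj_orthogonal[OF assms(2,1)] assms
  by (simp add: is_proj_def add.commute)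

lemma norm_proj_diff:
  assumes "is_proj P" "is_proj Q" "P \<le> Q"
  shows "(norm (app Q x - app P x))\<^sup>2 = form Q x - form P x"
proof -
  have "inner (app Q x) (app P x) = inner x (app P x)"
    by (simp add: app_symmetric[of Q] proj_le_absorb(1)[OF assms])
  then have "inner (app Q x) (app P x) = form P x"
    by (simp add: form_def inner_commute)
  then show ?thesis
    by (simp add: power2_norm_eq_inner inner_expand inner_commute)
      (simp add: power2_norm_eq_inner[symmetric] form_proj assms)
qed

text \<open>Squared norms of differences along the sequence are increments of a bounded monotone numerical
  sequence, so the sequence is Cauchy at every vector.\<close>

lemma incseq_proj_limit:
  fixes Q :: "nat \<Rightarrow> 'a::complex_hilbert_space sa"
  assumes Q: "\<And>n. is_proj (Q n)" and inc: "incseq Q"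
  obtains P where "is_proj P" "\<And>x. (\<lambda>n. app (Q n) x) \<longlonglongrightarrow> app P x"
proof -
  have conv: "convergent (\<lambda>n. app (Q n) x)" for x
  proof -
    have inc_form: "form (Q m) x \<le> form (Q n) x" if "m \<le> n" for m n
      using incseqD[OF inc that] by (simp add: le_form)
    have bounded: "norm (form (Q n) x) \<le> (norm x)\<^sup>2" for n
      using proj_le_one[OF Q[of n]] proj_nonneg[OF Q[of n]] by (simp add: le_form)
    have "convergent (\<lambda>n. form (Q n) x)"
      using inc_form by (intro Bseq_mono_convergent BseqI'[OF bounded]) auto
    then have cau: "Cauchy (\<lambda>n. form (Q n) x)" by (rule convergent_Cauchy)
    have dist_eq: "(dist (app (Q m) x) (app (Q n) x))\<^sup>2 = dist (form (Q m) x) (form (Q n) x)" for m n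
    proof (induction m n rule: linorder_wlog)
      case (le m n)
      then show ?case
        using norm_proj_diff[OF Q Q incseqD[OF inc le], of x] inc_form[OF le]
        by (simp add: dist_norm norm_minus_commute dist_real_def)
    qed (simp add: dist_commute)
    have "Cauchy (\<lambda>n. app (Q n) x)"
    proof (rule metric_CauchyI)
      fix e :: real assume "e > 0"
      then obtain N where N: "\<And>m n. m \<ge> N \<Longrightarrow> n \<ge> N \<Longrightarrow> dist (form (Q m) x) (form (Q n) x) < e\<^sup>2"
        using metric_CauchyD[OF cau, of "e\<^sup>2"] by auto
      have "dist (app (Q m) x) (app (Q n) x) < e" if "m \<ge> N" "n \<ge> N" for m n
        using N[OF that] \<open>e > 0\<close> unfolding dist_eq[symmetric]
        by (auto intro: power2_less_imp_less)
      then show "\<exists>N. \<forall>m\<ge>N. \<forall>n\<ge>N. dist (app (Q m) x) (app (Q n) x) < e" by blast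
    qed
    then show ?thesis by (rule Cauchy_convergent)
  qed
  define p where "p x = lim (\<lambda>n. app (Q n) x)" for x
  have p: "(\<lambda>n. app (Q n) x) \<longlonglongrightarrow> p x" for x
    using conv[of x] by (simp only: p_def convergent_LIMSEQ_iff)
  have norm_Q: "norm (app (Q n) x) \<le> norm x" for n x
  proof -
    have "(norm (app (Q n) x))\<^sup>2 \<le> (norm x)\<^sup>2"
      using proj_le_one[OF Q[of n]] by (simp add: le_form form_proj Q)
    then show ?thesis by simp
  qed
  have p_scaleC: "p (c *\<^sub>C x) = c *\<^sub>C p x" for c x
    using bounded_linear.tendsto[OF bounded_linear_scaleC p, of c x]
    by (intro LIMSEQ_unique[OF p]) simp
  have "bounded_linear p"
  proof (rule bounded_linear_intro[where K = 1])
    show "p (x + y) = p x + p y" for x y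
      using tendsto_add[OF p p, of x y] by (intro LIMSEQ_unique[OF p]) simp
    show "p (r *\<^sub>R x) = r *\<^sub>R p x" for r x
      by (simp add: scaleR_eq_scaleC p_scaleC)
    show "norm (p x) \<le> norm x * 1" for x
      using norm_Q by (intro LIMSEQ_le_const2[OF tendsto_norm[OF p]]) auto
  qed
  moreover have "inner (p x) y = inner x (p y)" for x y
  proof (rule LIMSEQ_unique)
    show "(\<lambda>n. inner (app (Q n) x) y) \<longlonglongrightarrow> inner (p x) y" by (intro tendsto_intros p)
    show "(\<lambda>n. inner (app (Q n) x) y) \<longlonglongrightarrow> inner x (p y)"
      unfolding app_symmetric by (intro tendsto_intros p)
  qed
  ultimately have "p \<in> selfadjoint_ops"
    by (simp add: selfadjoint_iff_symmetric p_scaleC)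
  then have app: "app (Abs_sa p) = p" by (rule Abs_sa_inverse)
  have "app (Q n) (p x) = app (Q n) x" for n x
  proof (rule LIMSEQ_unique)
    show "(\<lambda>m. app (Q n) (app (Q m) x)) \<longlonglongrightarrow> app (Q n) (p x)"
      by (rule bounded_linear.tendsto[OF bounded_linear_app p])
    have "app (Q n) (app (Q m) x) = app (Q n) x" if "m \<ge> n" for m
      by (rule proj_le_absorb(2)[OF Q Q incseqD[OF inc that]])
    then show "(\<lambda>m. app (Q n) (app (Q m) x)) \<longlonglongrightarrow> app (Q n) x"
      by (intro tendsto_eventually) (auto simp: eventually_sequentially)
  qed
  then have "p (p x) = p x" for x
    using p[of x] by (intro LIMSEQ_unique[OF p]) simp
  then have "is_proj (Abs_sa p)" by (simp add: is_proj_def app)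
  then show ?thesis using that p by (simp add: app)
qed

lemma form_tendsto:
  assumes "\<And>x. (\<lambda>n. app (Q n) x) \<longlonglongrightarrow> app P x"
  shows "(\<lambda>n. form (Q n) x) \<longlonglongrightarrow> form P x"
  unfolding form_def by (intro tendsto_intros assms)

section \<open>The spectral theorem\<close>

text \<open>The spectrum of \<open>A\<close> lies between \<open>-K\<close> and \<open>K\<close>, and \<open>E r\<close> is the spectral projection for the part
  of it in \<open>(-\<infinity>, r]\<close>. The strict inequality for the complementary part is what makes \<open>E\<close> continuous
  from the right.\<close>

locale spectral_family =
  fixes A :: "'a::complex_hilbert_space sa" and E :: "real \<Rightarrow> 'a sa" and K :: real
  assumes proj: "is_proj (E r)"
    and commute: "commuting B A \<Longrightarrow> commuting B (E r)"
    and below: "app (E r) x = x \<Longrightarrow> form A x \<le> r * (norm x)\<^sup>2"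
    and above: "app (E r) x = 0 \<Longrightarrow> x \<noteq> 0 \<Longrightarrow> r * (norm x)\<^sup>2 < form A x"
    and K_nonneg: "0 \<le> K" and upper: "A \<le> K *\<^sub>R 1" and lower: "- (K *\<^sub>R 1) \<le> A"
begin

lemma A_E: "app A (app (E r) x) = app (E r) (app A x)"
  using commute[of A] by (simp add: commuting_def)

lemma E_E: "app (E s) (app (E r) x) = app (E r) (app (E s) x)"
proof -
  have "commuting (E s) A" by (simp add: commuting_def A_E)
  then have "commuting (E s) (E r)" by (rule commute)
  then show ?thesis by (simp only: commuting_def)
qed

text \<open>The difference \<open>y\<close> lies in the range of \<open>E r\<close> and in the kernel of \<open>E s\<close>, so the form of \<open>A\<close> at \<open>y\<close>
  would be at most \<open>r\<close> and greater than \<open>s\<close> times the squared norm, were \<open>y\<close> not zero.\<close>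

lemma E_absorb:
  assumes "r \<le> s"
  shows "app (E s) (app (E r) x) = app (E r) x"
proof -
  define y where "y = app (E r) x - app (E s) (app (E r) x)"
  have "app (E r) y = y" "app (E s) y = 0"
    by (simp_all add: y_def is_projD[OF proj] E_E[of s r])
  then have "form A y \<le> r * (norm y)\<^sup>2" "y \<noteq> 0 \<Longrightarrow> s * (norm y)\<^sup>2 < form A y"
    by (simp_all add: below above)
  moreover have "r * (norm y)\<^sup>2 \<le> s * (norm y)\<^sup>2" using assms by (simp add: mult_right_mono)
  ultimately have "y = 0" by (cases "y = 0") auto
  then show ?thesis by (simp add: y_def)
qed

lemma E_mono:
  assumes "r \<le> s"
  shows "E r \<le> E s"
  unfolding le_form
proof
  fix x
  have "form (E r) x = form (E r) (app (E s) x)"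
    by (simp add: form_proj proj E_absorb[OF assms] flip: E_E[of s r])
  also have "\<dots> \<le> form 1 (app (E s) x)" using proj_le_one[OF proj] unfolding le_form by blast
  also have "\<dots> = form (E s) x" by (simp add: form_proj proj)
  finally show "form (E r) x \<le> form (E s) x" .
qed

lemma E_top: "E K = 1"
proof (rule form_eqI)
  fix x
  define y where "y = x - app (E K) x"
  have "form A y \<le> form (K *\<^sub>R 1) y" using upper unfolding le_form by blast
  moreover have "app (E K) y = 0" by (simp add: y_def is_projD[OF proj])
  ultimately have "y = 0" using above[of K y] by (cases "y = 0") auto
  then show "form (E K) x = form 1 x" by (simp add: y_def form_proj proj)
qed

lemma E_bottom:
  assumes "r < - K"
  shows "E r = 0"
proof (rule form_eqI)
  fix x
  define y where "y = app (E r) x"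
  have "form (- (K *\<^sub>R 1)) y \<le> form A y" using lower unfolding le_form by blast
  moreover have "form A y \<le> r * (norm y)\<^sup>2"
    by (rule below) (simp add: y_def is_projD[OF proj])
  ultimately have "0 \<le> (r + K) * (norm y)\<^sup>2" by (simp add: algebra_simps)
  then have "y = 0" using assms by (simp add: zero_le_mult_iff)
  then show "form (E r) x = form 0 x" by (simp add: y_def form_proj proj)
qed

text \<open>Let \<open>s n\<close> decrease to \<open>r\<close>. The vectors \<open>E (s n) x\<close> converge to some \<open>y\<close>, which lies in the range of
  \<open>E t\<close> for all \<open>t > r\<close>. So does \<open>z = y - E r y\<close>, and the upper bounds for the form of \<open>A\<close> at \<open>z\<close> give
  the bound \<open>r\<close> in the limit. As \<open>E r z = 0\<close>, this contradicts the strict lower bound unless \<open>z = 0\<close>.\<close>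

lemma E_right_continuous: "continuous (at_right r) (\<lambda>r. form (E r) x)"
proof -
  define s where "s n = r + 1 / real (Suc n)" for n
  have s_lim: "s \<longlonglongrightarrow> r + 0"
    unfolding s_def by (intro tendsto_intros) (rule LIMSEQ_Suc[OF lim_1_over_n])
  have s: "decseq s" "r < s n" for n
    by (auto simp: s_def decseq_def frac_le)
  have "incseq (\<lambda>n. 1 - E (s n))"
    using s(1) E_mono by (auto simp: incseq_def decseq_def)
  then obtain R where R: "is_proj R" "\<And>x. (\<lambda>n. app (1 - E (s n)) x) \<longlonglongrightarrow> app R x"
    using incseq_proj_limit[of "\<lambda>n. 1 - E (s n)"] is_proj_compl[OF proj] by blast
  define y where "y = x - app R x"
  have y: "(\<lambda>n. app (E (s n)) x) \<longlonglongrightarrow> y"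
    using tendsto_diff[OF tendsto_const[of x] R(2)[of x]] by (simp add: y_def)
  have E_y: "app (E t) y = y" if "r < t" for t
  proof (rule LIMSEQ_unique)
    show "(\<lambda>n. app (E t) (app (E (s n)) x)) \<longlonglongrightarrow> app (E t) y"
      by (rule bounded_linear.tendsto[OF bounded_linear_app y])
    have "\<forall>\<^sub>F n in sequentially. s n < t"
      using order_tendstoD(2)[OF s_lim, of t] that by simp
    then have "\<forall>\<^sub>F n in sequentially. app (E (s n)) x = app (E t) (app (E (s n)) x)"
      by eventually_elim (simp add: E_absorb)
    then show "(\<lambda>n. app (E t) (app (E (s n)) x)) \<longlonglongrightarrow> y"
      by (rule Lim_transform_eventually[OF y])
  qed
  have E_r_y: "app (E r) y = app (E r) x"
  proof (rule LIMSEQ_unique)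
    show "(\<lambda>n. app (E r) (app (E (s n)) x)) \<longlonglongrightarrow> app (E r) y"
      by (rule bounded_linear.tendsto[OF bounded_linear_app y])
    have "app (E r) (app (E (s n)) x) = app (E r) x" for n
      using E_absorb[of r "s n" x] s(2)[of n] by (simp add: E_E[of r "s n"])
    then show "(\<lambda>n. app (E r) (app (E (s n)) x)) \<longlonglongrightarrow> app (E r) x" by simp
  qed
  define z where "z = y - app (E r) y"
  have "form A z \<le> t * (norm z)\<^sup>2" if "r < t" for t
    by (rule below) (simp add: z_def E_E[of t r] E_y[OF that])
  then have "form A z \<le> s n * (norm z)\<^sup>2" for n using s(2) by blast
  then have "form A z \<le> (r + 0) * (norm z)\<^sup>2"
    by (intro LIMSEQ_le_const[OF tendsto_mult[OF s_lim tendsto_const]]) blast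
  moreover have "app (E r) z = 0" by (simp add: z_def is_projD[OF proj])
  ultimately have "z = 0" using above[of r z] by (cases "z = 0") auto
  then have "y = app (E r) x" by (simp add: z_def E_r_y)
  then have "(\<lambda>n. inner (app (E (s n)) x) x) \<longlonglongrightarrow> inner (app (E r) x) x"
    using y by (intro tendsto_intros) simp
  then have lim: "(\<lambda>n. form (E (s n)) x) \<longlonglongrightarrow> form (E r) x" by (simp only: form_def)
  have mono: "form (E a) x \<le> form (E b) x" if "a \<le> b" for a b
    using E_mono[OF that] by (simp add: le_form)
  have "\<exists>d>0. form (E (r + d)) x - form (E r) x < e" if "e > 0" for e
  proof -
    have "\<forall>\<^sub>F n in sequentially. form (E (s n)) x < form (E r) x + e"
      using order_tendstoD(2)[OF lim] that by simp
    then obtain n where "form (E (s n)) x < form (E r) x + e"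
      by (auto simp: eventually_sequentially)
    then show ?thesis by (intro exI[of _ "1 / real (Suc n)"]) (simp add: s_def)
  qed
  then show ?thesis
    using mono by (subst continuous_at_right_real_increasing) auto
qed

text \<open>The distribution of the values of \<open>A\<close> in the vector state \<open>x\<close>, with total mass the squared norm of
  \<open>x\<close>.\<close>

definition distr_measure :: "'a \<Rightarrow> real measure" where
  "distr_measure x = interval_measure (\<lambda>r. form (E r) x)"

lemma E_mono_form: "r \<le> s \<Longrightarrow> form (E r) x \<le> form (E s) x"
  using E_mono by (simp add: le_form)

lemma E_at_bot: "((\<lambda>r. form (E r) x) \<longlongrightarrow> 0) at_bot"
proof (rule tendsto_eventually)
  have "\<forall>\<^sub>F r in at_bot. r < - K" by (auto simp: eventually_at_bot_dense)
  then show "\<forall>\<^sub>F r in at_bot. form (E r) x = 0" by eventually_elim (simp add: E_bottom)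
qed

lemma E_above_top: "K \<le> r \<Longrightarrow> E r = 1"
  using E_mono[of K r] proj_le_one[OF proj, of r] unfolding E_top by (intro antisym) auto

lemma E_at_top: "((\<lambda>r. form (E r) x) \<longlongrightarrow> (norm x)\<^sup>2) at_top"
proof (rule tendsto_eventually)
  show "\<forall>\<^sub>F r in at_top. form (E r) x = (norm x)\<^sup>2"
    using eventually_ge_at_top[of K] by eventually_elim (simp add: E_above_top)
qed

lemma sets_distr [simp, measurable_cong]: "sets (distr_measure x) = sets borel"
  by (simp add: distr_measure_def)

lemma space_distr [simp]: "space (distr_measure x) = UNIV"
  by (simp add: distr_measure_def)

lemma emeasure_distr_UNIV: "emeasure (distr_measure x) UNIV = ennreal ((norm x)\<^sup>2)"
  unfolding distr_measure_def
  by (rule interval_measure_UNIV[OF E_mono_form E_right_continuous E_at_bot E_at_top]) auto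

lemma finite_measure_distr: "finite_measure (distr_measure x)"
  by (rule finite_measureI) (simp add: emeasure_distr_UNIV)

lemma measure_distr_UNIV: "measure (distr_measure x) UNIV = (norm x)\<^sup>2"
  using emeasure_distr_UNIV by (simp add: measure_def)

lemma measure_distr_atMost: "measure (distr_measure x) {..r} = form (E r) x"
  unfolding distr_measure_def
  by (rule measure_interval_measure_Iic[OF E_mono_form E_right_continuous E_at_bot])

lemma measure_distr_Ioc:
  "r \<le> s \<Longrightarrow> measure (distr_measure x) {r<..s} = form (E s) x - form (E r) x"
  unfolding distr_measure_def
  by (rule measure_interval_measure_Ioc[OF _ E_mono_form E_right_continuous])

definition has_proj :: "real set \<Rightarrow> 'a sa \<Rightarrow> bool" where
  "has_proj D P \<longleftrightarrow> is_proj P \<and> (\<forall>x. measure (distr_measure x) D = form P x)"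

text \<open>The sum of the two projections is bounded by the identity, because the measures of the disjoint
  sets add up to at most the total mass. Hence the projections are orthogonal.\<close>

lemma has_proj_disjoint_union:
  assumes "has_proj D P" "has_proj D' Q" "D \<inter> D' = {}" "D \<in> sets borel" "D' \<in> sets borel"
  shows "has_proj (D \<union> D') (P + Q)" "P + Q \<le> 1"
proof -
  have union: "measure (distr_measure x) (D \<union> D') = form (P + Q) x" for x
  proof -
    interpret finite_measure "distr_measure x" by (rule finite_measure_distr)
    show ?thesis using assms by (simp add: finite_measure_Union has_proj_def)
  qed
  show "P + Q \<le> 1"
    unfolding le_form
  proof
    fix x
    interpret finite_measure "distr_measure x" by (rule finite_measure_distr)
    show "form (P + Q) x \<le> form 1 x"
      using bounded_measure[of "D \<union> D'"] union[of x] by (simp add: measure_distr_UNIV)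
  qed
  then show "has_proj (D \<union> D') (P + Q)"
    using union assms is_proj_add by (auto simp: has_proj_def)
qed

lemma has_proj_limit:
  fixes D :: "nat \<Rightarrow> real set"
  assumes "\<And>n. has_proj (D n) (Q n)" "incseq D" "\<And>n. D n \<in> sets borel"
  obtains P where "has_proj (\<Union>n. D n) P" "\<And>x. (\<lambda>n. app (Q n) x) \<longlonglongrightarrow> app P x"
proof -
  have "incseq Q"
    unfolding incseq_def le_form
  proof safe
    fix m n :: nat and x :: 'a
    assume "m \<le> n"
    interpret finite_measure "distr_measure x" by (rule finite_measure_distr)
    have "measure (distr_measure x) (D m) \<le> measure (distr_measure x) (D n)"
      using assms(2,3) \<open>m \<le> n\<close> by (intro finite_measure_mono) (auto simp: incseq_def)
    then show "form (Q m) x \<le> form (Q n) x" using assms(1) by (simp add: has_proj_def)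
  qed
  then obtain P where P: "is_proj P" "\<And>x. (\<lambda>n. app (Q n) x) \<longlonglongrightarrow> app P x"
    using incseq_proj_limit[of Q] assms(1) by (auto simp: has_proj_def)
  have "measure (distr_measure x) (\<Union>n. D n) = form P x" for x
  proof (rule LIMSEQ_unique)
    interpret finite_measure "distr_measure x" by (rule finite_measure_distr)
    show "(\<lambda>n. measure (distr_measure x) (D n)) \<longlonglongrightarrow> measure (distr_measure x) (\<Union>n. D n)"
      using assms(2,3) by (intro finite_Lim_measure_incseq) auto
    show "(\<lambda>n. measure (distr_measure x) (D n)) \<longlonglongrightarrow> form P x"
      using form_tendsto[OF P(2)] assms(1) by (simp add: has_proj_def)
  qed
  then have "has_proj (\<Union>n. D n) P" using P(1) by (simp add: has_proj_def)
  then show ?thesis using that P(2) by blast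
qed

lemma disjoint_family_initial:
  fixes D :: "nat \<Rightarrow> 'b set"
  assumes "disjoint_family D"
  shows "(\<Union>i<n. D i) \<inter> D n = {}"
proof -
  have "D i \<inter> D n = {}" if "i < n" for i
    using assms that by (simp add: disjoint_family_on_def)
  then show ?thesis by auto
qed

lemma incseq_initial: "incseq (\<lambda>n. \<Union>i<n. D i)" for D :: "nat \<Rightarrow> 'b set"
  unfolding incseq_def by (intro allI impI UN_mono) auto

text \<open>The sets with a projection contain the half-lines and are closed under complements and, as increasing
  limits of finite disjoint unions, under countable disjoint unions; the half-lines are closed under
  intersection and generate the Borel sets.\<close>

lemma has_proj_exists:
  assumes "D \<in> sets borel"
  shows "\<exists>P. has_proj D P"
proof -
  let ?G = "range (\<lambda>a::real. {..a})"
  have "sets (borel :: real measure) = sigma_sets UNIV ?G"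
    by (subst borel_eq_atMost) simp
  then have D: "D \<in> sigma_sets UNIV ?G" and borel: "\<And>B. B \<in> sigma_sets UNIV ?G \<Longrightarrow> B \<in> sets borel"
    using assms by auto
  have "Int_stable ?G" by (auto simp: Int_stable_def)
  moreover have "?G \<subseteq> Pow UNIV" by simp
  ultimately show ?thesis
    using D
  proof (induction rule: sigma_sets_induct_disjoint)
    case (basic A)
    then show ?case using proj measure_distr_atMost by (auto simp: has_proj_def)
  next
    case empty
    then show ?case by (intro exI[of _ 0]) (simp add: has_proj_def is_proj_zero)
  next
    case (compl A)
    then obtain P where P: "has_proj A P" by blast
    have "measure (distr_measure x) (UNIV - A) = form (1 - P) x" for x
    proof -
      interpret finite_measure "distr_measure x" by (rule finite_measure_distr)
      show ?thesis
        using finite_measure_compl[of A] borel[OF compl(1)] P by (simp add: measure_distr_UNIV has_proj_def)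
    qed
    then have "has_proj (UNIV - A) (1 - P)" using P by (simp add: has_proj_def is_proj_compl)
    then show ?case by blast
  next
    case (union A)
    then obtain P where P: "\<And>n. has_proj (A n) (P n)" by metis
    have A: "A n \<in> sets borel" for n using union(2) borel by blast
    note disj = disjoint_family_initial[OF union(1)]
    have partial: "has_proj (\<Union>i<n. A i) (\<Sum>i<n. P i)" for n
    proof (induction n)
      case (Suc n)
      have "has_proj ((\<Union>i<n. A i) \<union> A n) ((\<Sum>i<n. P i) + P n)"
        using Suc P disj A by (intro has_proj_disjoint_union) auto
      then show ?case by (simp add: lessThan_Suc Un_commute add.commute)
    qed (simp add: has_proj_def is_proj_zero)
    have "(\<Union>i<n. A i) \<in> sets borel" for n using A by auto
    then obtain R where R: "has_proj (\<Union>n. \<Union>i<n. A i) R"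
      using has_proj_limit[OF partial incseq_initial] by blast
    have "(\<Union>n. \<Union>i<n. A i) = (\<Union>i. A i)" by auto
    with R show ?case by (intro exI) (simp only:)
  qed
qed

definition pvm :: "real set \<Rightarrow> 'a sa" where
  "pvm D = (SOME P. has_proj D P)"

lemma pvm: "D \<in> sets borel \<Longrightarrow> has_proj D (pvm D)"
  unfolding pvm_def by (rule someI_ex) (rule has_proj_exists)

lemma pvm_unique:
  assumes "has_proj D P"
  shows "pvm D = P"
proof (rule form_eqI)
  have "has_proj D (pvm D)" unfolding pvm_def using assms by (rule someI)
  then show "form (pvm D) v = form P v" for v using assms by (simp add: has_proj_def)
qed

lemma pvm_atMost: "pvm {..r} = E r"
  by (rule pvm_unique) (simp add: has_proj_def proj measure_distr_atMost)

lemma pvm_empty: "pvm {} = 0"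
  by (rule pvm_unique) (simp add: has_proj_def is_proj_zero)

lemma pvm_UNIV: "pvm UNIV = 1"
  by (rule pvm_unique) (simp add: has_proj_def is_proj_one measure_distr_UNIV)

lemma pvm_disjoint:
  assumes "D \<inter> D' = {}" "D \<in> sets borel" "D' \<in> sets borel"
  shows "pvm (D \<union> D') = pvm D + pvm D'" "app (pvm D) (app (pvm D') x) = 0"
proof -
  note h = has_proj_disjoint_union[OF pvm[OF assms(2)] pvm[OF assms(3)] assms]
  show "pvm (D \<union> D') = pvm D + pvm D'" by (rule pvm_unique) (rule h)
  show "app (pvm D) (app (pvm D') x) = 0"
    using proj_orthogonal[OF _ _ h(2)] pvm assms by (simp add: has_proj_def)
qed

text \<open>Multiplicativity follows from additivity: the two sets are split into their intersection and their
  differences, and projections of disjoint sets are orthogonal.\<close>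

lemma pvm_Int:
  assumes D: "D \<in> sets borel" and D': "D' \<in> sets borel"
  shows "app (pvm (D \<inter> D')) x = app (pvm D) (app (pvm D') x)"
proof -
  let ?C = "D \<inter> D'"
  have split: "D = ?C \<union> (D - D')" "D' = ?C \<union> (D' - D)" by auto
  have eq: "pvm D = pvm ?C + pvm (D - D')" "pvm D' = pvm ?C + pvm (D' - D)"
    by (subst split, rule pvm_disjoint; use D D' in auto)+
  have "app (pvm ?C) (app (pvm (D' - D)) x) = 0" "app (pvm (D - D')) (app (pvm ?C) x) = 0"
    "app (pvm (D - D')) (app (pvm (D' - D)) x) = 0"
    by (rule pvm_disjoint(2); use D D' in auto)+
  moreover have "app (pvm ?C) (app (pvm ?C) x) = app (pvm ?C) x"
    using pvm[of ?C] D D' by (simp add: has_proj_def is_projD)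
  ultimately show ?thesis unfolding eq by simp
qed

lemma pvm_sums:
  assumes D: "range D \<subseteq> sets borel" "disjoint_family D"
  shows "(\<lambda>n. app (pvm (D n)) x) sums app (pvm (\<Union>n. D n)) x"
proof -
  have sets: "D n \<in> sets borel" for n using D(1) by auto
  note disj = disjoint_family_initial[OF D(2)]
  have partial: "pvm (\<Union>i<n. D i) = (\<Sum>i<n. pvm (D i))" for n
  proof (induction n)
    case (Suc n)
    have "pvm ((\<Union>i<n. D i) \<union> D n) = pvm (\<Union>i<n. D i) + pvm (D n)"
      using disj sets by (intro pvm_disjoint) auto
    then show ?case by (simp add: Suc lessThan_Suc Un_commute)
  qed (simp add: pvm_empty)
  have app_sum: "app (\<Sum>i<n. pvm (D i)) x = (\<Sum>i<n. app (pvm (D i)) x)" for n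
    by (induction n) simp_all
  obtain P where P: "has_proj (\<Union>n. \<Union>i<n. D i) P"
    "\<And>x. (\<lambda>n. app (pvm (\<Union>i<n. D i)) x) \<longlonglongrightarrow> app P x"
  proof (rule has_proj_limit[of "\<lambda>n. \<Union>i<n. D i" "\<lambda>n. pvm (\<Union>i<n. D i)"])
    show "has_proj (\<Union>i<n. D i) (pvm (\<Union>i<n. D i))" for n using sets by (intro pvm) auto
    show "incseq (\<lambda>n. \<Union>i<n. D i)" by (rule incseq_initial)
  qed (use sets in auto)
  moreover have "(\<Union>n. \<Union>i<n. D i) = (\<Union>i. D i)" by auto
  ultimately have "pvm (\<Union>n. D n) = P" using pvm_unique by simp
  then show ?thesis
    using P(2)[of x] by (simp add: sums_def partial app_sum)
qed

end

text \<open>Halving the interval \<open>n\<close> times improves the bound by the factor \<open>2 ^ n\<close>, as the increments of \<open>F\<close>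
  add up to the total increment.\<close>

lemma constant_if_small_increments:
  fixes g F :: "real \<Rightarrow> real"
  assumes inc: "\<And>s t. s \<le> t \<Longrightarrow> \<bar>g t - g s\<bar> \<le> (t - s) * (F t - F s)"
    and "s \<le> t"
  shows "g s = g t"
proof -
  have halve: "\<bar>g t - g s\<bar> \<le> ((t - s) * (F t - F s)) / 2 ^ n" if "s \<le> t" for s t n
    using that
  proof (induction n arbitrary: s t)
    case (Suc n)
    define m where "m = (s + t) / 2"
    have m: "s \<le> m" "m \<le> t" "m - s = (t - s) / 2" "t - m = (t - s) / 2"
      using Suc.prems by (auto simp: m_def field_simps)
    have "\<bar>g t - g s\<bar> \<le> \<bar>g t - g m\<bar> + \<bar>g m - g s\<bar>" by simp
    also have "\<dots> \<le> ((t - m) * (F t - F m)) / 2 ^ n + ((m - s) * (F m - F s)) / 2 ^ n"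
      by (intro add_mono Suc.IH m)
    also have "\<dots> = ((t - s) * (F t - F s)) / 2 ^ Suc n"
      unfolding m(3,4) by (simp add: field_simps)
    finally show ?case .
  qed (simp add: inc)
  have "\<bar>g t - g s\<bar> \<le> 0"
    by (rule LIMSEQ_le_const[OF LIMSEQ_divide_realpow_zero[of 2 "(t - s) * (F t - F s)"]])
       (use halve[OF \<open>s \<le> t\<close>] in auto)
  then show ?thesis by simp
qed

context spectral_family
begin

lemma AE_distr_bounds: "AE t in distr_measure x. - K - 1 < t \<and> t \<le> K"
proof -
  interpret finite_measure "distr_measure x" by (rule finite_measure_distr)
  have "{..- K - 1} \<in> null_sets (distr_measure x)"
    by (rule null_setsI) (simp_all add: emeasure_eq_measure measure_distr_atMost E_bottom)
  moreover have "measure (distr_measure x) (UNIV - {..K}) = 0"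
    using finite_measure_compl[of "{..K}"]
    by (simp add: measure_distr_UNIV measure_distr_atMost E_top)
  then have "UNIV - {..K} \<in> null_sets (distr_measure x)"
    by (intro null_setsI) (simp_all add: emeasure_eq_measure)
  ultimately show ?thesis
    by (auto dest!: AE_not_in elim: eventually_elim2)
qed

lemma integrable_distr: "integrable (distr_measure x) (\<lambda>t. t)"
proof -
  interpret finite_measure "distr_measure x" by (rule finite_measure_distr)
  have "AE t in distr_measure x. norm t \<le> \<bar>K\<bar> + 1"
    using AE_distr_bounds[of x] by eventually_elim auto
  then show ?thesis by (rule integrable_const_bound) simp
qed

text \<open>The vector \<open>y x\<close> lies in the range of \<open>E t\<close> and in the kernel of \<open>E s\<close>, and its squared norm is the
  increment of the distribution function.\<close>

lemma form_E_increment: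
  assumes "s \<le> t"
  defines "y \<equiv> \<lambda>x. app (E t) x - app (E s) x"
  shows "form A (app (E t) x) - form A (app (E s) x) = form A (y x)"
    and "s * (form (E t) x - form (E s) x) \<le> form A (y x)"
    and "form A (y x) \<le> t * (form (E t) x - form (E s) x)"
proof -
  have y: "app (E t) (y x) = y x" "app (E s) (y x) = 0"
    by (simp_all add: y_def is_projD[OF proj] E_absorb[OF assms(1)] E_E[of s t])
  have "form A (app (E s) x + y x) = form A (app (E s) x) + form A (y x) + 2 * inner (app (E s) (app A x)) (y x)"
    by (simp only: form_add_arg A_E)
  moreover have "inner (app (E s) (app A x)) (y x) = 0"
    by (simp only: app_symmetric y inner_zero_right)
  moreover have "app (E s) x + y x = app (E t) x" by (simp add: y_def)
  ultimately show "form A (app (E t) x) - form A (app (E s) x) = form A (y x)" by simp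
  have norm_y: "(norm (y x))\<^sup>2 = form (E t) x - form (E s) x"
    unfolding y_def by (rule norm_proj_diff[OF proj proj E_mono[OF assms(1)]])
  show "form A (y x) \<le> t * (form (E t) x - form (E s) x)"
    using below[OF y(1)] by (simp add: norm_y)
  show "s * (form (E t) x - form (E s) x) \<le> form A (y x)"
  proof (cases "y x = 0")
    case True
    then show ?thesis by (simp add: norm_y[symmetric] form_def[of A])
  qed (use above[OF y(2)] in \<open>simp add: norm_y[symmetric]\<close>)
qed

text \<open>Both \<open>r \<mapsto> form A (E r x)\<close> and the integral of the identity over \<open>(-\<infinity>, r]\<close> have increments between
  \<open>s\<close> and \<open>t\<close> times the mass of \<open>(s, t]\<close>. So their difference \<open>g\<close> is constant; it vanishes below the
  spectrum, and above the spectrum it is the difference of the two sides.\<close>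

lemma integral_distr: "(\<integral>t. t \<partial>distr_measure x) = form A x"
proof -
  interpret finite_measure "distr_measure x" by (rule finite_measure_distr)
  let ?M = "distr_measure x"
  define k where "k r = (\<integral>t. indicator {..r} t * t \<partial>?M)" for r
  define g where "g r = form A (app (E r) x) - k r" for r
  have int: "integrable ?M (\<lambda>t. indicator D t * t)" if "D \<in> sets borel" for D
    using integrable_mult_indicator[OF _ integrable_distr, of D] that by simp
  have "\<bar>g t - g s\<bar> \<le> (t - s) * (form (E t) x - form (E s) x)" if "s \<le> t" for s t
  proof -
    let ?J = "{s<..t}"
    have int_J: "integrable ?M (\<lambda>u. indicator ?J u * c)" for c :: real
      by (intro integrable_mult_left integrable_real_indicator) (auto simp: emeasure_eq_measure)
    have J: "(\<integral>u. indicator ?J u * c \<partial>?M) = c * (form (E t) x - form (E s) x)" for c :: real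
      using measure_distr_Ioc[OF that] by simp
    have "k t - k s = (\<integral>u. indicator {..t} u * u - indicator {..s} u * u \<partial>?M)"
      unfolding k_def by (intro Bochner_Integration.integral_diff[symmetric] int) auto
    also have "\<dots> = (\<integral>u. indicator ?J u * u \<partial>?M)"
      using that by (intro Bochner_Integration.integral_cong) (auto simp: indicator_def)
    finally have k: "k t - k s = (\<integral>u. indicator ?J u * u \<partial>?M)" .
    have "(\<integral>u. indicator ?J u * s \<partial>?M) \<le> k t - k s"
      unfolding k by (intro integral_mono int int_J) (auto simp: indicator_def)
    moreover have "k t - k s \<le> (\<integral>u. indicator ?J u * t \<partial>?M)"
      unfolding k by (intro integral_mono int int_J) (auto simp: indicator_def)
    ultimately have "s * (form (E t) x - form (E s) x) \<le> k t - k s"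
      "k t - k s \<le> t * (form (E t) x - form (E s) x)"
      unfolding J .
    then show ?thesis
      using form_E_increment[OF that, of x] by (simp add: g_def abs_le_iff algebra_simps)
  qed
  moreover have "- K - 1 \<le> K" using K_nonneg by simp
  ultimately have "g (- K - 1) = g K"
    by (rule constant_if_small_increments)
  moreover have "AE t in ?M. indicator {..- K - 1} t * t = 0"
    using AE_distr_bounds[of x] by eventually_elim simp
  then have "k (- K - 1) = 0"
    unfolding k_def by (rule integral_eq_zero_AE)
  moreover have "k K = (\<integral>t. t \<partial>?M)"
    unfolding k_def
  proof (rule integral_cong_AE)
    show "AE t in ?M. indicator {..K} t * t = t"
      using AE_distr_bounds[of x] by eventually_elim simp
  qed (simp_all)
  moreover have "E (- K - 1) = 0" by (rule E_bottom) simp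
  ultimately show ?thesis
    by (simp add: g_def E_top form_def)
qed

lemma scalar_measure_pvm: "scalar_measure (\<lambda>D. app (pvm D)) x = distr_measure x"
proof -
  interpret finite_measure "distr_measure x" by (rule finite_measure_distr)
  have "ennreal (Re (cinner (app (pvm D) x) x)) = emeasure (distr_measure x) D" if "D \<in> sets borel" for D
    using pvm[OF that] by (simp add: has_proj_def emeasure_eq_measure form_cinner)
  then have "scalar_measure (\<lambda>D. app (pvm D)) x =
      measure_of UNIV (sets borel) (emeasure (distr_measure x))"
    unfolding scalar_measure_def
    by (intro measure_of_eq) (auto simp: sets.sigma_sets_eq[of borel, simplified])
  then show ?thesis
    using measure_of_of_measure[of "distr_measure x"] by simp
qed

lemma bounded_pvm_pvm: "bounded_pvm (\<lambda>D. app (pvm D))"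
proof -
  have "app (pvm D) \<in> projections" if "D \<in> sets borel" for D
    using pvm[OF that] by (simp add: has_proj_def app_in_projections)
  moreover have "app (pvm {}) = (\<lambda>x. 0)" "app (pvm UNIV) = id"
    by (auto simp: fun_eq_iff pvm_empty pvm_UNIV)
  moreover have "\<exists>a. app (pvm {- a..a}) = id"
  proof -
    define a where "a = \<bar>K\<bar> + 1"
    have "has_proj {- a..a} 1"
      unfolding has_proj_def
    proof (intro conjI allI)
      show "is_proj 1" by (rule is_proj_one)
      fix x
      interpret finite_measure "distr_measure x" by (rule finite_measure_distr)
      have "AE t in distr_measure x. t \<in> {- a..a}"
        using AE_distr_bounds[of x] by eventually_elim (auto simp: a_def)
      then have "measure (distr_measure x) {- a..a} = measure (distr_measure x) UNIV"
        by (intro finite_measure_eq_AE) auto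
      then show "measure (distr_measure x) {- a..a} = form 1 x"
        by (simp add: measure_distr_UNIV)
    qed
    then have "pvm {- a..a} = 1" by (rule pvm_unique)
    then have "app (pvm {- a..a}) = id" by (simp add: fun_eq_iff)
    then show ?thesis ..
  qed
  moreover have "app (pvm (D \<inter> D')) = app (pvm D) \<circ> app (pvm D')"
    if "D \<in> sets borel" "D' \<in> sets borel" for D D'
    using pvm_Int[OF that] by (simp add: fun_eq_iff)
  ultimately show ?thesis
    unfolding bounded_pvm_def using pvm_sums by auto
qed

lemma is_spectral_measure_pvm: "is_spectral_measure (app A) (\<lambda>D. app (pvm D))"
  unfolding is_spectral_measure_def
  by (simp add: bounded_pvm_pvm scalar_measure_pvm integral_distr form_cinner)

end

theorem spectral_measure_exists:
  fixes A :: "'a::complex_hilbert_space sa"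
  obtains E where "is_spectral_measure (app A) E"
    "\<And>r x. E {..r} x = x \<Longrightarrow> form A x \<le> r * (norm x)\<^sup>2"
    "\<And>r x. E {..r} x = 0 \<Longrightarrow> x \<noteq> 0 \<Longrightarrow> r * (norm x)\<^sup>2 < form A x"
proof -
  obtain E where E: "\<And>r. is_proj (E r) \<and> (\<forall>B. commuting B A \<longrightarrow> commuting B (E r)) \<and>
     (\<forall>x. app (E r) x = x \<longrightarrow> form A x \<le> r * (norm x)\<^sup>2) \<and>
     (\<forall>x. app (E r) x = 0 \<longrightarrow> x \<noteq> 0 \<longrightarrow> r * (norm x)\<^sup>2 < form A x)"
    using spectral_projection_exists[of A] by metis
  obtain K where K: "0 \<le> K" "A \<le> K *\<^sub>R 1" "- (K *\<^sub>R 1) \<le> A"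
    using bounded_by_identity[of A] by blast
  interpret spectral_family A E K
    by unfold_locales (use E K in auto)
  show ?thesis
    by (rule that[OF is_spectral_measure_pvm]) (simp_all add: pvm_atMost below above)
qed

section \<open>Self-complementary operators are the scalars\<close>

lemma scalar_measure_facts:
  fixes E :: "real set \<Rightarrow> 'a::complex_hilbert_space \<Rightarrow> 'a"
  assumes E: "bounded_pvm E"
  shows "sets (scalar_measure E x) = sets borel" "space (scalar_measure E x) = UNIV"
    "D \<in> sets borel \<Longrightarrow> emeasure (scalar_measure E x) D = ennreal ((norm (E D x))\<^sup>2)"
proof -
  have sigma: "sigma_algebra UNIV (sets (borel :: real measure))"
    using sets.sigma_algebra_axioms[of "borel :: real measure"] by simp
  interpret sigma_algebra UNIV "sets (borel :: real measure)" by (rule sigma)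
  show "sets (scalar_measure E x) = sets borel" "space (scalar_measure E x) = UNIV"
    by (simp_all add: scalar_measure_def)
  have norm: "Re (cinner (E D x) x) = (norm (E D x))\<^sup>2" if "D \<in> sets borel" for D
  proof -
    have P: "E D \<in> selfadjoint_ops" "E D (E D x) = E D x"
      using E that by (auto simp: bounded_pvm_def projections_def fun_eq_iff)
    have "(norm (E D x))\<^sup>2 = inner x (E D (E D x))"
      using P(1) by (simp add: power2_norm_eq_inner selfadjoint_iff_symmetric)
    then show ?thesis by (simp add: P(2) inner_commute inner_eq_Re_cinner[symmetric])
  qed
  show "emeasure (scalar_measure E x) D = ennreal ((norm (E D x))\<^sup>2)" if D: "D \<in> sets borel"
  proof -
    have "emeasure (scalar_measure E x) D = ennreal (Re (cinner (E D x) x))"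
      unfolding scalar_measure_def
    proof (rule emeasure_measure_of_sigma[OF sigma _ _ D])
      show "positive (sets borel) (\<lambda>D. ennreal (Re (cinner (E D x) x)))"
        using E by (simp add: positive_def bounded_pvm_def)
      show "countably_additive (sets borel) (\<lambda>D. ennreal (Re (cinner (E D x) x)))"
        unfolding countably_additive_def
      proof (intro allI impI)
        fix F :: "nat \<Rightarrow> real set"
        assume F: "range F \<subseteq> sets borel" "disjoint_family F"
        then have "(\<lambda>n. E (F n) x) sums E (\<Union>n. F n) x"
          using E by (simp add: bounded_pvm_def)
        then have "(\<lambda>n. inner (E (F n) x) x) sums inner (E (\<Union>n. F n) x) x"
          by (rule bounded_linear.sums[OF bounded_linear_inner_left])
        then have "(\<lambda>n. Re (cinner (E (F n) x) x)) sums Re (cinner (E (\<Union>n. F n) x) x)"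
          by (simp only: inner_eq_Re_cinner)
        moreover have "0 \<le> Re (cinner (E (F n) x) x)" for n
          using norm[of "F n"] F(1) by auto
        ultimately show "(\<Sum>n. ennreal (Re (cinner (E (F n) x) x))) = ennreal (Re (cinner (E (\<Union> (range F)) x) x))"
          by (intro suminf_ennreal_eq) auto
      qed
    qed
    then show ?thesis by (simp add: norm[OF D])
  qed
qed

lemma finite_scalar_measure:
  assumes "bounded_pvm E"
  shows "finite_measure (scalar_measure E x)" "measure (scalar_measure E x) UNIV = (norm x)\<^sup>2"
proof -
  have UNIV: "emeasure (scalar_measure E x) UNIV = ennreal ((norm x)\<^sup>2)"
    using scalar_measure_facts(3)[OF assms, of UNIV x] assms by (simp add: bounded_pvm_def)
  then show "finite_measure (scalar_measure E x)"
    by (intro finite_measureI) (simp add: scalar_measure_facts(2)[OF assms])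
  show "measure (scalar_measure E x) UNIV = (norm x)\<^sup>2"
    using UNIV by (simp add: measure_def)
qed

text \<open>Multiplicativity of \<open>E\<close> shows that \<open>E\<close> of the complement of \<open>D\<close> annihilates the range of \<open>E D\<close>.\<close>

lemma AE_scalar_measure:
  assumes E: "bounded_pvm E" and D: "D \<in> sets borel" and x: "E D x = x"
  shows "AE t in scalar_measure E x. t \<in> D"
proof -
  have "\<forall>B\<in>sets borel. \<forall>C\<in>sets borel. E (B \<inter> C) = E B \<circ> E C"
    using E unfolding bounded_pvm_def by blast
  moreover have "- D \<in> sets borel" using D by simp
  ultimately have mult: "E (- D \<inter> D) = E (- D) \<circ> E D" using D by blast
  have "E (- D) x = (E (- D) \<circ> E D) x" by (simp add: x)
  also have "\<dots> = E {} x" unfolding mult[symmetric] by simp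
  also have "\<dots> = 0" using E by (simp add: bounded_pvm_def)
  finally have "E (- D) x = 0" .
  then have "- D \<in> null_sets (scalar_measure E x)"
    using scalar_measure_facts[OF E] D by (intro null_setsI) auto
  then show ?thesis by (auto dest: AE_not_in)
qed

lemma integrable_scalar_measure:
  assumes E: "bounded_pvm E"
  shows "integrable (scalar_measure E x) (\<lambda>t. t)"
proof -
  interpret finite_measure "scalar_measure E x" by (rule finite_scalar_measure[OF E])
  obtain a where "E {- a..a} = id" using E by (auto simp: bounded_pvm_def)
  then have "AE t in scalar_measure E x. t \<in> {- a..a}"
    by (intro AE_scalar_measure E) auto
  then have "AE t in scalar_measure E x. norm t \<le> a" by eventually_elim auto
  moreover have "(\<lambda>t. t) \<in> borel_measurable (scalar_measure E x)"
    using scalar_measure_facts(1)[OF E] by (simp cong: measurable_cong_sets)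
  ultimately show ?thesis by (rule integrable_const_bound)
qed

text \<open>If \<open>t - c\<close> has a strict sign on \<open>D\<close>, a vector in the range of \<open>E D\<close> has a spectral
  distribution on \<open>D\<close> whose mean is \<open>c\<close>; this is only possible for the zero vector.\<close>

lemma scalar_pvm_one_sided:
  fixes E :: "real set \<Rightarrow> 'a::complex_hilbert_space \<Rightarrow> 'a"
  assumes spec: "is_spectral_measure (\<lambda>x. c *\<^sub>R x) E" and D: "D \<in> sets borel"
    and sign: "\<And>t. t \<in> D \<Longrightarrow> 0 < s * (t - c)"
  shows "E D x = 0"
proof -
  have E: "bounded_pvm E" using spec by (simp add: is_spectral_measure_def)
  define y where "y = E D x"
  let ?M = "scalar_measure E y"
  interpret finite_measure ?M by (rule finite_scalar_measure[OF E])
  have "E D y = y"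
    using E D by (auto simp: y_def bounded_pvm_def projections_def fun_eq_iff)
  then have AE: "AE t in ?M. t \<in> D" by (rule AE_scalar_measure[OF E D])
  have int: "integrable ?M (\<lambda>t. s * (t - c))"
    using integrable_scalar_measure[OF E, of y] by simp
  have "complex_of_real (\<integral>t. t \<partial>?M) = of_real (c * (norm y)\<^sup>2)"
    using spec unfolding is_spectral_measure_def by (metis cinner_scaleR_left cinner_self of_real_mult)
  then have "(\<integral>t. t \<partial>?M) = c * (norm y)\<^sup>2" by (simp only: of_real_eq_iff)
  then have "(\<integral>t. s * (t - c) \<partial>?M) = 0"
    using integrable_scalar_measure[OF E, of y] finite_scalar_measure(2)[OF E, of y]
    by (simp add: scalar_measure_facts(2)[OF E])
  moreover have "AE t in ?M. 0 \<le> s * (t - c)"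
    using AE by eventually_elim (use sign less_imp_le in blast)
  ultimately have "AE t in ?M. s * (t - c) = 0"
    using integral_nonneg_eq_0_iff_AE[OF int] by blast
  then have "AE t in ?M. False"
    using AE by eventually_elim (use sign in force)
  then have "emeasure ?M {t \<in> space ?M. True} = 0"
    by (intro emeasure_eq_0_AE) simp
  then have "(norm y)\<^sup>2 = 0"
    using finite_scalar_measure(2)[OF E, of y] by (simp add: scalar_measure_facts(2)[OF E] measure_def)
  then show ?thesis by (simp add: y_def)
qed

lemma bounded_pvm_add:
  assumes E: "bounded_pvm E" and "D \<inter> D' = {}" "D \<in> sets borel" "D' \<in> sets borel"
  shows "E (D \<union> D') x = E D x + E D' x"
proof -
  have "range (binaryset D D') \<subseteq> sets borel" "disjoint_family (binaryset D D')"
    using assms(2-4) by (auto simp: range_binaryset_eq disjoint_family_on_def binaryset_def)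
  then have "(\<lambda>n. E (binaryset D D' n) x) sums E (\<Union>n. binaryset D D' n) x"
    using E by (simp add: bounded_pvm_def)
  moreover have "(\<lambda>n. E (binaryset D D' n) x) sums (E D x + E D' x)"
    using E by (intro binaryset_sums[where f = "\<lambda>D. E D x"]) (simp add: bounded_pvm_def)
  ultimately show ?thesis
    by (simp add: UN_binaryset_eq sums_unique2)
qed

text \<open>A Borel set that does not contain \<open>c\<close> consists of a part to the right and a part to the left of \<open>c\<close>,
  so its projection is zero; a set that contains \<open>c\<close> has a complement of this kind.\<close>

lemma spectral_range_scalar: "spectral_range (\<lambda>x. c *\<^sub>R x) \<subseteq> {\<lambda>x. 0, id}"
proof -
  have "E D = (\<lambda>x. 0) \<or> E D = id"
    if spec: "is_spectral_measure (\<lambda>x. c *\<^sub>R x) E" and D: "D \<in> sets borel" for E D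
  proof -
    have E: "bounded_pvm E" using spec by (simp add: is_spectral_measure_def)
    have zero: "E B x = 0" if B: "B \<in> sets borel" "c \<notin> B" for B x
    proof -
      have "E (B \<inter> {c<..}) x = 0"
        by (rule scalar_pvm_one_sided[OF spec, where s = 1]) (use B in auto)
      moreover have "E (B \<inter> {..<c}) x = 0"
        by (rule scalar_pvm_one_sided[OF spec, where s = "-1"]) (use B in auto)
      moreover have "E ((B \<inter> {c<..}) \<union> (B \<inter> {..<c})) x = E (B \<inter> {c<..}) x + E (B \<inter> {..<c}) x"
        by (rule bounded_pvm_add[OF E]) (use B in auto)
      moreover have "(B \<inter> {c<..}) \<union> (B \<inter> {..<c}) = B"
        using B(2) by auto (metis linorder_cases)
      ultimately show ?thesis by simp
    qed
    show ?thesis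
    proof (cases "c \<in> D")
      case True
      have "x = E D x" for x
      proof -
        have "E (D \<union> - D) x = E D x + E (- D) x"
          by (rule bounded_pvm_add[OF E]) (use D in auto)
        then show ?thesis
          using zero[of "- D" x] True D E by (simp add: bounded_pvm_def Compl_partition)
      qed
      then show ?thesis by (auto simp: fun_eq_iff)
    qed (use zero D in auto)
  qed
  then show ?thesis by (auto simp: spectral_range_def)
qed

lemma exists_two_values_if_not_scalar:
  fixes A :: "'a::complex_hilbert_space sa"
  assumes "\<nexists>c. A = c *\<^sub>R 1"
  obtains x y where "x \<noteq> 0" "y \<noteq> 0" "form A x / (norm x)\<^sup>2 < form A y / (norm y)\<^sup>2"
proof -
  have "\<exists>x y. x \<noteq> 0 \<and> y \<noteq> 0 \<and> form A x / (norm x)\<^sup>2 \<noteq> form A y / (norm y)\<^sup>2"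
  proof (rule ccontr)
    assume "\<not> ?thesis"
    then have const: "\<And>x y. x \<noteq> 0 \<Longrightarrow> y \<noteq> 0 \<Longrightarrow> form A x / (norm x)\<^sup>2 = form A y / (norm y)\<^sup>2"
      by blast
    define c where "c = form A (SOME x. x \<noteq> 0) / (norm (SOME x :: 'a. x \<noteq> 0))\<^sup>2"
    have "form A x = form (c *\<^sub>R 1) x" for x
    proof (cases "x = 0")
      case False
      then have "(SOME x :: 'a. x \<noteq> 0) \<noteq> 0" by (rule someI)
      then have "form A x / (norm x)\<^sup>2 = c" unfolding c_def by (rule const[OF False])
      then show ?thesis using False by (simp add: field_simps)
    qed (simp add: form_def)
    then have "A = c *\<^sub>R 1" by (rule form_eqI)
    then show False using assms by blast
  qed
  then show ?thesis using that by (metis neq_iff)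
qed

text \<open>A scalar operator has only trivial spectral projections. If \<open>A\<close> is not a scalar, the quotient
  \<open>form A x / (norm x)\<^sup>2\<close> takes two different values, and the smaller one, \<open>r\<close>, cuts the spectrum of
  \<open>A\<close> into two parts with nonzero spectral projections. The range of the projection of either part
  meets itself in more than the zero vector.\<close>

lemma self_complementary_iff_scalar:
  "complementary (app A) (app A) \<longleftrightarrow> (\<exists>c. A = c *\<^sub>R 1)"
proof
  assume "\<exists>c. A = c *\<^sub>R 1"
  then obtain c where "A = c *\<^sub>R 1" by blast
  then have "app A = (\<lambda>x. c *\<^sub>R x)" by (simp add: fun_eq_iff)
  then have "spectral_range (app A) - {\<lambda>x. 0, id} = {}"
    using spectral_range_scalar[of c] by auto
  then show "complementary (app A) (app A)" unfolding complementary_def by blast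
next
  assume compl: "complementary (app A) (app A)"
  show "\<exists>c. A = c *\<^sub>R 1"
  proof (rule ccontr)
    assume "\<not> ?thesis"
    then obtain x y where xy: "x \<noteq> 0" "y \<noteq> 0" "form A x / (norm x)\<^sup>2 < form A y / (norm y)\<^sup>2"
      by (rule exists_two_values_if_not_scalar)
    define r where "r = form A x / (norm x)\<^sup>2"
    obtain E where E: "is_spectral_measure (app A) E"
      "\<And>r x. E {..r} x = x \<Longrightarrow> form A x \<le> r * (norm x)\<^sup>2"
      "\<And>r x. E {..r} x = 0 \<Longrightarrow> x \<noteq> 0 \<Longrightarrow> r * (norm x)\<^sup>2 < form A x"
      using spectral_measure_exists by blast
    let ?P = "E {..r}"
    have "form A x = r * (norm x)\<^sup>2" using xy(1) by (simp add: r_def)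
    then have "?P x \<noteq> 0" using E(3)[of r x] xy(1) by force
    moreover have "r * (norm y)\<^sup>2 < form A y"
      using xy(2,3) by (simp add: r_def[symmetric] field_simps)
    then have "?P y \<noteq> y" using E(2)[of r y] by force
    ultimately have nontrivial: "?P \<noteq> (\<lambda>x. 0)" "?P \<noteq> id" by auto
    have "{..r} \<in> sets borel" by simp
    then have "?P \<in> spectral_range (app A)"
      unfolding spectral_range_def using E(1) by blast
    then have "range ?P \<inter> range ?P = {0}"
      using compl nontrivial unfolding complementary_def by blast
    then have "?P x \<in> {0}" by blast
    then show False using \<open>?P x \<noteq> 0\<close> by simp
  qed
qed

section \<open>The automorphisms\<close>

text \<open>Otherwise both \<open>x\<close> and \<open>y\<close> would be multiples of \<open>v\<close>.\<close>

lemma orthogonal_vector_exists: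
  fixes x y v :: "'a::complex_hilbert_space"
  assumes "x \<noteq> y" "complex_vector.independent {x, y}"
  shows "\<exists>e. e \<noteq> 0 \<and> cinner e v = 0"
proof (rule ccontr)
  assume none: "\<not> ?thesis"
  obtain c w where x: "x = w + c *\<^sub>C v" "cinner w v = 0" by (rule orthogonal_decomposition)
  obtain d u where y: "y = u + d *\<^sub>C v" "cinner u v = 0" by (rule orthogonal_decomposition)
  have xy: "x = c *\<^sub>C v" "y = d *\<^sub>C v" using none x y by auto
  have "x \<noteq> 0" "y \<notin> complex_vector.span {x}"
    using assms complex_vector.independent_insert[of y "{x}"] complex_vector.dependent_zero[of "{x, y}"]
    by (auto simp: insert_commute)
  moreover have "y = (d / c) *\<^sub>C x" using \<open>x \<noteq> 0\<close> by (simp add: xy scaleC_scaleC)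
  ultimately show False
    by (metis complex_vector.span_base complex_vector.span_scale insertI1)
qed

lemma semiunitary_cases:
  assumes "semiunitary U \<sigma>"
  shows "unitary_op U \<and> is_adjoint U (inv U) \<or> antiunitary_op U \<and> is_conj_adjoint U (inv U)"
proof -
  interpret semiunitary U \<sigma> by (rule assms)
  interpret I: semiunitary "inv U" \<sigma> by (rule semiunitary_inv)
  have move: "cinner (U x) y = twist \<sigma> (cinner x (inv U y))" for x y
    using cinner_U[of x "inv U y"] by (simp add: inv_U)
  consider "\<sigma> = 1" | "\<sigma> = -1" using sign by blast
  then show ?thesis
  proof cases
    case 1
    then have twist: "twist \<sigma> c = c" for c by (simp add: twist_def)
    have "bounded_linear U"
      by (rule bounded_linear_intro[where K = 1]) (simp_all add: U_add U_scaleR norm_U)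
    then have "bounded_clinear U"
      by (simp add: bounded_clinear_def U_scaleC twist)
    moreover have "is_adjoint U (inv U)" by (simp add: is_adjoint_def move twist)
    moreover have "inv U \<circ> U = id" "U \<circ> inv U = id" by (auto simp: fun_eq_iff inv_U)
    ultimately show ?thesis by (auto simp: unitary_op_def)
  next
    case 2
    then have twist: "twist \<sigma> c = cnj c" for c by (simp add: twist_def complex_eq_iff)
    have "antiunitary_op U"
      by (simp add: antiunitary_op_def conjugate_linear_def U_add U_scaleC twist bij_U norm_U)
    moreover have "is_conj_adjoint U (inv U)"
      by (simp add: is_conj_adjoint_def conjugate_linear_def I.U_add I.U_scaleC twist move
          flip: cinner_commute)
    ultimately show ?thesis by blast
  qed
qed

theorem corollary4:
  fixes \<phi> :: "('a::complex_hilbert_space \<Rightarrow> 'a) \<Rightarrow> ('a \<Rightarrow> 'a)"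
  assumes dim: "\<exists>x y :: 'a. x \<noteq> y \<and> complex_vector.independent {x, y}"
    and bij: "bij_betw \<phi> selfadjoint_ops selfadjoint_ops"
    and order: "\<And>A B. A \<in> selfadjoint_ops \<Longrightarrow> B \<in> selfadjoint_ops \<Longrightarrow>
                  op_le A B \<longleftrightarrow> op_le (\<phi> A) (\<phi> B)"
    and compl: "\<And>A B. A \<in> selfadjoint_ops \<Longrightarrow> B \<in> selfadjoint_ops \<Longrightarrow>
                  complementary A B \<longleftrightarrow> complementary (\<phi> A) (\<phi> B)"
  shows "\<exists>(U :: 'a \<Rightarrow> 'a) (Us :: 'a \<Rightarrow> 'a) (l :: real) (m :: real).
           (unitary_op U \<and> is_adjoint U Us \<or> antiunitary_op U \<and> is_conj_adjoint U Us) \<and>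
           l > 0 \<and>
           (\<forall>A\<in>selfadjoint_ops. \<phi> A = (\<lambda>x. l *\<^sub>R U (A (Us x)) + m *\<^sub>R x))"
proof -
  define \<Phi> where "\<Phi> A = Abs_sa (\<phi> (app A))" for A
  have app_\<Phi>: "app (\<Phi> A) = \<phi> (app A)" for A
    unfolding \<Phi>_def using bij app[of A] by (intro Abs_sa_inverse) (auto simp: bij_betw_def)
  have \<Phi>_order: "A \<le> B \<longleftrightarrow> \<Phi> A \<le> \<Phi> B" for A B
    unfolding op_le_app[symmetric] app_\<Phi> by (rule order) (rule app)+
  have \<Phi>_surj: "\<exists>A. \<Phi> A = B" for B
  proof -
    obtain f where f: "f \<in> selfadjoint_ops" "app B = \<phi> f"
      using bij app[of B] unfolding bij_betw_def by blast
    then have "app (\<Phi> (Abs_sa f)) = app B" by (simp add: app_\<Phi> Abs_sa_inverse)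
    then show ?thesis by (auto simp: app_inject)
  qed
  \<comment> \<open>Scalars are the self-complementary operators, and \<open>\<phi>\<close> preserves self-complementarity.\<close>
  have scalar: "\<exists>c. \<Phi> (r *\<^sub>R 1) = c *\<^sub>R 1" for r
    using compl[OF app app, of "r *\<^sub>R 1" "r *\<^sub>R 1"]
    unfolding app_\<Phi>[symmetric] self_complementary_iff_scalar by blast
  obtain m where m: "\<Phi> 0 = m *\<^sub>R 1" using scalar[of 0] by auto
  obtain k where k: "\<Phi> 1 = k *\<^sub>R 1" using scalar[of 1] by auto
  obtain v :: 'a where v: "v \<noteq> 0"
    using dim orthogonal_vector_exists by blast
  have le_scalar: "a *\<^sub>R 1 \<le> b *\<^sub>R (1 :: 'a sa) \<longleftrightarrow> a \<le> b" for a b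
    using v by (auto simp: le_form mult_right_mono mult_le_cancel_right dest!: spec[of _ v])
  have "m \<le> k" "\<not> k \<le> m"
    using \<Phi>_order[of 0 1] \<Phi>_order[of 1 0] le_scalar[of 0 1] le_scalar[of 1 0]
    by (simp_all add: m k le_scalar)
  then have l: "k - m > 0" by simp
  \<comment> \<open>The affine normalisation is an order automorphism because \<open>k - m\<close> is positive.\<close>
  define \<Psi> where "\<Psi> A = (1 / (k - m)) *\<^sub>R (\<Phi> A - m *\<^sub>R 1)" for A
  have \<Phi>_eq: "\<Phi> A = (k - m) *\<^sub>R \<Psi> A + m *\<^sub>R 1" for A
    using l by (simp add: \<Psi>_def)
  have aut: "order_automorphism \<Psi>"
  proof
    show le: "A \<le> B \<longleftrightarrow> \<Psi> A \<le> \<Psi> B" for A B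
    proof -
      have "\<Phi> A \<le> \<Phi> B \<longleftrightarrow> \<Psi> A \<le> \<Psi> B"
        using l by (simp add: \<Phi>_eq le_form)
      then show ?thesis using \<Phi>_order by blast
    qed
    have "inj \<Psi>"
    proof (rule injI)
      fix A B assume "\<Psi> A = \<Psi> B"
      then have "A \<le> B" "B \<le> A" using le[of A B] le[of B A] by simp_all
      then show "A = B" by (rule antisym)
    qed
    moreover have "surj \<Psi>"
      unfolding surj_def
    proof
      fix B
      obtain A where "\<Phi> A = (k - m) *\<^sub>R B + m *\<^sub>R 1" using \<Phi>_surj by blast
      then have "B = \<Psi> A" using l by (simp add: \<Psi>_def)
      then show "\<exists>A. B = \<Psi> A" ..
    qed
    ultimately show "bij \<Psi>" by (simp add: bij_def)
  qed
  have "\<Psi> 0 = 0" "\<Psi> 1 = 1"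
    using l by (simp_all add: \<Psi>_def m k flip: scaleR_diff_left)
  moreover have "\<exists>e :: 'a. e \<noteq> 0 \<and> cinner e x = 0" for x
    using dim orthogonal_vector_exists by blast
  ultimately obtain U \<sigma> where U: "semiunitary U \<sigma>"
    and \<Psi>: "\<And>A. app (\<Psi> A) = (\<lambda>x. U (app A (inv U x)))"
    using normalised_order_automorphism[OF aut] by blast
  have "\<phi> A = (\<lambda>x. (k - m) *\<^sub>R U (A (inv U x)) + m *\<^sub>R x)" if "A \<in> selfadjoint_ops" for A
  proof -
    have "\<phi> A = app (\<Phi> (Abs_sa A))" using that by (simp add: app_\<Phi> Abs_sa_inverse)
    also have "\<dots> = (\<lambda>x. (k - m) *\<^sub>R app (\<Psi> (Abs_sa A)) x + m *\<^sub>R x)"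
      unfolding \<Phi>_eq by (simp add: fun_eq_iff)
    finally show ?thesis using that by (simp add: \<Psi> Abs_sa_inverse)
  qed
  then show ?thesis
    using semiunitary_cases[OF U] l by blast
qed

end
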